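(* Let the inequality $$\sup_{x\in\mathcal{P}_{\mathcal{R}_0/2}}\|b^n\|_{\mathcal{X},\mathcal{P}_{\rho}(x')\cap\Omega}\leqslant\mathfrak{B}\,\sigma(\rho/\mathcal{R}_0)$$ hold for all $\rho\leqslant\mathcal{R}_0/2$, where $\mathfrak{B}>0$ is a constant and $\sigma\in\mathcal{D}_1$ satisfies $\mathcal{J}_{\sigma}(t)=o(\delta(t))$ as $t\to0$. Let $u\in\mathcal{W}^2_{\mathcal{X},loc}(\Omega)\cap C(\overline{\Omega})$ satisfy $\mathcal{L}u=0$ in $\Omega$ and $u|_{\partial\Omega\cap\overline{\mathcal{P}}_{\mathcal{R}_0}}=0$. Then there exists a sufficiently small $R_0>0$, determined by $n$, $\nu$, $\mathcal{R}_0$, $\mathfrak{B}$, the functions $\sigma,\delta$ and the moduli of continuity of $|\mathbf{b}'|$ in $\mathcal{X}(\Omega)$, such that for every $r\in(0,R_0/2)$ $$\underset{\Omega\cap\mathcal{P}_{r/4}}{\mathrm{osc}}\frac{u(x)}{x_n}\leqslant(1-\varkappa\,\delta(r))\,\underset{\Omega\cap\mathcal{P}_{2r}}{\mathrm{osc}}\frac{u(x)}{x_n},$$ where $\varkappa\in(0,1)$ depends only on $n$ and $\nu$.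
   Context: Notation: $x=(x',x_n)\in\mathbb{R}^n$; $\mathcal{P}_{r,h}(\overline{x}')=\{x\in\mathbb{R}^n:|x'-\overline{x}'|<r,\ 0<x_n<h\}$, $\mathcal{P}_r(\overline{x}')=\mathcal{P}_{r,r}(\overline{x}')$, $\mathcal{P}_r=\mathcal{P}_r(0)$; $v_+=\max\{v,0\}$, $v_-=\max\{-v,0\}$; $D_i$ is the weak derivative in $x_i$, summation over repeated indices. $\mathcal{L}u=-a^{ij}(x)D_iD_ju+b^i(x)D_iu$ with measurable coefficients, $\nu\mathcal{I}_n\leqslant(a^{ij}(x))\leqslant\nu^{-1}\mathcal{I}_n$, $\mathbf{b}=(b^1,\dots,b^n)$, $\mathbf{b}'=(b^1,\dots,b^{n-1})$. A function $\sigma:[0,1]\to\mathbb{R}_+$ is in the class $\mathcal{D}_1$ if $\sigma$ is increasing, $\sigma(0)=0$, $\sigma(1)=1$, and $\sigma(t)/t$ is summable and decreasing; $\mathcal{J}_\sigma(s)=\int_0^s\frac{\sigma(\tau)}{\tau}d\tau$. Function space: $\mathcal{X}(\Omega)$ is a space of measurable functions on a bounded domain $\Omega\subset\mathbb{R}^n$ with norm $\|\cdot\|_{\mathcal{X},\Omega}$, and $\|f\|_{\mathcal{X},\Omega_1}=\|f\chi_{\Omega_1}\|_{\mathcal{X},\Omega}$ for $\Omega_1\subset\Omega$. It satisfies: (i) if $g$ is measurable, $f\in\mathcal{X}(\Omega)$ and $|g|\leqslant|f|$, then $g\in\mathcal{X}(\Omega)$ and $\|g\|_{\mathcal{X},\Omega}\leqslant\|f\|_{\mathcal{X},\Omega}$;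 (ii) $f_k\in\mathcal{X}(\Omega)$, $f_k\searrow0$ a.e. implies $\|f_k\|_{\mathcal{X},\Omega}\to0$; (iii) $\mathcal{X}_{loc}(\Omega)$ contains the Orlicz space $L_{\Phi,loc}(\Omega)$ with $\Phi(\varsigma)=e^\varsigma-\varsigma-1$; (iv) Aleksandrov-type maximum principle: denoting by $\mathcal{W}^2_{\mathcal{X},loc}(\Omega)$ the set of $u$ with $D(Du)\in\mathcal{X}_{loc}(\Omega)$, if $u\in\mathcal{W}^2_{\mathcal{X},loc}(\Omega)\cap C(\overline{\Omega})$, $u|_{\partial\Omega}\leqslant0$ and $|\mathbf{b}|\in\mathcal{X}(\Omega)$, then $u\leqslant N_0(n,\nu,\|\mathbf{b}\|_{\mathcal{X},\Omega})\,\mathrm{diam}(\Omega)\,\|(\mathcal{L}u)_+\|_{\mathcal{X},\{u>0\}}$ (the basic example is $\mathcal{X}=L_n$). The modulus of continuity of $f$ in $\mathcal{X}(\Omega)$ is $\mu(\rho)=\sup_{x\in\Omega}\|f\|_{\mathcal{X},B_\rho(x)\cap\Omega}$. Domain: $\Omega$ is bounded, $0\in\partial\Omega$, and for some $0<\mathcal{R}_0\leqslant1$, $\mathcal{P}_{\mathcal{R}_0}\cap\Omega=\{(x',x_n):|x'|\leqslant\mathcal{R}_0,\ F(x')<x_n<\mathcal{R}_0\}$ with $F$ convex, nonnegative, $F(0)=0$; $\delta(r)=\max_{|x'|\leqslant r}F(x')/|x'|$, and it is assumed that $\delta(r)\to0$ as $r\to0$. Throughout, $|\mathbf{b}|\in\mathcal{X}(\Omega)$.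 *)

theory Defs
  imports "HOL-Analysis.Analysis" "HOL-Library.Landau_Symbols"
begin

text \<open>Points of R^n are pairs (x', x_n) with x' in 'a = R^(n-1).\<close>

definition bounded_domain :: "'x::euclidean_space set \<Rightarrow> bool" where
  "bounded_domain \<Omega> \<longleftrightarrow> open \<Omega> \<and> connected \<Omega> \<and> bounded \<Omega> \<and> \<Omega> \<noteq> {}"

text \<open>Cylinder P_{r,h}(xb') and P_r(xb') = P_{r,r}(xb').\<close>
definition Pcyl :: "real \<Rightarrow> real \<Rightarrow> 'a::euclidean_space \<Rightarrow> ('a \<times> real) set" where
  "Pcyl r h xb = {x. norm (fst x - xb) < r \<and> 0 < snd x \<and> snd x < h}"

definition pd :: "'x::euclidean_space \<Rightarrow> ('x \<Rightarrow> real) \<Rightarrow> ('x \<Rightarrow> real)" where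
  "pd e \<phi> = (\<lambda>x. frechet_derivative \<phi> (at x) e)"

definition smooth_fun :: "('x::euclidean_space \<Rightarrow> real) \<Rightarrow> bool" where
  "smooth_fun \<phi> \<longleftrightarrow> (\<forall>es. set es \<subseteq> Basis \<longrightarrow> (\<forall>x. foldr pd es \<phi> differentiable (at x)))"

definition test_fun :: "'x::euclidean_space set \<Rightarrow> ('x \<Rightarrow> real) \<Rightarrow> bool" where
  "test_fun U \<phi> \<longleftrightarrow> smooth_fun \<phi> \<and> (\<exists>K. compact K \<and> K \<subseteq> U \<and> (\<forall>x. x \<notin> K \<longrightarrow> \<phi> x = 0))"

definition loc_integrable :: "'x::euclidean_space set \<Rightarrow> ('x \<Rightarrow> real) \<Rightarrow> bool" where
  "loc_integrable U f \<longleftrightarrow> (\<forall>K. compact K \<and> K \<subseteq> U \<longrightarrow> set_integrable lebesgue K f)"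

definition weak_deriv :: "'x::euclidean_space set \<Rightarrow> ('x \<Rightarrow> real) \<Rightarrow> 'x \<Rightarrow> ('x \<Rightarrow> real) \<Rightarrow> bool" where
  "weak_deriv U f e g \<longleftrightarrow> loc_integrable U f \<and> loc_integrable U g \<and>
     (\<forall>\<phi>. test_fun U \<phi> \<longrightarrow>
        (LINT x:U|lebesgue. f x * pd e \<phi> x) = - (LINT x:U|lebesgue. g x * \<phi> x))"

text \<open>Xn S f is the norm of f in X over S (i.e. the paper's ||f||_{X,S}), value \<infinity> if f is not in X(S).\<close>

definition X_mem :: "('x::euclidean_space set \<Rightarrow> ('x \<Rightarrow> real) \<Rightarrow> ennreal) \<Rightarrow> 'x set \<Rightarrow> ('x \<Rightarrow> real) \<Rightarrow> bool" where
  "X_mem Xn \<Omega> f \<longleftrightarrow> f \<in> borel_measurable lebesgue \<and> Xn \<Omega> f < \<infinity>"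

definition X_loc :: "('x::euclidean_space set \<Rightarrow> ('x \<Rightarrow> real) \<Rightarrow> ennreal) \<Rightarrow> 'x set \<Rightarrow> ('x \<Rightarrow> real) \<Rightarrow> bool" where
  "X_loc Xn \<Omega> f \<longleftrightarrow> f \<in> borel_measurable lebesgue \<and>
     (\<forall>\<Omega>'. bounded_domain \<Omega>' \<and> closure \<Omega>' \<subseteq> \<Omega> \<longrightarrow> Xn \<Omega>' f < \<infinity>)"

definition Phi_orlicz :: "real \<Rightarrow> real" where
  "Phi_orlicz s = exp s - s - 1"

definition Orlicz_loc :: "'x::euclidean_space set \<Rightarrow> ('x \<Rightarrow> real) \<Rightarrow> bool" where
  "Orlicz_loc \<Omega> f \<longleftrightarrow> f \<in> borel_measurable lebesgue \<and>
     (\<forall>K. compact K \<and> K \<subseteq> \<Omega> \<longrightarrow>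
        (\<exists>lam>0. set_integrable lebesgue K (\<lambda>x. Phi_orlicz (\<bar>f x\<bar> / lam))))"

definition X_space :: "('x::euclidean_space set \<Rightarrow> ('x \<Rightarrow> real) \<Rightarrow> ennreal) \<Rightarrow> bool" where
  "X_space Xn \<longleftrightarrow> (\<forall>\<Omega>. bounded_domain \<Omega> \<longrightarrow>
     (\<forall>S f. S \<subseteq> \<Omega> \<longrightarrow> Xn S f = Xn \<Omega> (\<lambda>x. indicator S x * f x)) \<and>
     (\<forall>f g. f \<in> borel_measurable lebesgue \<longrightarrow> g \<in> borel_measurable lebesgue \<longrightarrow>
        Xn \<Omega> (\<lambda>x. f x + g x) \<le> Xn \<Omega> f + Xn \<Omega> g) \<and>
     (\<forall>f c. f \<in> borel_measurable lebesgue \<longrightarrow> Xn \<Omega> (\<lambda>x. c * f x) = ennreal \<bar>c\<bar> * Xn \<Omega> f) \<and>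
     (\<forall>f. f \<in> borel_measurable lebesgue \<longrightarrow>
        (Xn \<Omega> f = 0 \<longleftrightarrow> (AE x in lebesgue. x \<in> \<Omega> \<longrightarrow> f x = 0))) \<and>
     (\<forall>f g. g \<in> borel_measurable lebesgue \<longrightarrow> X_mem Xn \<Omega> f \<longrightarrow>
        (\<forall>x\<in>\<Omega>. \<bar>g x\<bar> \<le> \<bar>f x\<bar>) \<longrightarrow> X_mem Xn \<Omega> g \<and> Xn \<Omega> g \<le> Xn \<Omega> f) \<and>
     (\<forall>fs :: nat \<Rightarrow> 'x \<Rightarrow> real. (\<forall>k. X_mem Xn \<Omega> (fs k)) \<longrightarrow>
        (AE x in lebesgue. x \<in> \<Omega> \<longrightarrow> (\<forall>k. fs (Suc k) x \<le> fs k x) \<and> (\<lambda>k. fs k x) \<longlonglongrightarrow> 0) \<longrightarrow>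
        (\<lambda>k. Xn \<Omega> (fs k)) \<longlonglongrightarrow> 0) \<and>
     (\<forall>f. Orlicz_loc \<Omega> f \<longrightarrow> X_loc Xn \<Omega> f))"

definition elliptic :: "real \<Rightarrow> 'x::euclidean_space set \<Rightarrow> ('x \<Rightarrow> 'x \<Rightarrow> 'x \<Rightarrow> real) \<Rightarrow> bool" where
  "elliptic \<nu> \<Omega> a \<longleftrightarrow>
     (\<forall>i\<in>Basis. \<forall>j\<in>Basis. (\<lambda>x. a x i j) \<in> borel_measurable lebesgue) \<and>
     (\<forall>x\<in>\<Omega>. (\<forall>i\<in>Basis. \<forall>j\<in>Basis. a x i j = a x j i) \<and>
        (\<forall>\<xi>. \<nu> * (norm \<xi>)\<^sup>2 \<le> (\<Sum>i\<in>Basis. \<Sum>j\<in>Basis. a x i j * (\<xi> \<bullet> i) * (\<xi> \<bullet> j)) \<and>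
              (\<Sum>i\<in>Basis. \<Sum>j\<in>Basis. a x i j * (\<xi> \<bullet> i) * (\<xi> \<bullet> j)) \<le> (norm \<xi>)\<^sup>2 / \<nu>))"

definition W2Xloc :: "('x::euclidean_space set \<Rightarrow> ('x \<Rightarrow> real) \<Rightarrow> ennreal) \<Rightarrow> 'x set \<Rightarrow> ('x \<Rightarrow> real)
    \<Rightarrow> ('x \<Rightarrow> 'x \<Rightarrow> real) \<Rightarrow> ('x \<Rightarrow> 'x \<Rightarrow> 'x \<Rightarrow> real) \<Rightarrow> bool" where
  "W2Xloc Xn \<Omega> u Du D2u \<longleftrightarrow> (\<forall>j\<in>Basis. weak_deriv \<Omega> u j (Du j) \<and>
     (\<forall>i\<in>Basis. weak_deriv \<Omega> (Du j) i (D2u i j) \<and> X_loc Xn \<Omega> (D2u i j)))"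

definition Lop :: "('x::euclidean_space \<Rightarrow> 'x \<Rightarrow> 'x \<Rightarrow> real) \<Rightarrow> ('x \<Rightarrow> 'x)
    \<Rightarrow> ('x \<Rightarrow> 'x \<Rightarrow> real) \<Rightarrow> ('x \<Rightarrow> 'x \<Rightarrow> 'x \<Rightarrow> real) \<Rightarrow> 'x \<Rightarrow> real" where
  "Lop a b Du D2u x = - (\<Sum>i\<in>Basis. \<Sum>j\<in>Basis. a x i j * D2u i j x) + (\<Sum>i\<in>Basis. (b x \<bullet> i) * Du i x)"

definition Aleksandrov :: "('x::euclidean_space set \<Rightarrow> ('x \<Rightarrow> real) \<Rightarrow> ennreal) \<Rightarrow> bool" where
  "Aleksandrov Xn \<longleftrightarrow> (\<exists>N0 :: real \<Rightarrow> real \<Rightarrow> real.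
     \<forall>\<Omega> \<nu> a b u Du D2u. bounded_domain \<Omega> \<and> 0 < \<nu> \<and> elliptic \<nu> \<Omega> a \<and>
       b \<in> borel_measurable lebesgue \<and> X_mem Xn \<Omega> (\<lambda>x. norm (b x)) \<and>
       W2Xloc Xn \<Omega> u Du D2u \<and> continuous_on (closure \<Omega>) u \<and> (\<forall>x\<in>frontier \<Omega>. u x \<le> 0)
     \<longrightarrow> (\<forall>x\<in>\<Omega>. ennreal (u x) \<le>
            ennreal (N0 \<nu> (enn2real (Xn \<Omega> (\<lambda>x. norm (b x)))) * diameter \<Omega>) *
            Xn {y\<in>\<Omega>. u y > 0} (\<lambda>y. max (Lop a b Du D2u y) 0)))"

definition class_D1 :: "(real \<Rightarrow> real) \<Rightarrow> bool" where
  "class_D1 \<sigma> \<longleftrightarrow> (\<forall>t\<in>{0..1}. 0 \<le> \<sigma> t) \<and> mono_on {0..1} \<sigma> \<and> \<sigma> 0 = 0 \<and> \<sigma> 1 = 1 \<and>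
     set_integrable lborel {0<..1} (\<lambda>t. \<sigma> t / t) \<and>
     (\<forall>s t. 0 < s \<and> s \<le> t \<and> t \<le> 1 \<longrightarrow> \<sigma> t / t \<le> \<sigma> s / s)"

definition J_sigma :: "(real \<Rightarrow> real) \<Rightarrow> real \<Rightarrow> real" where
  "J_sigma \<sigma> s = (LINT t:{0<..s}|lborel. \<sigma> t / t)"

definition X_modulus :: "('x::euclidean_space set \<Rightarrow> ('x \<Rightarrow> real) \<Rightarrow> ennreal) \<Rightarrow> 'x set \<Rightarrow> ('x \<Rightarrow> real) \<Rightarrow> real \<Rightarrow> ennreal" where
  "X_modulus Xn \<Omega> f \<rho> = (SUP x\<in>\<Omega>. Xn (ball x \<rho> \<inter> \<Omega>) f)"

definition osc :: "'x set \<Rightarrow> ('x \<Rightarrow> real) \<Rightarrow> ereal" where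
  "osc S f = (SUP x\<in>S. ereal (f x)) - (INF x\<in>S. ereal (f x))"

end

theory Submission
  imports Defs
begin

text \<open>Let \<open>M\<close> and \<open>m\<close> be the supremum and the infimum of \<open>u/x\<^sub>n\<close> over \<open>\<Omega> \<inter> \<P>\<^sub>2\<^sub>r\<close>. Since \<open>u\<close> vanishes at boundary
  points of positive height, \<open>m \<le> 0 \<le> M\<close>, and after replacing \<open>u\<close> by \<open>-u\<close> one may assume \<open>M \<ge> (M - m)/2\<close>.
  The function \<open>w = M x\<^sub>n - u\<close> is nonnegative, satisfies \<open>\<L>w = M b\<^sup>n\<close>, and equals \<open>M x\<^sub>n\<close> on \<open>\<partial>\<Omega>\<close>. By convexity
  \<open>F \<ge> r \<delta>(r)\<close> on a ball of radius \<open>r/4\<close>, so \<open>w \<ge> M r \<delta>(r)\<close> on the part of the boundary above it. Gaussian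
  barriers and a chain of balls spread the bound \<open>w \<ge> c M r \<delta>(r)\<close> to the points of height comparable to \<open>r\<close>,
  with a first linear bound \<open>w \<ge> k x\<^sub>n - E\<close> below them. Quadratic barriers in cylinders of radii
  \<open>4\<^sup>-\<^sup>j r\<close> remove the defect \<open>E\<close>: the total loss of slope is controlled by \<open>\<J>\<^sub>\<sigma>(r) = o(\<delta>(r))\<close>, and
  since \<open>\<L>x\<^sub>n = b\<^sup>n\<close> the component \<open>b'\<close> needs only to be small, not Dini. Hence \<open>w \<ge> \<kappa> M \<delta>(r) x\<^sub>n\<close> in
  \<open>\<Omega> \<inter> \<P>\<^sub>r\<^sub>/\<^sub>4\<close>.\<close>

subsection \<open>Weak derivatives\<close>

text \<open>The maximum principle controls only an additive error, proportional to the diameter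
  times a norm of the drift, while the wanted bound is proportional to x_n. A single barrier
  therefore leaves a defect, which has to be reduced scale by scale. In such an error b' is
  multiplied by the tangential gradient of the barrier, which has the size of the bound already
  known, so a small factor suffices at every scale. In contrast b^n meets the slope M of M x_n,
  larger by the factor 1/\<delta>(r); its contributions at all scales must add up to a small part of
  M \<delta>(r), and this is where the integral of \<sigma>(t)/t enters. Smallness of \<delta>(r)
  serves another purpose: w = M x_n on the boundary of \<Omega>, and a barrier of height M r
  \<delta>(r) must not rise above M x_n near low boundary points. Lengths such as r/64 and the
  number 512 of steps are tied to r by fixed ratios, so the constants depend on the dimension, \<nu>
  and the space alone. The radius is chosen before the domain and the solution are known, hence only
  from \<sigma>, \<delta>, the modulus of b' and the numerical data.\<close>

lemma has_derivative_zero_outside_support: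
  fixes f :: "'x::euclidean_space \<Rightarrow> real"
  assumes "(f has_derivative f') (at x)" "compact K" "\<And>x. x \<notin> K \<Longrightarrow> f x = 0" "x \<notin> K"
  shows "f' = (\<lambda>_. 0)"
proof -
  have "(f has_derivative (\<lambda>_. 0)) (at x)"
    by (rule has_derivative_transform_within_open[of "\<lambda>_. 0" _ _ _ "- K"])
       (use assms in \<open>auto simp: compact_imp_closed open_Compl\<close>)
  then show ?thesis
    using assms(1) has_derivative_unique by blast
qed

text \<open>Lebesgue measure is translation invariant, so every difference quotient of
  \<open>f\<close> has integral 0. By the mean value theorem the quotients are bounded on one fixed
  ball and converge to the derivative; dominated convergence does the rest. Applied to a product
  with a test function this becomes integration by parts.\<close>

lemma integral_directional_derivative_eq_0:
  fixes f :: "'x::euclidean_space \<Rightarrow> real"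
  assumes d: "\<And>x. (f has_derivative f' x) (at x)"
    and c: "continuous_on UNIV (\<lambda>x. f' x e)"
    and K: "compact K" "\<And>x. x \<notin> K \<Longrightarrow> f x = 0"
  shows "(LINT x|lebesgue. f' x e) = 0"
proof -
  have cf: "continuous_on UNIV f"
    using d by (meson continuous_at_imp_continuous_on has_derivative_continuous)
  have z: "f' x e = 0" if "x \<notin> K" for x
    using has_derivative_zero_outside_support[OF d K that] by simp
  obtain B where B: "\<And>x. \<bar>f' x e\<bar> \<le> B" "0 \<le> B"
  proof -
    have "bounded ((\<lambda>x. f' x e) ` K)"
      using c K(1) by (meson compact_continuous_image compact_imp_bounded continuous_on_subset subset_UNIV)
    then obtain B where B: "\<And>x. x \<in> K \<Longrightarrow> \<bar>f' x e\<bar> \<le> B"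
      unfolding bounded_iff by auto
    have "\<bar>f' x e\<bar> \<le> max B 0" for x
      using B[of x] z[of x] by (cases "x \<in> K") auto
    then show ?thesis
      using that[of "max B 0"] by simp
  qed
  obtain R where R: "\<And>x. x \<in> K \<Longrightarrow> norm x \<le> R"
    using compact_imp_bounded[OF K(1)] unfolding bounded_iff by blast
  define s where "s k x = (f (x + (1 / real (Suc k)) *\<^sub>R e) - f x) * real (Suc k)" for k x
  have mv: "\<exists>\<xi>. 0 < \<xi> \<and> \<xi> < 1 / real (Suc k) \<and> s k x = f' (x + \<xi> *\<^sub>R e) e" for k x
  proof -
    have D: "((\<lambda>t. f (x + t *\<^sub>R e)) has_real_derivative f' (x + t *\<^sub>R e) e) (at t)" for t
    proof -
      have "((\<lambda>t. f (x + t *\<^sub>R e)) has_derivative (\<lambda>h. f' (x + t *\<^sub>R e) (h *\<^sub>R e))) (at t)"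
        by (rule has_derivative_compose[where f = "\<lambda>t. x + t *\<^sub>R e", OF _ d]) (auto intro!: derivative_eq_intros)
      moreover have "f' (x + t *\<^sub>R e) (h *\<^sub>R e) = f' (x + t *\<^sub>R e) e * h" for h
        using linear_cmul[OF has_derivative_linear[OF d[of "x + t *\<^sub>R e"]]] by simp
      ultimately show ?thesis
        by (simp add: has_field_derivative_def)
    qed
    obtain \<xi> where "0 < \<xi>" "\<xi> < 1 / real (Suc k)"
      "f (x + (1 / real (Suc k)) *\<^sub>R e) - f (x + 0 *\<^sub>R e) = (1 / real (Suc k) - 0) * f' (x + \<xi> *\<^sub>R e) e"
      using MVT2[of 0 "1 / real (Suc k)" "\<lambda>t. f (x + t *\<^sub>R e)" "\<lambda>t. f' (x + t *\<^sub>R e) e"] D by auto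
    then show ?thesis
      by (intro exI[of _ \<xi>]) (auto simp: s_def field_simps)
  qed
  have lim: "(\<lambda>k. s k x) \<longlonglongrightarrow> f' x e" for x
  proof -
    obtain \<xi> where \<xi>: "\<And>k. 0 < \<xi> k" "\<And>k. \<xi> k < 1 / real (Suc k)" "\<And>k. s k x = f' (x + \<xi> k *\<^sub>R e) e"
      using mv[of _ x] by metis
    have "\<xi> \<longlonglongrightarrow> 0"
      by (rule tendsto_sandwich[of "\<lambda>_. 0" _ _ "\<lambda>k. 1 / real (Suc k)"])
         (use \<xi> LIMSEQ_inverse_real_of_nat in \<open>auto simp: less_imp_le inverse_eq_divide\<close>)
    then have "(\<lambda>k. x + \<xi> k *\<^sub>R e) \<longlonglongrightarrow> x + 0 *\<^sub>R e"
      by (intro tendsto_intros)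
    then have "(\<lambda>k. f' (x + \<xi> k *\<^sub>R e) e) \<longlonglongrightarrow> f' x e"
      using isCont_tendsto_compose[of x "\<lambda>x. f' x e"] c by (simp add: continuous_on_eq_continuous_at)
    then show ?thesis by (simp add: \<xi>)
  qed
  \<comment> \<open>A shift of length at most \<open>norm e\<close> cannot carry a point from
    outside the larger ball into \<open>K\<close>.\<close>
  have bd: "\<bar>s k x\<bar> \<le> B * indicator (cball 0 (R + norm e)) x" for k x
  proof (cases "norm x \<le> R + norm e")
    case True
    then show ?thesis using mv[of k x] B by auto
  next
    case False
    have *: "norm ((1 / real (Suc k)) *\<^sub>R e) \<le> norm e"
      by (simp add: divide_le_eq mult_le_cancel_left1)
    have "norm x \<le> norm (x + (1 / real (Suc k)) *\<^sub>R e) + norm ((1 / real (Suc k)) *\<^sub>R e)"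
      by (metis add_diff_cancel_right' norm_triangle_ineq4)
    then have "\<not> norm (x + (1 / real (Suc k)) *\<^sub>R e) \<le> R" "\<not> norm x \<le> R"
      using False * norm_ge_zero[of e] by linarith+
    then have "x + (1 / real (Suc k)) *\<^sub>R e \<notin> K" "x \<notin> K"
      using R by blast+
    then show ?thesis using False K by (simp add: s_def)
  qed
  have int: "integrable lborel (\<lambda>x. f (x + a))" for a
  proof -
    have "integrable lborel (\<lambda>x. indicator ((\<lambda>y. y - a) ` K) x *\<^sub>R f (x + a))"
      by (rule borel_integrable_compact)
         (auto intro!: continuous_intros compact_continuous_image continuous_on_compose2[OF cf] K)
    moreover have "indicator ((\<lambda>y. y - a) ` K) x *\<^sub>R f (x + a) = f (x + a)" for x
    proof (cases "x + a \<in> K")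
      case True
      then have "x \<in> (\<lambda>y. y - a) ` K" by (intro image_eqI[of _ _ "x + a"]) auto
      then show ?thesis by simp
    qed (simp add: K)
    ultimately show ?thesis by (simp only:)
  qed
  have shift: "(LINT x|lborel. f (x + a)) = (LINT x|lborel. f x)" for a
  proof -
    have "(LINT x|lborel. f x) = (LINT x|distr lborel borel ((+) a). f x)"
      by (simp add: lborel_distr_plus)
    also have "\<dots> = (LINT x|lborel. f (a + x))"
      by (rule integral_distr) (use cf in \<open>auto intro: borel_measurable_continuous_onI\<close>)
    finally show ?thesis by (simp add: add.commute)
  qed
  have s0: "(LINT x|lborel. s k x) = 0" for k
    using int[of 0] int[of "(1 / real (Suc k)) *\<^sub>R e"] shift[of "(1 / real (Suc k)) *\<^sub>R e"]
    by (simp add: s_def)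
  have "(\<lambda>k. LINT x|lborel. s k x) \<longlonglongrightarrow> (LINT x|lborel. f' x e)"
  proof (rule integral_dominated_convergence[where w = "\<lambda>x. B * indicator (cball 0 (R + norm e)) x"])
    show "(\<lambda>x. f' x e) \<in> borel_measurable lborel"
      using c by (simp add: borel_measurable_continuous_onI)
    show "s k \<in> borel_measurable lborel" for k
      unfolding s_def
      using cf by (intro borel_measurable_continuous_onI borel_measurable_times borel_measurable_diff)
        (auto intro!: continuous_intros continuous_on_compose2[OF cf] borel_measurable_continuous_onI)
    show "integrable lborel (\<lambda>x::'x. B * indicator (cball 0 (R + norm e)) x :: real)"
      using emeasure_compact_finite[of "cball 0 (R + norm e) :: 'x set"] by (intro integrable_mult_right integrable_real_indicator) auto
  qed (use lim bd in auto)
  then have "(LINT x|lborel. f' x e) = 0"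
    by (simp add: s0 LIMSEQ_const_iff)
  moreover have "(LINT x|lebesgue. f' x e) = (LINT x|lborel. f' x e)"
    by (rule integral_completion) (use c in \<open>simp add: borel_measurable_continuous_onI\<close>)
  ultimately show ?thesis by simp
qed

lemma test_fun_D:
  fixes \<phi> :: "'x::euclidean_space \<Rightarrow> real"
  assumes "test_fun U \<phi>" "e \<in> Basis"
  obtains K where "compact K" "K \<subseteq> U" "\<And>x. x \<notin> K \<Longrightarrow> \<phi> x = 0" "\<And>x. x \<notin> K \<Longrightarrow> pd e \<phi> x = 0"
    "continuous_on UNIV \<phi>" "continuous_on UNIV (pd e \<phi>)"
    "\<And>x. (\<phi> has_derivative frechet_derivative \<phi> (at x)) (at x)"
proof -
  obtain K where K: "compact K" "K \<subseteq> U" "\<And>x. x \<notin> K \<Longrightarrow> \<phi> x = 0" and s: "smooth_fun \<phi>"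
    using assms by (auto simp: test_fun_def)
  have d0: "\<phi> differentiable (at x)" for x
    using s[unfolded smooth_fun_def, rule_format, of "[]" x] by simp
  have d1: "pd e \<phi> differentiable (at x)" for x
    using s[unfolded smooth_fun_def, rule_format, of "[e]" x] assms by simp
  have h: "(\<phi> has_derivative frechet_derivative \<phi> (at x)) (at x)" for x
    using d0 frechet_derivative_works by blast
  have "pd e \<phi> x = 0" if "x \<notin> K" for x
    using has_derivative_zero_outside_support[OF h K(1) K(3) that] by (simp add: pd_def)
  moreover have "continuous_on UNIV \<phi>" "continuous_on UNIV (pd e \<phi>)"
    using d0 d1 by (auto simp: continuous_on_eq_continuous_within intro: differentiable_imp_continuous_within)
  ultimately show ?thesis using that K h by blast
qed

lemma integrable_loc_integrable_mult:
  fixes f \<psi> :: "'x::euclidean_space \<Rightarrow> real"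
  assumes f: "loc_integrable U f" and K: "compact K" "K \<subseteq> U" "\<And>x. x \<notin> K \<Longrightarrow> \<psi> x = 0"
    and c: "continuous_on UNIV \<psi>"
  shows "integrable lebesgue (\<lambda>x. f x * \<psi> x)"
proof -
  have i: "integrable lebesgue (\<lambda>x. indicator K x *\<^sub>R f x)"
    using f K by (auto simp: loc_integrable_def set_integrable_def)
  have "bounded (\<psi> ` K)"
    using c K(1) by (meson compact_continuous_image compact_imp_bounded continuous_on_subset subset_UNIV)
  then obtain B where B: "\<And>x. x \<in> K \<Longrightarrow> \<bar>\<psi> x\<bar> \<le> B"
    unfolding bounded_iff by auto
  have eq: "f x * \<psi> x = (indicator K x *\<^sub>R f x) * \<psi> x" for x
    by (cases "x \<in> K") (auto simp: K)
  have [measurable]: "\<psi> \<in> borel_measurable lebesgue"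
    using c by (simp add: borel_measurable_continuous_onI measurable_completion)
  note [measurable] = borel_measurable_integrable[OF i]
  show ?thesis
    unfolding eq
  proof (rule Bochner_Integration.integrable_bound[OF integrable_mult_right[of B, OF integrable_abs[OF i]]])
    show "AE x in lebesgue. norm (indicator K x *\<^sub>R f x * \<psi> x) \<le> norm (B * \<bar>indicator K x *\<^sub>R f x\<bar>)"
    proof (rule AE_I2)
      fix x
      show "norm (indicator K x *\<^sub>R f x * \<psi> x) \<le> norm (B * \<bar>indicator K x *\<^sub>R f x\<bar>)"
      proof (cases "x \<in> K")
        case True
        then have "\<bar>f x\<bar> * \<bar>\<psi> x\<bar> \<le> \<bar>f x\<bar> * \<bar>B\<bar>"
          using B[OF True] by (intro mult_left_mono) auto
        then show ?thesis using True by (simp add: abs_mult mult.commute)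
      qed auto
    qed
  qed measurable
qed

lemma set_lebesgue_integral_support:
  assumes "\<And>x. x \<notin> U \<Longrightarrow> f x = 0"
  shows "(LINT x:U|M. f x) = (LINT x|M. f x :: real)"
  unfolding set_lebesgue_integral_def
  by (rule Bochner_Integration.integral_cong) (use assms in \<open>auto simp: indicator_def\<close>)

text \<open>A test function and its derivative vanish outside \<open>U\<close>, so the integrals
  over \<open>U\<close> agree with whole-space integrals, for which linearity and congruence are at
  hand.\<close>

lemma weak_deriv_alt:
  fixes f g :: "'x::euclidean_space \<Rightarrow> real"
  assumes e: "e \<in> Basis"
  shows "weak_deriv U f e g \<longleftrightarrow> loc_integrable U f \<and> loc_integrable U g \<and>
     (\<forall>\<phi>. test_fun U \<phi> \<longrightarrow> (LINT x|lebesgue. f x * pd e \<phi> x) = - (LINT x|lebesgue. g x * \<phi> x))"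
proof -
  have "(LINT x:U|lebesgue. f x * pd e \<phi> x) = (LINT x|lebesgue. f x * pd e \<phi> x)"
       "(LINT x:U|lebesgue. g x * \<phi> x) = (LINT x|lebesgue. g x * \<phi> x)" if t: "test_fun U \<phi>" for \<phi>
  proof -
    obtain K where K: "K \<subseteq> U" "\<And>x. x \<notin> K \<Longrightarrow> \<phi> x = 0" "\<And>x. x \<notin> K \<Longrightarrow> pd e \<phi> x = 0"
      using test_fun_D[OF t e] by metis
    have "\<phi> x = 0 \<and> pd e \<phi> x = 0" if "x \<notin> U" for x
      using that K by blast
    then show "(LINT x:U|lebesgue. f x * pd e \<phi> x) = (LINT x|lebesgue. f x * pd e \<phi> x)"
       "(LINT x:U|lebesgue. g x * \<phi> x) = (LINT x|lebesgue. g x * \<phi> x)"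
      by (auto intro!: set_lebesgue_integral_support)
  qed
  then show ?thesis unfolding weak_deriv_def by auto
qed

lemma test_fun_mono: "test_fun V \<phi> \<Longrightarrow> V \<subseteq> U \<Longrightarrow> test_fun U \<phi>"
  unfolding test_fun_def by blast

lemma loc_integrable_mono: "loc_integrable U f \<Longrightarrow> V \<subseteq> U \<Longrightarrow> loc_integrable V f"
  unfolding loc_integrable_def by blast

lemma weak_deriv_mono:
  "weak_deriv U f e g \<Longrightarrow> V \<subseteq> U \<Longrightarrow> e \<in> Basis \<Longrightarrow> weak_deriv V f e g"
  by (auto simp: weak_deriv_alt intro: test_fun_mono loc_integrable_mono)

lemma loc_integrable_lin:
  assumes "loc_integrable U f" "loc_integrable U g"
  shows "loc_integrable U (\<lambda>x. c * f x + g x)"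
  using assms unfolding loc_integrable_def
  by (auto intro!: set_integral_add set_integrable_mult_right)

lemma weak_deriv_lin:
  fixes f g :: "'x::euclidean_space \<Rightarrow> real"
  assumes "weak_deriv U f e f'" "weak_deriv U g e g'" and e: "e \<in> Basis"
  shows "weak_deriv U (\<lambda>x. c * f x + g x) e (\<lambda>x. c * f' x + g' x)"
  unfolding weak_deriv_alt[OF e]
proof (intro conjI allI impI)
  note A = assms(1,2)[unfolded weak_deriv_alt[OF e]]
  show "loc_integrable U (\<lambda>x. c * f x + g x)" "loc_integrable U (\<lambda>x. c * f' x + g' x)"
    using A by (auto intro: loc_integrable_lin)
  fix \<phi> assume t: "test_fun U \<phi>"
  obtain K where K: "compact K" "K \<subseteq> U" "\<And>x. x \<notin> K \<Longrightarrow> \<phi> x = 0" "\<And>x. x \<notin> K \<Longrightarrow> pd e \<phi> x = 0"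
    "continuous_on UNIV \<phi>" "continuous_on UNIV (pd e \<phi>)"
    using test_fun_D[OF t e] by metis
  note I1 = integrable_loc_integrable_mult[OF _ K(1,2,4,6)]
  note I2 = integrable_loc_integrable_mult[OF _ K(1,2,3,5)]
  have "(LINT x|lebesgue. (c * f x + g x) * pd e \<phi> x)
      = c * (LINT x|lebesgue. f x * pd e \<phi> x) + (LINT x|lebesgue. g x * pd e \<phi> x)"
    using I1[of f] I1[of g] A by (simp add: algebra_simps)
  also have "\<dots> = - (c * (LINT x|lebesgue. f' x * \<phi> x) + (LINT x|lebesgue. g' x * \<phi> x))"
    using A t by simp
  also have "\<dots> = - (LINT x|lebesgue. (c * f' x + g' x) * \<phi> x)"
    using I2[of f'] I2[of g'] A by (simp add: algebra_simps)
  finally show "(LINT x|lebesgue. (c * f x + g x) * pd e \<phi> x) = - (LINT x|lebesgue. (c * f' x + g' x) * \<phi> x)" .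
qed

lemma loc_integrable_continuous:
  fixes f :: "'x::euclidean_space \<Rightarrow> real"
  assumes "continuous_on UNIV f"
  shows "loc_integrable U f"
  unfolding loc_integrable_def set_integrable_def
proof (intro allI impI)
  fix K :: "'x set" assume "compact K \<and> K \<subseteq> U"
  then have "integrable lborel (\<lambda>x. indicator K x *\<^sub>R f x)"
    using assms continuous_on_subset by (intro borel_integrable_compact) blast+
  then show "integrable lebesgue (\<lambda>x. indicator K x *\<^sub>R f x)"
    by (simp add: integrable_completion)
qed

text \<open>The product of \<open>f\<close> with a test function is C1 with compact support, so its
  derivative integrates to 0. Through this lemma smooth barriers enter the weak setting.\<close>

lemma weak_deriv_C1:
  fixes f :: "'x::euclidean_space \<Rightarrow> real"
  assumes d: "\<And>x. (f has_derivative f' x) (at x)" and c: "continuous_on UNIV (\<lambda>x. f' x e)"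
    and e: "e \<in> Basis"
  shows "weak_deriv U f e (\<lambda>x. f' x e)"
  unfolding weak_deriv_alt[OF e]
proof (intro conjI allI impI)
  have cf: "continuous_on UNIV f"
    using d by (meson continuous_at_imp_continuous_on has_derivative_continuous)
  show lf: "loc_integrable U f" and lf': "loc_integrable U (\<lambda>x. f' x e)"
    using c cf by (auto intro: loc_integrable_continuous)
  fix \<phi> assume t: "test_fun U \<phi>"
  obtain K where K: "compact K" "K \<subseteq> U" "\<And>x. x \<notin> K \<Longrightarrow> \<phi> x = 0" "\<And>x. x \<notin> K \<Longrightarrow> pd e \<phi> x = 0"
    "continuous_on UNIV \<phi>" "continuous_on UNIV (pd e \<phi>)"
    and h: "\<And>x. (\<phi> has_derivative frechet_derivative \<phi> (at x)) (at x)"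
    using test_fun_D[OF t e] by metis
  have "(LINT x|lebesgue. f x * pd e \<phi> x + f' x e * \<phi> x) = 0"
  proof -
    have "((\<lambda>x. f x * \<phi> x) has_derivative (\<lambda>h. f x * frechet_derivative \<phi> (at x) h + f' x h * \<phi> x)) (at x)" for x
      by (rule has_derivative_mult[OF d h])
    moreover have "continuous_on UNIV (\<lambda>x. f x * pd e \<phi> x + f' x e * \<phi> x)"
      using K c cf by (intro continuous_intros)
    ultimately show ?thesis
      using integral_directional_derivative_eq_0[of "\<lambda>x. f x * \<phi> x", OF _ _ K(1), of _ e] K(3)
      unfolding pd_def by fastforce
  qed
  moreover have "integrable lebesgue (\<lambda>x. f x * pd e \<phi> x)" "integrable lebesgue (\<lambda>x. f' x e * \<phi> x)"
    using integrable_loc_integrable_mult[OF lf K(1,2,4,6)] integrable_loc_integrable_mult[OF lf' K(1,2,3,5)] by auto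
  ultimately show "(LINT x|lebesgue. f x * pd e \<phi> x) = - (LINT x|lebesgue. f' x e * \<phi> x)"
    by simp
qed

lemma loc_integrable_cong_AE:
  fixes f :: "'x::euclidean_space \<Rightarrow> real"
  assumes "loc_integrable U f" "AE x in lebesgue. x \<in> U \<longrightarrow> f x = f1 x"
    and [measurable]: "f1 \<in> borel_measurable lebesgue"
  shows "loc_integrable U f1"
  unfolding loc_integrable_def set_integrable_def
proof (intro allI impI)
  fix K assume K: "compact K \<and> K \<subseteq> U"
  then have i: "integrable lebesgue (\<lambda>x. indicator K x *\<^sub>R f x)"
    using assms by (auto simp: loc_integrable_def set_integrable_def)
  have [measurable]: "K \<in> sets lebesgue"
    using K by (simp add: borel_compact)
  have "AE x in lebesgue. indicator K x *\<^sub>R f x = indicator K x *\<^sub>R f1 x"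
    using assms(2) by eventually_elim (use K in \<open>auto simp: indicator_def\<close>)
  then show "integrable lebesgue (\<lambda>x. indicator K x *\<^sub>R f1 x)"
    by (intro integrable_cong_AE_imp[OF i]) (auto elim: eventually_mono)
qed

lemma weak_deriv_cong_AE:
  fixes f g :: "'x::euclidean_space \<Rightarrow> real"
  assumes w: "weak_deriv U f e g" and e: "e \<in> Basis"
    and f: "AE x in lebesgue. x \<in> U \<longrightarrow> f x = f1 x" "loc_integrable U f1"
    and g: "AE x in lebesgue. x \<in> U \<longrightarrow> g x = g1 x" "loc_integrable U g1"
  shows "weak_deriv U f1 e g1"
proof -
  have int: "(LINT x|lebesgue. h x * \<psi> x) = (LINT x|lebesgue. h1 x * \<psi> x)"
    if l: "loc_integrable U h" and ae: "AE x in lebesgue. x \<in> U \<longrightarrow> h x = h1 x" and l1: "loc_integrable U h1"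
      and K: "compact K" "K \<subseteq> U" "\<And>x. x \<notin> K \<Longrightarrow> \<psi> x = 0" and c: "continuous_on UNIV \<psi>" for h h1 \<psi> K
  proof (rule integral_cong_AE)
    show "(\<lambda>x. h x * \<psi> x) \<in> borel_measurable lebesgue" "(\<lambda>x. h1 x * \<psi> x) \<in> borel_measurable lebesgue"
      using integrable_loc_integrable_mult[OF l K c] integrable_loc_integrable_mult[OF l1 K c] by auto
    show "AE x in lebesgue. h x * \<psi> x = h1 x * \<psi> x"
      using ae by eventually_elim (use K in fastforce)
  qed
  show ?thesis
    using w f(2) g(2) unfolding weak_deriv_alt[OF e]
  proof (elim conjE, intro conjI allI impI)
    fix \<phi> assume t: "test_fun U \<phi>" and lf: "loc_integrable U f" and lg: "loc_integrable U g"
      and eq: "\<forall>\<phi>. test_fun U \<phi> \<longrightarrow> (LINT x|lebesgue. f x * pd e \<phi> x) = - (LINT x|lebesgue. g x * \<phi> x)"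
    obtain K where K: "compact K" "K \<subseteq> U" "\<And>x. x \<notin> K \<Longrightarrow> \<phi> x = 0" "\<And>x. x \<notin> K \<Longrightarrow> pd e \<phi> x = 0"
      "continuous_on UNIV \<phi>" "continuous_on UNIV (pd e \<phi>)"
      using test_fun_D[OF t e] by metis
    show "(LINT x|lebesgue. f1 x * pd e \<phi> x) = - (LINT x|lebesgue. g1 x * \<phi> x)"
      using int[OF lf f K(1,2,4,6)] int[OF lg g K(1,2,3,5)] eq t by simp
  qed auto
qed

text \<open>Local integrability speaks of compact sets only; the cut-off to \<open>U\<close> is the
  pointwise limit of the cut-offs to a compact exhaustion of \<open>U\<close>.\<close>

lemma loc_integrable_measurable:
  fixes f :: "'x::euclidean_space \<Rightarrow> real"
  assumes f: "loc_integrable U f" and U: "open U"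
  shows "(\<lambda>x. indicator U x * f x) \<in> borel_measurable lebesgue"
proof -
  obtain K where K: "\<And>n::nat. compact (K n)" "\<And>n. K n \<subseteq> U" "(\<Union>n. K n) = U"
      and Ki: "\<And>n. K n \<subseteq> interior (K (Suc n))"
    by (rule open_Union_compact_subsets[OF U]) blast
  have K4: "K n \<subseteq> K (Suc n)" for n
    using Ki interior_subset by blast
  have m: "(\<lambda>x. indicator (K n) x * f x) \<in> borel_measurable lebesgue" for n
  proof -
    have "set_integrable lebesgue (K n) f"
      using f K by (simp add: loc_integrable_def)
    then show ?thesis
      using borel_measurable_integrable by (force simp: set_integrable_def)
  qed
  have mono: "K n \<subseteq> K m" if "n \<le> m" for n m
    using that K4 lift_Suc_mono_le[of K] by blast
  have "(\<lambda>n. indicator (K n) x * f x) \<longlonglongrightarrow> indicator U x * f x" for x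
  proof (cases "x \<in> U")
    case True
    then obtain n where "x \<in> K n" using K by auto
    then have "\<forall>m\<ge>n. indicator (K m) x * f x = indicator U x * f x"
      using mono True by (auto simp: indicator_def)
    then show ?thesis
      by (intro tendsto_eventually) (auto simp: eventually_sequentially)
  next
    case False
    then have "x \<notin> K n" for n using K by auto
    then show ?thesis using False by simp
  qed
  then show ?thesis
    by (intro borel_measurable_LIMSEQ_real[OF _ m]) auto
qed

subsection \<open>The maximum principle\<close>

lemma X_spaceD:
  assumes "X_space Xn" "bounded_domain \<Omega>"
  shows X_space_restrict: "S \<subseteq> \<Omega> \<Longrightarrow> Xn S f = Xn \<Omega> (\<lambda>x. indicator S x * f x)"
    and X_space_triangle: "f \<in> borel_measurable lebesgue \<Longrightarrow> g \<in> borel_measurable lebesgue \<Longrightarrow>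
        Xn \<Omega> (\<lambda>x. f x + g x) \<le> Xn \<Omega> f + Xn \<Omega> g"
    and X_space_cmult: "f \<in> borel_measurable lebesgue \<Longrightarrow> Xn \<Omega> (\<lambda>x. c * f x) = ennreal \<bar>c\<bar> * Xn \<Omega> f"
    and X_space_eq_0: "f \<in> borel_measurable lebesgue \<Longrightarrow>
        Xn \<Omega> f = 0 \<longleftrightarrow> (AE x in lebesgue. x \<in> \<Omega> \<longrightarrow> f x = 0)"
    and X_space_dominated: "g \<in> borel_measurable lebesgue \<Longrightarrow> X_mem Xn \<Omega> f \<Longrightarrow>
        (\<And>x. x \<in> \<Omega> \<Longrightarrow> \<bar>g x\<bar> \<le> \<bar>f x\<bar>) \<Longrightarrow> Xn \<Omega> g \<le> Xn \<Omega> f"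
    and X_space_decreasing: "(\<And>k. X_mem Xn \<Omega> (fs k)) \<Longrightarrow>
        (AE x in lebesgue. x \<in> \<Omega> \<longrightarrow> (\<forall>k. fs (Suc k) x \<le> fs k x) \<and> (\<lambda>k. fs k x) \<longlonglongrightarrow> 0) \<Longrightarrow>
        (\<lambda>k. Xn \<Omega> (fs k)) \<longlonglongrightarrow> 0"
    and X_space_Orlicz: "Orlicz_loc \<Omega> f \<Longrightarrow> X_loc Xn \<Omega> f"
  using assms(1)[unfolded X_space_def, rule_format, OF assms(2)] by blast+

text \<open>Both norms are rewritten as norms over \<Omega>, where domination applies. Domination
  presupposes a finite norm of the larger function, so the infinite case is separated.\<close>

lemma X_space_mono:
  assumes X: "X_space Xn" "bounded_domain \<Omega>" and ST: "S \<subseteq> T" "T \<subseteq> \<Omega>"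
    and [measurable]: "S \<in> sets lebesgue" "T \<in> sets lebesgue"
      "f \<in> borel_measurable lebesgue" "g \<in> borel_measurable lebesgue"
    and le: "\<And>x. x \<in> S \<Longrightarrow> \<bar>f x\<bar> \<le> \<bar>g x\<bar>"
  shows "Xn S f \<le> Xn T g"
proof (cases "Xn T g = \<infinity>")
  case False
  have eq: "Xn S f = Xn \<Omega> (\<lambda>x. indicator S x * f x)" "Xn T g = Xn \<Omega> (\<lambda>x. indicator T x * g x)"
    using ST by (auto intro!: X_space_restrict[OF X])
  have "X_mem Xn \<Omega> (\<lambda>x. indicator T x * g x)"
    using False eq unfolding X_mem_def by (auto simp: less_top)
  then have "Xn \<Omega> (\<lambda>x. indicator S x * f x) \<le> Xn \<Omega> (\<lambda>x. indicator T x * g x)"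
    by (rule X_space_dominated[OF X, rotated]) (use ST le in \<open>auto simp: indicator_def\<close>)
  then show ?thesis by (simp add: eq)
qed auto

lemma bounded_domain_ball: "0 < r \<Longrightarrow> bounded_domain (ball x r)"
  by (simp add: bounded_domain_def)

lemma bounded_domain_sets: "bounded_domain \<Omega> \<Longrightarrow> \<Omega> \<in> sets lebesgue"
  by (auto simp: bounded_domain_def borel_open)

text \<open>A constant lies in the local Orlicz class of any ball. Local membership covers only
  domains whose closure lies inside the ball, which is why the ball is taken larger than
  \<Omega>.\<close>

lemma X_space_const_finite:
  assumes X: "X_space Xn" and bd: "bounded_domain \<Omega>"
  shows "Xn \<Omega> (\<lambda>_. c) < \<infinity>"
proof -
  obtain r where r: "\<Omega> \<subseteq> cball 0 r"
    using bd unfolding bounded_domain_def bounded_iff by (metis mem_cball_0 subsetI)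
  define B where "B = ball (0 :: 'a) (\<bar>r\<bar> + 1)"
  have "Orlicz_loc B (\<lambda>_. c)"
    unfolding Orlicz_loc_def
    by (auto intro!: exI[of _ 1] simp: set_integrable_def lmeasurable_iff_integrable[symmetric] lmeasurable_compact)
  then have "X_loc Xn B (\<lambda>_. c)"
    by (rule X_space_Orlicz[OF X, rotated]) (simp add: B_def bounded_domain_ball)
  moreover have "closure \<Omega> \<subseteq> cball 0 r"
    using r by (simp add: closure_minimal)
  then have "closure \<Omega> \<subseteq> B"
    by (auto simp: B_def)
  ultimately show ?thesis
    using bd by (auto simp: X_loc_def)
qed

lemma X_loc_continuous:
  assumes X: "X_space Xn" and c: "continuous_on UNIV f"
  shows "X_loc Xn \<Omega> f"
  unfolding X_loc_def
proof (intro conjI allI impI)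
  show [measurable]: "f \<in> borel_measurable lebesgue"
    using c by (simp add: borel_measurable_continuous_onI measurable_completion)
  fix \<Omega>' assume \<Omega>': "bounded_domain \<Omega>' \<and> closure \<Omega>' \<subseteq> \<Omega>"
  have [measurable]: "\<Omega>' \<in> sets lebesgue"
    using \<Omega>' bounded_domain_sets by blast
  have "compact (closure \<Omega>')"
    using \<Omega>' by (simp add: bounded_domain_def)
  then have "bounded (f ` closure \<Omega>')"
    using c by (meson compact_continuous_image compact_imp_bounded continuous_on_subset subset_UNIV)
  then obtain B where B: "\<And>x. x \<in> \<Omega>' \<Longrightarrow> \<bar>f x\<bar> \<le> B"
    unfolding bounded_iff using closure_subset[of \<Omega>'] by auto
  have "Xn \<Omega>' f \<le> Xn \<Omega>' (\<lambda>_. B)"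
    using \<Omega>' B by (intro X_space_mono[OF X]) force+
  then show "Xn \<Omega>' f < \<infinity>"
    using X_space_const_finite[OF X, of \<Omega>' B] \<Omega>' by (auto intro: le_less_trans)
qed

lemma X_loc_add:
  assumes X: "X_space Xn" and f: "X_loc Xn \<Omega> f" "X_loc Xn \<Omega> g"
  shows "X_loc Xn \<Omega> (\<lambda>x. c * f x + g x)"
  unfolding X_loc_def
proof (intro conjI allI impI)
  have [measurable]: "f \<in> borel_measurable lebesgue" "g \<in> borel_measurable lebesgue"
    using f by (auto simp: X_loc_def)
  show "(\<lambda>x. c * f x + g x) \<in> borel_measurable lebesgue" by measurable
  fix \<Omega>' assume \<Omega>': "bounded_domain \<Omega>' \<and> closure \<Omega>' \<subseteq> \<Omega>"
  then have "Xn \<Omega>' (\<lambda>x. c * f x + g x) \<le> Xn \<Omega>' (\<lambda>x. c * f x) + Xn \<Omega>' g"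
    by (intro X_space_triangle[OF X]) auto
  also have "\<dots> = ennreal \<bar>c\<bar> * Xn \<Omega>' f + Xn \<Omega>' g"
    using \<Omega>' by (subst X_space_cmult[OF X]) auto
  also have "\<dots> < \<infinity>"
    using f \<Omega>' by (auto simp: X_loc_def ennreal_mult_less_top)
  finally show "Xn \<Omega>' (\<lambda>x. c * f x + g x) < \<infinity>" .
qed

lemma X_loc_mono: "X_loc Xn \<Omega> f \<Longrightarrow> D \<subseteq> \<Omega> \<Longrightarrow> X_loc Xn D f"
  by (auto simp: X_loc_def)

lemma elliptic_mono: "elliptic \<nu> \<Omega> a \<Longrightarrow> D \<subseteq> \<Omega> \<Longrightarrow> elliptic \<nu> D a"
  by (auto simp: elliptic_def)

text \<open>The constant of the maximum principle may be arbitrary in its dependence on the norm of the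
  drift. Subtracting \<open>t Du/|Du|\<close> from the drift only decreases \<open>\<L>u\<close> and, for a suitable \<open>t\<close>, raises
  the norm to exactly 1, so the constant for norm 1 serves all drifts of norm at most 1.\<close>

lemma Aleksandrov_uniform:
  fixes Xn :: "'x::euclidean_space set \<Rightarrow> ('x \<Rightarrow> real) \<Rightarrow> ennreal"
  assumes X: "X_space Xn" and A: "Aleksandrov Xn" and \<nu>: "0 < \<nu>"
  obtains N :: real where "0 \<le> N"
    "\<And>\<Omega> a b u Du D2u G \<gamma> x. bounded_domain \<Omega> \<Longrightarrow> elliptic \<nu> \<Omega> a \<Longrightarrow> b \<in> borel_measurable lebesgue \<Longrightarrow>
      Xn \<Omega> (\<lambda>x. norm (b x)) \<le> 1 \<Longrightarrow> W2Xloc Xn \<Omega> u Du D2u \<Longrightarrow>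
      (\<And>e. e \<in> Basis \<Longrightarrow> Du e \<in> borel_measurable lebesgue) \<Longrightarrow>
      continuous_on (closure \<Omega>) u \<Longrightarrow> (\<And>x. x \<in> frontier \<Omega> \<Longrightarrow> u x \<le> 0) \<Longrightarrow>
      G \<in> borel_measurable lebesgue \<Longrightarrow> Xn \<Omega> G \<le> ennreal \<gamma> \<Longrightarrow> 0 \<le> \<gamma> \<Longrightarrow>
      (\<And>y. y \<in> \<Omega> \<Longrightarrow> 0 \<le> G y) \<Longrightarrow> (\<And>y. y \<in> \<Omega> \<Longrightarrow> Lop a b Du D2u y \<le> G y) \<Longrightarrow>
      x \<in> \<Omega> \<Longrightarrow> u x \<le> N * diameter \<Omega> * \<gamma>"
proof -
  obtain N0 :: "real \<Rightarrow> real \<Rightarrow> real" where N0: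
    "\<And>\<Omega> \<nu> a b u Du D2u. bounded_domain \<Omega> \<and> 0 < \<nu> \<and> elliptic \<nu> \<Omega> a \<and>
       b \<in> borel_measurable lebesgue \<and> X_mem Xn \<Omega> (\<lambda>x. norm (b x)) \<and>
       W2Xloc Xn \<Omega> u Du D2u \<and> continuous_on (closure \<Omega>) u \<and> (\<forall>x\<in>frontier \<Omega>. u x \<le> 0)
     \<Longrightarrow> (\<forall>x\<in>\<Omega>. ennreal (u x) \<le>
            ennreal (N0 \<nu> (enn2real (Xn \<Omega> (\<lambda>x. norm (b x)))) * diameter \<Omega>) *
            Xn {y\<in>\<Omega>. u y > 0} (\<lambda>y. max (Lop a b Du D2u y) 0))"
    using A unfolding Aleksandrov_def by blast
  define N where "N = max (N0 \<nu> 1) 0"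
  show ?thesis
  proof (rule that[of N])
    show "0 \<le> N" by (simp add: N_def)
    fix \<Omega> :: "'x set" and a b u Du D2u G \<gamma> x
    assume bd: "bounded_domain \<Omega>" and ell: "elliptic \<nu> \<Omega> a" and b[measurable]: "b \<in> borel_measurable lebesgue"
      and b1: "Xn \<Omega> (\<lambda>x. norm (b x)) \<le> 1" and W: "W2Xloc Xn \<Omega> u Du D2u"
      and Du[measurable]: "\<And>e. e \<in> Basis \<Longrightarrow> Du e \<in> borel_measurable lebesgue"
      and cu: "continuous_on (closure \<Omega>) u" and fr: "\<And>x. x \<in> frontier \<Omega> \<Longrightarrow> u x \<le> 0"
      and G[measurable]: "G \<in> borel_measurable lebesgue" and G\<gamma>: "Xn \<Omega> G \<le> ennreal \<gamma>" "0 \<le> \<gamma>"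
      and G0: "\<And>y. y \<in> \<Omega> \<Longrightarrow> 0 \<le> G y" and LG: "\<And>y. y \<in> \<Omega> \<Longrightarrow> Lop a b Du D2u y \<le> G y" and x: "x \<in> \<Omega>"
    have [measurable]: "\<Omega> \<in> sets lebesgue"
      using bd by (rule bounded_domain_sets)
    obtain e0 :: 'x where e0: "e0 \<in> Basis"
      using nonempty_Basis by blast
    define V where "V y = (\<Sum>i\<in>Basis. Du i y *\<^sub>R i)" for y
    \<comment> \<open>The default \<open>e0\<close> keeps \<open>dir\<close> of length 1 where the
      gradient vanishes as well. So the norm of \<open>b - t dir\<close> changes by at most
      \<open>C\<close> times the change of \<open>t\<close>, and it becomes large for large
      \<open>t\<close>.\<close>
    define dir where "dir y = (if V y = 0 then e0 else V y /\<^sub>R norm (V y))" for y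
    have [measurable]: "V \<in> borel_measurable lebesgue"
      unfolding V_def by measurable
    have [measurable]: "dir \<in> borel_measurable lebesgue"
      unfolding dir_def by measurable
    have nd: "norm (dir y) = 1" for y
      using e0 by (simp add: dir_def)
    have dV: "dir y \<bullet> V y = norm (V y)" for y
      by (simp add: dir_def dot_square_norm power2_eq_square)
    define m where "m t = Xn \<Omega> (\<lambda>y. norm (b y - t *\<^sub>R dir y))" for t
    define C where "C = Xn \<Omega> (\<lambda>_. 1)"
    have C: "C < \<infinity>"
      unfolding C_def by (rule X_space_const_finite[OF X bd])
    \<comment> \<open>A nonempty open set is not null, so the constant 1 has positive norm; the
      value \<open>2/c\<close> of \<open>t\<close> below relies on it.\<close>
    have C0: "C \<noteq> 0"
    proof
      assume "C = 0"
      then have "AE x in lebesgue. x \<notin> \<Omega>"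
        unfolding C_def by (subst (asm) X_space_eq_0[OF X bd]) auto
      then have "\<Omega> \<in> null_sets lebesgue"
        by (subst (asm) AE_iff_null_sets[symmetric]) auto
      moreover have "open \<Omega>" "\<Omega> \<noteq> {}" using bd by (auto simp: bounded_domain_def)
      ultimately show False
        using open_not_negligible negligible_iff_null_sets by blast
    qed
    have tri: "m t \<le> m s + ennreal \<bar>t - s\<bar> * C" for t s
    proof -
      have fin: "Xn \<Omega> (\<lambda>y. \<bar>t - s\<bar> * 1) = ennreal \<bar>t - s\<bar> * C"
        unfolding C_def by (subst X_space_cmult[OF X bd]) auto
      have "m t \<le> Xn \<Omega> (\<lambda>y. norm (b y - s *\<^sub>R dir y) + \<bar>t - s\<bar> * 1)"
        unfolding m_def
      proof (rule X_space_mono[OF X bd])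
        fix y
        have "norm (b y - t *\<^sub>R dir y) \<le> norm (b y - s *\<^sub>R dir y) + norm ((s - t) *\<^sub>R dir y)"
          using norm_triangle_ineq[of "b y - s *\<^sub>R dir y" "(s - t) *\<^sub>R dir y"] by (simp add: algebra_simps)
        then show "\<bar>norm (b y - t *\<^sub>R dir y)\<bar> \<le> \<bar>norm (b y - s *\<^sub>R dir y) + \<bar>t - s\<bar> * 1\<bar>"
          by (simp add: nd abs_minus_commute)
      qed auto
      also have "\<dots> \<le> m s + Xn \<Omega> (\<lambda>y. \<bar>t - s\<bar> * 1)"
        unfolding m_def by (rule X_space_triangle[OF X bd]) auto
      finally show ?thesis by (simp only: fin)
    qed
    have m0: "m 0 \<le> 1" using b1 by (simp add: m_def)
    have mfin: "m t < \<infinity>" for t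
    proof -
      have "m t \<le> 1 + ennreal \<bar>t\<bar> * C"
        using tri[of t 0] m0 by (simp add: order_trans add_right_mono)
      also have "\<dots> < \<infinity>" using C by (simp add: ennreal_mult_less_top)
      finally show ?thesis .
    qed
    define c where "c = enn2real C"
    have c: "C = ennreal c" "0 < c"
      using C C0 by (auto simp: c_def enn2real_positive_iff less_top zero_less_iff_neq_zero)
    define k where "k t = enn2real (m t)" for t
    have k: "m t = ennreal (k t)" "0 \<le> k t" for t
      using mfin[of t] by (auto simp: k_def less_top)
    have ktri: "k t \<le> k s + \<bar>t - s\<bar> * c" for t s
      using tri[of t s] c k(2)[of s] unfolding k(1) c(1)
      by (simp add: ennreal_mult[symmetric] ennreal_plus[symmetric] del: ennreal_plus)
    have "c-lipschitz_on UNIV k"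
    proof (rule lipschitz_onI)
      show "dist (k t) (k s) \<le> c * dist t s" for t s
        using ktri[of t s] ktri[of s t] by (auto simp: dist_real_def abs_minus_commute mult.commute abs_le_iff)
    qed (use c in auto)
    then have kc: "continuous_on {0..2/c} k"
      using lipschitz_on_continuous_on continuous_on_subset by blast
    \<comment> \<open>For this \<open>t\<close> the subtracted field has norm 2 while
      \<open>b\<close> has norm at most 1. The intermediate value theorem then yields norm exactly
      1, the argument at which \<open>N\<close> was fixed.\<close>
    have big: "1 \<le> k (2/c)"
    proof -
      have "ennreal (2/c) * C = Xn \<Omega> (\<lambda>y. (2/c) * 1)"
        unfolding C_def using c by (subst X_space_cmult[OF X bd]) auto
      also have "\<dots> \<le> Xn \<Omega> (\<lambda>y. norm (b y - (2/c) *\<^sub>R dir y) + norm (b y))"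
      proof (rule X_space_mono[OF X bd])
        fix y
        have "norm ((2/c) *\<^sub>R dir y) \<le> norm (b y - (2/c) *\<^sub>R dir y) + norm (b y)"
          using norm_triangle_ineq[of "(2/c) *\<^sub>R dir y - b y" "b y"] by (simp add: norm_minus_commute)
        then show "\<bar>(2/c) * 1\<bar> \<le> \<bar>norm (b y - (2/c) *\<^sub>R dir y) + norm (b y)\<bar>"
          using c by (simp add: nd)
      qed auto
      also have "\<dots> \<le> m (2/c) + Xn \<Omega> (\<lambda>y. norm (b y))"
        unfolding m_def by (rule X_space_triangle[OF X bd]) auto
      also have "\<dots> \<le> ennreal (k (2/c)) + 1"
        using b1 by (simp add: k add_left_mono)
      also have "\<dots> = ennreal (k (2/c) + 1)"
        using k(2) by simp
      finally show ?thesis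
        using c k(2)[of "2/c"] by (simp add: ennreal_mult[symmetric] del: ennreal_plus)
    qed
    have "k 0 \<le> 1"
      using m0 k[of 0] by simp
    then obtain t where t: "0 \<le> t" "k t = 1"
      using IVT'[of k 0 1 "2/c"] big kc c by auto
    define b' where "b' y = b y - t *\<^sub>R dir y" for y
    have [measurable]: "b' \<in> borel_measurable lebesgue"
      unfolding b'_def by measurable
    have nb: "Xn \<Omega> (\<lambda>y. norm (b' y)) = 1"
      using k(1)[of t] t by (simp add: m_def b'_def)
    have a: "(\<lambda>y. a y i j) \<in> borel_measurable lebesgue" if "i \<in> Basis" "j \<in> Basis" for i j
      using ell that by (auto simp: elliptic_def)
    have d2: "D2u i j \<in> borel_measurable lebesgue" if "i \<in> Basis" "j \<in> Basis" for i j
      using W that by (auto simp: W2Xloc_def X_loc_def)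
    have [measurable]: "Lop a b' Du D2u \<in> borel_measurable lebesgue"
      unfolding Lop_def[abs_def] using a d2 Du
      by (intro borel_measurable_add borel_measurable_uminus borel_measurable_sum borel_measurable_times) auto
    \<comment> \<open>Since \<open>dir\<close> points along the gradient, the change of the
      first-order term is \<open>- t |Du|\<close>, which is never positive.\<close>
    have Leq: "Lop a b' Du D2u y = Lop a b Du D2u y - t * norm (V y)" for y
    proof -
      have "norm (V y) = (\<Sum>i\<in>Basis. (dir y \<bullet> i) * Du i y)"
      proof -
        have "norm (V y) = dir y \<bullet> V y" by (rule dV[symmetric])
        also have "\<dots> = (\<Sum>i\<in>Basis. (dir y \<bullet> i) * Du i y)"
          unfolding V_def by (simp add: inner_sum_right mult.commute)
        finally show ?thesis .
      qed
      then show ?thesis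
        by (simp add: Lop_def b'_def inner_diff_left algebra_simps sum_subtractf sum_distrib_left)
    qed
    have "ennreal (u x) \<le> ennreal (N0 \<nu> (enn2real (Xn \<Omega> (\<lambda>x. norm (b' x)))) * diameter \<Omega>) *
            Xn {y\<in>\<Omega>. u y > 0} (\<lambda>y. max (Lop a b' Du D2u y) 0)"
      using N0[of \<Omega> \<nu> a b' u Du D2u] bd \<nu> ell W cu fr x nb by (auto simp: X_mem_def)
    also have "\<dots> \<le> ennreal (N * diameter \<Omega>) * ennreal \<gamma>"
    proof (rule mult_mono)
      have "diameter \<Omega> \<ge> 0"
        using bd by (simp add: bounded_domain_def diameter_ge_0)
      then show "ennreal (N0 \<nu> (enn2real (Xn \<Omega> (\<lambda>x. norm (b' x)))) * diameter \<Omega>) \<le> ennreal (N * diameter \<Omega>)"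
        by (intro ennreal_leI mult_right_mono) (auto simp: nb N_def)
      have "open {y\<in>\<Omega>. u y > 0}"
      proof -
        have "continuous_on \<Omega> u" "open \<Omega>"
          using continuous_on_subset[OF cu closure_subset] bd by (simp_all add: bounded_domain_def)
        then have "open (\<Omega> \<inter> u -` {0<..})"
          by (intro continuous_open_preimage) auto
        then show ?thesis by (simp add: vimage_def Int_def)
      qed
      then have "Xn {y\<in>\<Omega>. u y > 0} (\<lambda>y. max (Lop a b' Du D2u y) 0) \<le> Xn \<Omega> G"
      proof (intro X_space_mono[OF X bd])
        fix y assume "y \<in> {y\<in>\<Omega>. u y > 0}"
        then have "Lop a b' Du D2u y \<le> G y" "0 \<le> G y"
          using LG[of y] G0[of y] t by (auto simp: Leq intro: order_trans[rotated])
        then show "\<bar>max (Lop a b' Du D2u y) 0\<bar> \<le> \<bar>G y\<bar>" by auto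
      qed auto
      then show "Xn {y\<in>\<Omega>. u y > 0} (\<lambda>y. max (Lop a b' Du D2u y) 0) \<le> ennreal \<gamma>"
        using G\<gamma> by simp
    qed auto
    also have "\<dots> = ennreal (N * diameter \<Omega> * \<gamma>)"
      using G\<gamma> by (simp add: ennreal_mult'')
    finally show "u x \<le> N * diameter \<Omega> * \<gamma>"
    proof (subst (asm) ennreal_le_iff)
      show "0 \<le> N * diameter \<Omega> * \<gamma>"
        using G\<gamma> bd by (simp add: N_def bounded_domain_def diameter_ge_0)
    qed
  qed
qed


section \<open>Strong solutions and comparison with smooth barriers\<close>

text \<open>The equation holds at every point and the first derivatives are measurable on the whole
  space; changing the weak derivatives on a null set and outside \<Omega> achieves both. Pointwise
  estimates of \<open>Lop\<close> then have no exceptional set.\<close>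

definition strong_solution ::
  "('x::euclidean_space set \<Rightarrow> ('x \<Rightarrow> real) \<Rightarrow> ennreal) \<Rightarrow> 'x set \<Rightarrow> ('x \<Rightarrow> 'x \<Rightarrow> 'x \<Rightarrow> real) \<Rightarrow> ('x \<Rightarrow> 'x)
    \<Rightarrow> ('x \<Rightarrow> real) \<Rightarrow> bool" where
  "strong_solution Xn \<Omega> a b u \<longleftrightarrow> (\<exists>Du D2u. W2Xloc Xn \<Omega> u Du D2u \<and>
     (\<forall>e\<in>Basis. Du e \<in> borel_measurable lebesgue) \<and> (\<forall>x. Lop a b Du D2u x = 0))"

text \<open>Weak derivatives are determined up to null sets and only inside \<Omega>, so all of them
  may be set to 0 on \<open>N\<close> and outside \<Omega>. At those points \<open>Lop\<close>
  vanishes trivially.\<close>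

lemma W2Xloc_cong_AE:
  assumes X: "X_space Xn" and U: "open \<Omega>" and W: "W2Xloc Xn \<Omega> u Du D2u" and N: "N \<in> null_sets lebesgue"
  shows "W2Xloc Xn \<Omega> u (\<lambda>e x. indicator (\<Omega> - N) x * Du e x) (\<lambda>i j x. indicator (\<Omega> - N) x * D2u i j x)"
    and "\<And>e. e \<in> Basis \<Longrightarrow> (\<lambda>x. indicator (\<Omega> - N) x * Du e x) \<in> borel_measurable lebesgue"
proof -
  have [measurable]: "\<Omega> \<in> sets lebesgue" "N \<in> sets lebesgue"
    using U N by auto
  have ae: "AE x in lebesgue. x \<in> \<Omega> \<longrightarrow> f x = indicator (\<Omega> - N) x * f x" for f :: "'a \<Rightarrow> real"
    using AE_not_in[OF N] by eventually_elim auto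
  have meas: "(\<lambda>x. indicator (\<Omega> - N) x * f x) \<in> borel_measurable lebesgue"
    if l: "loc_integrable \<Omega> f" for f :: "'a \<Rightarrow> real"
  proof -
    note [measurable] = loc_integrable_measurable[OF l U]
    have "(\<lambda>x. indicator (- N) x * (indicator \<Omega> x * f x)) \<in> borel_measurable lebesgue"
      by measurable
    moreover have "indicator (- N) x * (indicator \<Omega> x * f x) = indicator (\<Omega> - N) x * f x" for x
      by (auto simp: indicator_def)
    ultimately show ?thesis by simp
  qed
  have li: "loc_integrable \<Omega> (\<lambda>x. indicator (\<Omega> - N) x * f x)" if "loc_integrable \<Omega> f" for f
    by (rule loc_integrable_cong_AE[OF that ae meas[OF that]])
  note W' = W[unfolded W2Xloc_def, rule_format]
  have l1: "loc_integrable \<Omega> u" "loc_integrable \<Omega> (Du j)" if "j \<in> Basis" for j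
    using W' that by (auto simp: weak_deriv_def)
  have l2: "loc_integrable \<Omega> (D2u i j)" if "i \<in> Basis" "j \<in> Basis" for i j
    using W'[OF that(2)] that(1) by (auto simp: weak_deriv_def)
  show "(\<lambda>x. indicator (\<Omega> - N) x * Du e x) \<in> borel_measurable lebesgue" if "e \<in> Basis" for e
    using l1 that by (intro meas)
  show "W2Xloc Xn \<Omega> u (\<lambda>e x. indicator (\<Omega> - N) x * Du e x) (\<lambda>i j x. indicator (\<Omega> - N) x * D2u i j x)"
    unfolding W2Xloc_def
  proof (intro ballI conjI)
    fix j :: 'a assume j: "j \<in> Basis"
    show "weak_deriv \<Omega> u j (\<lambda>x. indicator (\<Omega> - N) x * Du j x)"
      using W'[OF j] by (intro weak_deriv_cong_AE[OF _ j _ l1(1)[OF j] ae li[OF l1(2)[OF j]]]) auto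
    fix i :: 'a assume i: "i \<in> Basis"
    show "weak_deriv \<Omega> (\<lambda>x. indicator (\<Omega> - N) x * Du j x) i (\<lambda>x. indicator (\<Omega> - N) x * D2u i j x)"
      using W'[OF j] i by (intro weak_deriv_cong_AE[OF _ i ae li[OF l1(2)[OF j]] ae li[OF l2[OF i j]]]) auto
    show "X_loc Xn \<Omega> (\<lambda>x. indicator (\<Omega> - N) x * D2u i j x)"
      unfolding X_loc_def
    proof (intro conjI allI impI)
      have Xl: "X_loc Xn \<Omega> (D2u i j)" using W'[OF j] i by auto
      then have [measurable]: "D2u i j \<in> borel_measurable lebesgue" by (simp add: X_loc_def)
      show "(\<lambda>x. indicator (\<Omega> - N) x * D2u i j x) \<in> borel_measurable lebesgue" by measurable
      fix \<Omega>' assume \<Omega>': "bounded_domain \<Omega>' \<and> closure \<Omega>' \<subseteq> \<Omega>"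
      have [measurable]: "\<Omega>' \<in> sets lebesgue"
        using \<Omega>' bounded_domain_sets by blast
      have "Xn \<Omega>' (\<lambda>x. indicator (\<Omega> - N) x * D2u i j x) \<le> Xn \<Omega>' (D2u i j)"
        using \<Omega>' by (intro X_space_mono[OF X]) (auto simp: indicator_def)
      then show "Xn \<Omega>' (\<lambda>x. indicator (\<Omega> - N) x * D2u i j x) < \<infinity>"
        using Xl \<Omega>' by (auto simp: X_loc_def intro: le_less_trans)
    qed
  qed
qed

lemma strong_solutionI:
  assumes X: "X_space Xn" and U: "open \<Omega>" and W: "W2Xloc Xn \<Omega> u Du D2u"
    and L: "AE x in lebesgue. x \<in> \<Omega> \<longrightarrow> Lop a b Du D2u x = 0"
  shows "strong_solution Xn \<Omega> a b u"
proof -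
  obtain N where N: "N \<in> null_sets lebesgue" "\<And>x. x \<notin> N \<Longrightarrow> x \<in> \<Omega> \<Longrightarrow> Lop a b Du D2u x = 0"
    by (rule AE_E3[OF L]) auto
  show ?thesis
    unfolding strong_solution_def
  proof (intro exI conjI)
    show "W2Xloc Xn \<Omega> u (\<lambda>e x. indicator (\<Omega> - N) x * Du e x) (\<lambda>i j x. indicator (\<Omega> - N) x * D2u i j x)"
      by (rule W2Xloc_cong_AE[OF X U W N(1)])
    show "\<forall>e\<in>Basis. (\<lambda>x. indicator (\<Omega> - N) x * Du e x) \<in> borel_measurable lebesgue"
      using W2Xloc_cong_AE[OF X U W N(1)] by blast
    show "\<forall>x. Lop a b (\<lambda>e x. indicator (\<Omega> - N) x * Du e x) (\<lambda>i j x. indicator (\<Omega> - N) x * D2u i j x) x = 0"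
    proof
      fix x
      show "Lop a b (\<lambda>e x. indicator (\<Omega> - N) x * Du e x) (\<lambda>i j x. indicator (\<Omega> - N) x * D2u i j x) x = 0"
        using N(2)[of x] by (cases "x \<in> \<Omega> - N") (auto simp: Lop_def)
    qed
  qed
qed

text \<open>The derivatives of the C2 function \<open>g\<close> are continuous, hence weak
  derivatives, and locally in the space. This admits a solution plus a barrier to the maximum
  principle.\<close>

lemma W2Xloc_lin_C2:
  assumes X: "X_space Xn" and W: "W2Xloc Xn \<Omega> u Du D2u"
    and g: "\<And>x. (g has_derivative (\<lambda>h. grad x \<bullet> h)) (at x)"
    and gr: "\<And>x. (grad has_derivative H x) (at x)"
    and H: "\<And>i. i \<in> Basis \<Longrightarrow> continuous_on UNIV (\<lambda>x. H x i)"
  shows "W2Xloc Xn \<Omega> (\<lambda>x. c * u x + g x) (\<lambda>j x. c * Du j x + grad x \<bullet> j) (\<lambda>i j x. c * D2u i j x + H x i \<bullet> j)"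
  unfolding W2Xloc_def
proof (intro ballI conjI)
  note W' = W[unfolded W2Xloc_def, rule_format]
  have cg: "continuous_on UNIV grad"
    using has_derivative_continuous[OF gr] by (simp add: continuous_at_imp_continuous_on)
  fix j :: 'a assume j: "j \<in> Basis"
  have "weak_deriv \<Omega> g j (\<lambda>x. grad x \<bullet> j)"
    by (rule weak_deriv_C1[OF g _ j]) (intro continuous_intros cg)
  then show "weak_deriv \<Omega> (\<lambda>x. c * u x + g x) j (\<lambda>x. c * Du j x + grad x \<bullet> j)"
    using W'[OF j] by (intro weak_deriv_lin[OF _ _ j]) auto
  fix i :: 'a assume i: "i \<in> Basis"
  have "((\<lambda>x. grad x \<bullet> j) has_derivative (\<lambda>h. H x h \<bullet> j)) (at x)" for x
    by (rule has_derivative_inner_left[OF gr])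
  moreover have c: "continuous_on UNIV (\<lambda>x. H x i \<bullet> j)"
    using H[OF i] by (intro continuous_intros)
  ultimately have "weak_deriv \<Omega> (\<lambda>x. grad x \<bullet> j) i (\<lambda>x. H x i \<bullet> j)"
    by (rule weak_deriv_C1[where f' = "\<lambda>x h. H x h \<bullet> j", OF _ _ i])
  then show "weak_deriv \<Omega> (\<lambda>x. c * Du j x + grad x \<bullet> j) i (\<lambda>x. c * D2u i j x + H x i \<bullet> j)"
    using W'[OF j] i by (intro weak_deriv_lin[OF _ _ i]) auto
  show "X_loc Xn \<Omega> (\<lambda>x. c * D2u i j x + H x i \<bullet> j)"
    using W'[OF j] i by (intro X_loc_add[OF X] X_loc_continuous[OF X c]) auto
qed

lemma strong_solution_minus:
  assumes X: "X_space Xn" and s: "strong_solution Xn \<Omega> a b u"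
  shows "strong_solution Xn \<Omega> a b (\<lambda>x. - u x)"
proof -
  obtain Du D2u where W: "W2Xloc Xn \<Omega> u Du D2u"
    and m: "\<And>e. e \<in> Basis \<Longrightarrow> Du e \<in> borel_measurable lebesgue" and L: "\<And>x. Lop a b Du D2u x = 0"
    using s by (auto simp: strong_solution_def)
  have "W2Xloc Xn \<Omega> (\<lambda>x. -1 * u x + 0) (\<lambda>j x. -1 * Du j x + 0 \<bullet> j) (\<lambda>i j x. -1 * D2u i j x + 0 \<bullet> j)"
    by (rule W2Xloc_lin_C2[OF X W]) auto
  moreover have "Lop a b (\<lambda>j x. - Du j x) (\<lambda>i j x. - D2u i j x) x = 0" for x
    using L[of x] by (simp add: Lop_def sum_negf)
  ultimately show ?thesis
    unfolding strong_solution_def using m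
    by (intro exI[of _ "\<lambda>j x. - Du j x"] exI[of _ "\<lambda>i j x. - D2u i j x"]) auto
qed

lemma W2Xloc_mono:
  "W2Xloc Xn \<Omega> u Du D2u \<Longrightarrow> D \<subseteq> \<Omega> \<Longrightarrow> W2Xloc Xn D u Du D2u"
  unfolding W2Xloc_def by (auto intro: weak_deriv_mono X_loc_mono)

text \<open>The second-order terms of the barrier \<open>g\<close> have the favourable sign, so the
  operator applied to \<open>u + g\<close> is at most the drift term
  \<open>b \<bullet> grad g\<close>. Its tangential and normal parts are estimated separately,
  because the two components of the drift obey different smallness conditions.\<close>

lemma comparison_principle:
  fixes Xn :: "('a::euclidean_space \<times> real) set \<Rightarrow> (('a \<times> real) \<Rightarrow> real) \<Rightarrow> ennreal"
  assumes X: "X_space Xn" and A: "Aleksandrov Xn" and \<nu>: "0 < \<nu>"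
  obtains N :: real where "0 \<le> N"
    "\<And>\<Omega> a b u D g grad H p q \<beta>' \<beta>\<^sub>n d x. bounded_domain \<Omega> \<Longrightarrow> elliptic \<nu> \<Omega> a \<Longrightarrow>
      b \<in> borel_measurable lebesgue \<Longrightarrow> strong_solution Xn \<Omega> a b u \<Longrightarrow> continuous_on (closure \<Omega>) u \<Longrightarrow>
      open D \<Longrightarrow> D \<subseteq> \<Omega> \<Longrightarrow>
      Xn D (\<lambda>x. norm (fst (b x))) \<le> ennreal \<beta>' \<Longrightarrow> Xn D (\<lambda>x. snd (b x)) \<le> ennreal \<beta>\<^sub>n \<Longrightarrow>
      0 \<le> \<beta>' \<Longrightarrow> 0 \<le> \<beta>\<^sub>n \<Longrightarrow> \<beta>' + \<beta>\<^sub>n \<le> 1 \<Longrightarrow>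
      (\<And>x y. x \<in> D \<Longrightarrow> y \<in> D \<Longrightarrow> dist x y \<le> d) \<Longrightarrow>
      (\<And>x. (g has_derivative (\<lambda>h. grad x \<bullet> h)) (at x)) \<Longrightarrow>
      (\<And>x. (grad has_derivative H x) (at x)) \<Longrightarrow>
      (\<And>i. i \<in> Basis \<Longrightarrow> continuous_on UNIV (\<lambda>x. H x i)) \<Longrightarrow>
      (\<And>x. x \<in> D \<Longrightarrow> 0 \<le> (\<Sum>i\<in>Basis. \<Sum>j\<in>Basis. a x i j * (H x i \<bullet> j))) \<Longrightarrow>
      (\<And>x. x \<in> D \<Longrightarrow> norm (fst (grad x)) \<le> p) \<Longrightarrow> (\<And>x. x \<in> D \<Longrightarrow> \<bar>snd (grad x)\<bar> \<le> q) \<Longrightarrow>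
      0 \<le> p \<Longrightarrow> 0 \<le> q \<Longrightarrow>
      (\<And>x. x \<in> frontier D \<Longrightarrow> u x + g x \<le> 0) \<Longrightarrow> x \<in> D \<Longrightarrow>
      u x + g x \<le> N * d * (p * \<beta>' + q * \<beta>\<^sub>n)"
proof -
  obtain N where N: "0 \<le> N" and N_bound:
    "\<And>\<Omega> a b u Du D2u G \<gamma> x. bounded_domain \<Omega> \<Longrightarrow> elliptic \<nu> \<Omega> a \<Longrightarrow> b \<in> borel_measurable lebesgue \<Longrightarrow>
      Xn \<Omega> (\<lambda>x. norm (b x)) \<le> 1 \<Longrightarrow> W2Xloc Xn \<Omega> u Du D2u \<Longrightarrow>
      (\<And>e. e \<in> Basis \<Longrightarrow> Du e \<in> borel_measurable lebesgue) \<Longrightarrow>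
      continuous_on (closure \<Omega>) u \<Longrightarrow> (\<And>x. x \<in> frontier \<Omega> \<Longrightarrow> u x \<le> 0) \<Longrightarrow>
      G \<in> borel_measurable lebesgue \<Longrightarrow> Xn \<Omega> G \<le> ennreal \<gamma> \<Longrightarrow> 0 \<le> \<gamma> \<Longrightarrow>
      (\<And>y. y \<in> \<Omega> \<Longrightarrow> 0 \<le> G y) \<Longrightarrow> (\<And>y. y \<in> \<Omega> \<Longrightarrow> Lop a b Du D2u y \<le> G y) \<Longrightarrow>
      x \<in> \<Omega> \<Longrightarrow> u x \<le> N * diameter \<Omega> * \<gamma>"
    by (rule Aleksandrov_uniform[OF X A \<nu>]) blast
  show ?thesis
  proof (rule that[OF N])
    fix \<Omega> D :: "('a \<times> real) set" and a and b :: "'a \<times> real \<Rightarrow> 'a \<times> real" and u g grad H p q \<beta>' \<beta>\<^sub>n d x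
    assume bd: "bounded_domain \<Omega>" and ell: "elliptic \<nu> \<Omega> a" and b[measurable]: "b \<in> borel_measurable lebesgue"
      and sol: "strong_solution Xn \<Omega> a b u" and cu: "continuous_on (closure \<Omega>) u"
      and D: "open D" "D \<subseteq> \<Omega>" and b': "Xn D (\<lambda>x. norm (fst (b x))) \<le> ennreal \<beta>'"
      and bn: "Xn D (\<lambda>x. snd (b x)) \<le> ennreal \<beta>\<^sub>n" and \<beta>: "0 \<le> \<beta>'" "0 \<le> \<beta>\<^sub>n" "\<beta>' + \<beta>\<^sub>n \<le> 1"
      and diam: "\<And>x y. x \<in> D \<Longrightarrow> y \<in> D \<Longrightarrow> dist x y \<le> d"
      and g: "\<And>x. (g has_derivative (\<lambda>h. grad x \<bullet> h)) (at x)"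
      and gr: "\<And>x. (grad has_derivative H x) (at x)"
      and H: "\<And>i. i \<in> Basis \<Longrightarrow> continuous_on UNIV (\<lambda>x. H x i)"
      and sub: "\<And>x. x \<in> D \<Longrightarrow> 0 \<le> (\<Sum>i\<in>Basis. \<Sum>j\<in>Basis. a x i j * (H x i \<bullet> j))"
      and p: "\<And>x. x \<in> D \<Longrightarrow> norm (fst (grad x)) \<le> p" and q: "\<And>x. x \<in> D \<Longrightarrow> \<bar>snd (grad x)\<bar> \<le> q"
      and pq: "0 \<le> p" "0 \<le> q"
      and fr: "\<And>x. x \<in> frontier D \<Longrightarrow> u x + g x \<le> 0" and x: "x \<in> D"
    obtain Du D2u where W: "W2Xloc Xn \<Omega> u Du D2u"
      and m: "\<And>e. e \<in> Basis \<Longrightarrow> Du e \<in> borel_measurable lebesgue" and L: "\<And>x. Lop a b Du D2u x = 0"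
      using sol by (auto simp: strong_solution_def)
    \<comment> \<open>\<open>D\<close> may be disconnected, whereas the maximum principle is stated
      for domains. The component of \<open>x\<close> is one, and its frontier lies in that of
      \<open>D\<close>.\<close>
    define C where "C = connected_component_set D x"
    have C: "C \<subseteq> D" "open C" "connected C" "x \<in> C"
      using D x by (auto simp: C_def connected_component_subset open_connected_component)
    have bdC: "bounded_domain C"
      using C D bd by (auto simp: bounded_domain_def intro: bounded_subset)
    have [measurable]: "C \<in> sets lebesgue" "D \<in> sets lebesgue" "\<Omega> \<in> sets lebesgue"
      using C D bd by (auto simp: bounded_domain_def)
    have [measurable]: "fst \<in> borel_measurable (borel :: ('a \<times> real) measure)" "snd \<in> borel_measurable (borel :: ('a \<times> real) measure)"
      by (auto intro!: borel_measurable_continuous_onI continuous_intros)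
    have C\<Omega>: "C \<subseteq> \<Omega>" using C D by blast
    note mono = X_space_mono[OF X bd C(1) D(2)]
    have bC: "Xn C (\<lambda>x. norm (fst (b x))) \<le> ennreal \<beta>'" "Xn C (\<lambda>x. \<bar>snd (b x)\<bar>) \<le> ennreal \<beta>\<^sub>n"
    proof -
      have "Xn C (\<lambda>x. norm (fst (b x))) \<le> Xn D (\<lambda>x. norm (fst (b x)))"
           "Xn C (\<lambda>x. \<bar>snd (b x)\<bar>) \<le> Xn D (\<lambda>x. snd (b x))"
        by (auto intro!: mono)
      then show "Xn C (\<lambda>x. norm (fst (b x))) \<le> ennreal \<beta>'" "Xn C (\<lambda>x. \<bar>snd (b x)\<bar>) \<le> ennreal \<beta>\<^sub>n"
        using b' bn by (auto intro: order_trans)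
    qed
    have "Xn C (\<lambda>x. norm (b x)) \<le> Xn C (\<lambda>x. norm (fst (b x)) + \<bar>snd (b x)\<bar>)"
      using norm_Pair_le[of "fst (b y)" "snd (b y)" for y]
      by (intro X_space_mono[OF X bdC]) auto
    also have "\<dots> \<le> Xn C (\<lambda>x. norm (fst (b x))) + Xn C (\<lambda>x. \<bar>snd (b x)\<bar>)"
      by (intro X_space_triangle[OF X bdC]) auto
    also have "\<dots> \<le> ennreal (\<beta>' + \<beta>\<^sub>n)"
      using bC \<beta> by (auto intro: add_mono)
    also have "\<dots> \<le> 1" using \<beta> by (simp del: ennreal_plus)
    finally have b1: "Xn C (\<lambda>x. norm (b x)) \<le> 1" .
    define G where "G y = p * norm (fst (b y)) + q * \<bar>snd (b y)\<bar>" for y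
    have [measurable]: "G \<in> borel_measurable lebesgue"
      unfolding G_def by measurable
    have "Xn C G \<le> Xn C (\<lambda>y. p * norm (fst (b y))) + Xn C (\<lambda>y. q * \<bar>snd (b y)\<bar>)"
      unfolding G_def by (intro X_space_triangle[OF X bdC]) auto
    also have "\<dots> = ennreal p * Xn C (\<lambda>y. norm (fst (b y))) + ennreal q * Xn C (\<lambda>y. \<bar>snd (b y)\<bar>)"
      using pq by (subst (1 2) X_space_cmult[OF X bdC]) auto
    also have "\<dots> \<le> ennreal p * ennreal \<beta>' + ennreal q * ennreal \<beta>\<^sub>n"
      using bC by (intro add_mono mult_left_mono) auto
    also have "\<dots> = ennreal (p * \<beta>' + q * \<beta>\<^sub>n)"
      using pq \<beta> by (simp add: ennreal_mult)
    finally have G\<gamma>: "Xn C G \<le> ennreal (p * \<beta>' + q * \<beta>\<^sub>n)" .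
    have WT: "W2Xloc Xn C (\<lambda>x. 1 * u x + g x) (\<lambda>j x. 1 * Du j x + grad x \<bullet> j) (\<lambda>i j x. 1 * D2u i j x + H x i \<bullet> j)"
      by (rule W2Xloc_lin_C2[OF X W2Xloc_mono[OF W C\<Omega>] g gr H])
    have LT: "Lop a b (\<lambda>j x. 1 * Du j x + grad x \<bullet> j) (\<lambda>i j x. 1 * D2u i j x + H x i \<bullet> j) y \<le> G y"
      if y: "y \<in> C" for y
    proof -
      have yD: "y \<in> D" using y C by blast
      have "Lop a b (\<lambda>j x. 1 * Du j x + grad x \<bullet> j) (\<lambda>i j x. 1 * D2u i j x + H x i \<bullet> j) y
          = Lop a b Du D2u y - (\<Sum>i\<in>Basis. \<Sum>j\<in>Basis. a y i j * (H y i \<bullet> j)) + (\<Sum>i\<in>Basis. (b y \<bullet> i) * (grad y \<bullet> i))"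
        by (simp add: Lop_def algebra_simps sum.distrib)
      also have "(\<Sum>i\<in>Basis. (b y \<bullet> i) * (grad y \<bullet> i)) = b y \<bullet> grad y"
        by (rule euclidean_inner[symmetric])
      also have "b y \<bullet> grad y = fst (b y) \<bullet> fst (grad y) + snd (b y) * snd (grad y)"
        by (simp add: inner_prod_def)
      also have "Lop a b Du D2u y - (\<Sum>i\<in>Basis. \<Sum>j\<in>Basis. a y i j * (H y i \<bullet> j)) + \<dots> \<le> \<dots>"
        using L[of y] sub[OF yD] by simp
      also have "\<dots> \<le> norm (fst (b y)) * norm (fst (grad y)) + \<bar>snd (b y)\<bar> * \<bar>snd (grad y)\<bar>"
        by (intro add_mono norm_cauchy_schwarz) (metis abs_ge_self abs_mult)
      also have "\<dots> \<le> norm (fst (b y)) * p + \<bar>snd (b y)\<bar> * q"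
        using p[OF yD] q[OF yD] by (intro add_mono mult_left_mono) auto
      finally show ?thesis by (simp add: G_def mult.commute)
    qed
    have cg: "continuous_on UNIV g"
      using has_derivative_continuous[OF g] by (simp add: continuous_at_imp_continuous_on)
    have cgr: "continuous_on UNIV grad"
      using has_derivative_continuous[OF gr] by (simp add: continuous_at_imp_continuous_on)
    have "1 * u x + g x \<le> N * diameter C * (p * \<beta>' + q * \<beta>\<^sub>n)"
    proof (rule N_bound[OF bdC _ b b1 WT _ _ _ _ G\<gamma> _ _ LT C(4)])
      show "elliptic \<nu> C a" by (rule elliptic_mono[OF ell C\<Omega>])
      show "(\<lambda>x. 1 * Du e x + grad x \<bullet> e) \<in> borel_measurable lebesgue" if e: "e \<in> Basis" for e
      proof -
        have [measurable]: "(\<lambda>x. grad x \<bullet> e) \<in> borel_measurable lebesgue"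
          by (intro measurable_completion, simp, intro borel_measurable_continuous_onI continuous_intros cgr)
        show ?thesis using m[OF e] by measurable
      qed
      show "continuous_on (closure C) (\<lambda>x. 1 * u x + g x)"
        using continuous_on_subset[OF cu closure_mono[OF C\<Omega>]] continuous_on_subset[OF cg]
        by (intro continuous_intros) auto
      show "1 * u y + g y \<le> 0" if "y \<in> frontier C" for y
        using fr[of y] that frontier_of_connected_component_subset[of D x] by (auto simp: C_def)
    qed (use pq \<beta> in \<open>auto simp: G_def\<close>)
    also have "\<dots> \<le> N * d * (p * \<beta>' + q * \<beta>\<^sub>n)"
    proof -
      have "diameter C \<le> d"
        using C diam x by (intro diameter_le) (auto simp: dist_norm[symmetric] intro: diam)
      then show ?thesis
        using N pq \<beta> by (intro mult_right_mono mult_left_mono) auto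
    qed
    finally show "u x + g x \<le> N * d * (p * \<beta>' + q * \<beta>\<^sub>n)" by simp
  qed
qed

subsection \<open>Barriers\<close>

lemma X_modulus_mono:
  assumes X: "X_space Xn" and bd: "bounded_domain \<Omega>" and [measurable]: "f \<in> borel_measurable lebesgue" and "r \<le> s"
  shows "X_modulus Xn \<Omega> f r \<le> X_modulus Xn \<Omega> f s"
  unfolding X_modulus_def
proof (rule SUP_mono, intro bexI)
  have [measurable]: "\<Omega> \<in> sets lebesgue" using bd by (rule bounded_domain_sets)
  show "Xn (ball x r \<inter> \<Omega>) f \<le> Xn (ball x s \<inter> \<Omega>) f" for x
    using \<open>r \<le> s\<close> by (intro X_space_mono[OF X bd]) auto
qed

text \<open>Otherwise arbitrarily small balls carry norm above \<epsilon>, and their centres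
  accumulate at a point \<open>l\<close>. The cut-offs of \<open>f\<close> to balls around
  \<open>l\<close> decrease to 0 except at \<open>l\<close> itself, so their norms tend to 0; yet
  each such ball contains one of the bad balls.\<close>

lemma X_modulus_small:
  assumes X: "X_space Xn" and bd: "bounded_domain \<Omega>" and [measurable]: "f \<in> borel_measurable lebesgue"
    and fin: "Xn \<Omega> f < \<infinity>" and f0: "\<And>x. 0 \<le> f x" and \<epsilon>: "0 < \<epsilon>"
  shows "\<exists>\<rho>>0. X_modulus Xn \<Omega> f \<rho> \<le> \<epsilon>"
proof (rule ccontr)
  have [measurable]: "\<Omega> \<in> sets lebesgue" using bd by (rule bounded_domain_sets)
  assume "\<not> ?thesis"
  then have "\<forall>k. \<epsilon> < X_modulus Xn \<Omega> f (1 / real (Suc k))"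
    by (auto simp: not_le)
  then have "\<forall>k. \<exists>x\<in>\<Omega>. \<epsilon> < Xn (ball x (1 / real (Suc k)) \<inter> \<Omega>) f"
    unfolding X_modulus_def less_SUP_iff .
  then obtain x where x: "\<And>k. x k \<in> \<Omega>" "\<And>k. \<epsilon> < Xn (ball (x k) (1 / real (Suc k)) \<inter> \<Omega>) f"
    by metis
  have "compact (closure \<Omega>)"
    using bd by (simp add: bounded_domain_def)
  moreover have "\<forall>k. x k \<in> closure \<Omega>"
    using x(1) closure_subset by blast
  ultimately obtain l s where ls: "strict_mono s" "(x \<circ> s) \<longlonglongrightarrow> l"
    unfolding compact_def by metis
  define fs where "fs k y = indicator (ball l (1 / real (Suc k))) y * f y" for k y
  have [measurable]: "fs k \<in> borel_measurable lebesgue" for k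
    unfolding fs_def[abs_def] by (intro borel_measurable_times borel_measurable_indicator) auto
  have "(\<lambda>k. Xn \<Omega> (fs k)) \<longlonglongrightarrow> 0"
  proof (rule X_space_decreasing[OF X bd])
    fix k
    have "Xn \<Omega> (fs k) \<le> Xn \<Omega> f"
      by (rule X_space_mono[OF X bd]) (auto simp: fs_def indicator_def)
    then show "X_mem Xn \<Omega> (fs k)"
      using fin by (auto simp: X_mem_def)
  next
    have "AE y in lebesgue. y \<noteq> l"
      by (rule AE_not_in[of "{l}", simplified]) auto
    then show "AE y in lebesgue. y \<in> \<Omega> \<longrightarrow> (\<forall>k. fs (Suc k) y \<le> fs k y) \<and> (\<lambda>k. fs k y) \<longlonglongrightarrow> 0"
    proof eventually_elim
      case (elim y)
      have "fs (Suc k) y \<le> fs k y" for k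
      proof -
        have "1 / real (Suc (Suc k)) \<le> 1 / real (Suc k)"
          by (simp add: field_simps)
        then show ?thesis
          using f0[of y] by (auto simp: fs_def indicator_def)
      qed
      moreover have "(\<lambda>k. fs k y) \<longlonglongrightarrow> 0"
      proof (rule tendsto_eventually)
        have "eventually (\<lambda>k. 1 / real (Suc k) < dist l y) sequentially"
          using order_tendstoD(2)[OF LIMSEQ_inverse_real_of_nat, of "dist l y"] elim
          by (simp add: inverse_eq_divide)
        then show "eventually (\<lambda>k. fs k y = 0) sequentially"
          by eventually_elim (simp add: fs_def)
      qed
      ultimately show ?case by blast
    qed
  qed
  then have "eventually (\<lambda>k. Xn \<Omega> (fs k) < \<epsilon>) sequentially"
    using \<epsilon> by (rule order_tendstoD)
  then obtain m where m: "Xn \<Omega> (fs m) < \<epsilon>"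
    by (auto simp: eventually_sequentially)
  define \<eta> where "\<eta> = 1 / real (Suc m) / 2"
  have \<eta>: "0 < \<eta>" by (simp add: \<eta>_def)
  have "eventually (\<lambda>k. dist ((x \<circ> s) k) l < \<eta>) sequentially"
    using tendstoD[OF ls(2) \<eta>] .
  moreover have "eventually (\<lambda>k. 1 / real (Suc k) < \<eta>) sequentially"
    using order_tendstoD(2)[OF LIMSEQ_inverse_real_of_nat \<eta>] by (simp add: inverse_eq_divide)
  ultimately have "eventually (\<lambda>k. dist (x (s k)) l < \<eta> \<and> 1 / real (Suc k) < \<eta>) sequentially"
    by eventually_elim simp
  then obtain k where k: "dist (x (s k)) l < \<eta>" "1 / real (Suc k) < \<eta>"
    by (auto simp: eventually_sequentially)
  have "1 / real (Suc (s k)) \<le> 1 / real (Suc k)"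
    using seq_suble[OF ls(1), of k] by (intro divide_left_mono) auto
  then have sub: "ball (x (s k)) (1 / real (Suc (s k))) \<subseteq> ball l (1 / real (Suc m))"
  proof (intro subsetI)
    fix y assume "y \<in> ball (x (s k)) (1 / real (Suc (s k)))"
    then have "dist (x (s k)) y < 1 / real (Suc (s k))" by simp
    moreover have "dist l y \<le> dist (x (s k)) l + dist (x (s k)) y"
      by (rule dist_triangle3)
    moreover have "1 / real (Suc m) = \<eta> + \<eta>" unfolding \<eta>_def by (rule field_sum_of_halves[symmetric])
    ultimately have "dist l y < 1 / real (Suc m)"
      using k \<open>1 / real (Suc (s k)) \<le> 1 / real (Suc k)\<close> by linarith
    then show "y \<in> ball l (1 / real (Suc m))" by simp
  qed
  have "Xn (ball (x (s k)) (1 / real (Suc (s k))) \<inter> \<Omega>) f \<le> Xn \<Omega> (fs m)"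
    using sub by (intro X_space_mono[OF X bd]) (auto simp: fs_def indicator_def)
  then show False
    using x(2)[of "s k"] m by auto
qed

section \<open>Second derivatives of barriers and ellipticity\<close>

text \<open>The Hessian of each barrier is a multiple of the identity plus a rank-one matrix.
  Contraction with \<open>a\<close> leaves the trace and one value of the quadratic form, the two
  quantities that ellipticity controls.\<close>

lemma sum_Basis_scaled_rank_one:
  fixes a :: "'x::euclidean_space \<Rightarrow> 'x \<Rightarrow> real"
  shows "(\<Sum>i\<in>Basis. \<Sum>j\<in>Basis. a i j * ((s *\<^sub>R i + (t * (v \<bullet> i)) *\<^sub>R v) \<bullet> j))
    = s * (\<Sum>i\<in>Basis. a i i) + t * (\<Sum>i\<in>Basis. \<Sum>j\<in>Basis. a i j * (v \<bullet> i) * (v \<bullet> j))"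
proof -
  have "(\<Sum>j\<in>Basis. a i j * (i \<bullet> j)) = a i i" if "i \<in> Basis" for i
  proof -
    have "(\<Sum>j\<in>Basis. a i j * (i \<bullet> j)) = (\<Sum>j\<in>Basis. if j = i then a i i else 0)"
      using that by (intro sum.cong) (auto simp: inner_Basis)
    then show ?thesis using that by simp
  qed
  then have "(\<Sum>i\<in>Basis. \<Sum>j\<in>Basis. a i j * (i \<bullet> j)) = (\<Sum>i\<in>Basis. a i i)"
    by (intro sum.cong) auto
  moreover have "(\<Sum>i\<in>Basis. \<Sum>j\<in>Basis. a i j * ((s *\<^sub>R i + (t * (v \<bullet> i)) *\<^sub>R v) \<bullet> j))
    = (\<Sum>i\<in>Basis. \<Sum>j\<in>Basis. s * (a i j * (i \<bullet> j)) + t * (a i j * (v \<bullet> i) * (v \<bullet> j)))"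
    by (simp add: inner_add_left algebra_simps)
  ultimately show ?thesis
    by (simp only: sum.distrib sum_distrib_left[symmetric])
qed

lemma elliptic_trace_le:
  assumes "elliptic \<nu> \<Omega> a" "x \<in> \<Omega>"
  shows "(\<Sum>i\<in>Basis. a x i i) \<le> real DIM('x::euclidean_space) / \<nu>"
    and "\<nu> * (norm (v :: 'x))\<^sup>2 \<le> (\<Sum>i\<in>Basis. \<Sum>j\<in>Basis. a x i j * (v \<bullet> i) * (v \<bullet> j))"
proof -
  have e: "\<nu> * (norm \<xi>)\<^sup>2 \<le> (\<Sum>i\<in>Basis. \<Sum>j\<in>Basis. a x i j * (\<xi> \<bullet> i) * (\<xi> \<bullet> j))"
    "(\<Sum>i\<in>Basis. \<Sum>j\<in>Basis. a x i j * (\<xi> \<bullet> i) * (\<xi> \<bullet> j)) \<le> (norm \<xi>)\<^sup>2 / \<nu>" for \<xi> :: 'x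
    using assms unfolding elliptic_def by blast+
  show "\<nu> * (norm (v :: 'x))\<^sup>2 \<le> (\<Sum>i\<in>Basis. \<Sum>j\<in>Basis. a x i j * (v \<bullet> i) * (v \<bullet> j))"
    by (rule e)
  have "a x k k \<le> 1 / \<nu>" if k: "k \<in> Basis" for k
  proof -
    have "(\<Sum>i\<in>Basis. \<Sum>j\<in>Basis. a x i j * (k \<bullet> i) * (k \<bullet> j))
        = (\<Sum>i\<in>Basis. \<Sum>j\<in>Basis. if j = k then (if i = k then a x k k else 0) else 0)"
      using k by (intro sum.cong refl) (auto simp: inner_Basis)
    also have "\<dots> = a x k k"
      using k by simp
    finally show ?thesis using e(2)[of k] k by simp
  qed
  then have "(\<Sum>i\<in>Basis. a x i i) \<le> (\<Sum>i\<in>(Basis::'x set). 1 / \<nu>)"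
    by (intro sum_mono) auto
  then show "(\<Sum>i\<in>Basis. a x i i) \<le> real DIM('x) / \<nu>"
    by simp
qed

lemma Gaussian_has_derivative:
  fixes c :: "'x::euclidean_space" and \<alpha> :: real
  defines "G \<equiv> \<lambda>x. exp (- (\<alpha> * ((x - c) \<bullet> (x - c))))"
  shows "(G has_derivative (\<lambda>h. ((- 2 * \<alpha> * G x) *\<^sub>R (x - c)) \<bullet> h)) (at x)"
    and "((\<lambda>x. (- 2 * \<alpha> * G x) *\<^sub>R (x - c)) has_derivative
       (\<lambda>h. (- 2 * \<alpha> * G x) *\<^sub>R h + (4 * \<alpha>\<^sup>2 * G x * ((x - c) \<bullet> h)) *\<^sub>R (x - c))) (at x)"
proof -
  show 1: "(G has_derivative (\<lambda>h. ((- 2 * \<alpha> * G x) *\<^sub>R (x - c)) \<bullet> h)) (at x)" for x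
    unfolding G_def
    by (rule derivative_eq_intros refl)+ (auto simp: fun_eq_iff inner_commute algebra_simps)
  show "((\<lambda>x. (- 2 * \<alpha> * G x) *\<^sub>R (x - c)) has_derivative
       (\<lambda>h. (- 2 * \<alpha> * G x) *\<^sub>R h + (4 * \<alpha>\<^sup>2 * G x * ((x - c) \<bullet> h)) *\<^sub>R (x - c))) (at x)"
    by (rule derivative_eq_intros 1 refl)+ (auto simp: fun_eq_iff power2_eq_square algebra_simps)
qed

text \<open>Here \<open>V\<close> plays the role of \<open>\<Omega> \<inter> \<P>\<^sub>2\<^sub>r\<close>, and \<open>M x\<^sub>n - u\<close> is the nonnegative function to be bounded from below.
  The numbers \<open>\<beta>'\<close> and \<open>\<beta> \<rho>\<close> bound the norms of \<open>b'\<close> over \<open>V\<close> and of \<open>b\<^sup>n\<close> over cylinders of radius \<open>\<rho>\<close>;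
  the only trace of the differential equation is the comparison principle \<open>cp\<close>.\<close>

locale corner =
  fixes V :: "('a::euclidean_space \<times> real) set" and a and u :: "'a \<times> real \<Rightarrow> real"
    and \<nu> N M r \<beta>' :: real and \<beta> :: "real \<Rightarrow> real" and A K2 K :: real
  assumes A_def: "A = 2 * real DIM('a \<times> real) / \<nu>\<^sup>2" and K2_def: "K2 = real DIM('a \<times> real) / \<nu>\<^sup>2"
    and K_def: "K = K2 + 2" and V: "open V" "V \<subseteq> Pcyl (2 * r) (2 * r) 0" and r: "0 < r" and M: "0 \<le> M" and \<nu>: "0 < \<nu>" and N: "0 \<le> N"
    and ell: "elliptic \<nu> V a"
    and \<beta>: "0 \<le> \<beta>'" "\<And>\<rho>. 0 < \<rho> \<Longrightarrow> \<rho> \<le> 2 * r \<Longrightarrow> 0 \<le> \<beta> \<rho>" "\<And>\<rho>. 0 < \<rho> \<Longrightarrow> \<rho> \<le> 2 * r \<Longrightarrow> \<beta>' + \<beta> \<rho> \<le> 1"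
    and cp: "\<And>D c \<rho> g grad H p q d x. open D \<Longrightarrow> D \<subseteq> V \<Longrightarrow> D \<subseteq> Pcyl \<rho> \<rho> c \<Longrightarrow> 0 < \<rho> \<Longrightarrow> \<rho> \<le> 2 * r \<Longrightarrow>
      norm c \<le> 2 * r \<Longrightarrow>
      (\<And>x y. x \<in> D \<Longrightarrow> y \<in> D \<Longrightarrow> dist x y \<le> d) \<Longrightarrow>
      (\<And>x. (g has_derivative (\<lambda>h. grad x \<bullet> h)) (at x)) \<Longrightarrow>
      (\<And>x. (grad has_derivative H x) (at x)) \<Longrightarrow>
      (\<And>i. i \<in> Basis \<Longrightarrow> continuous_on UNIV (\<lambda>x. H x i)) \<Longrightarrow>
      (\<And>x. x \<in> D \<Longrightarrow> 0 \<le> (\<Sum>i\<in>Basis. \<Sum>j\<in>Basis. a x i j * (H x i \<bullet> j))) \<Longrightarrow>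
      (\<And>x. x \<in> D \<Longrightarrow> norm (fst (grad x)) \<le> p) \<Longrightarrow> (\<And>x. x \<in> D \<Longrightarrow> \<bar>snd (grad x)\<bar> \<le> q) \<Longrightarrow>
      0 \<le> p \<Longrightarrow> 0 \<le> q \<Longrightarrow>
      (\<And>x. x \<in> frontier D \<Longrightarrow> u x + g x \<le> 0) \<Longrightarrow> x \<in> D \<Longrightarrow>
      u x + g x \<le> N * d * (p * \<beta>' + q * \<beta> \<rho>)"
    and cont: "continuous_on (closure V) u"
    and le: "\<And>x. x \<in> V \<Longrightarrow> u x \<le> M * snd x"
    and bdry: "\<And>x. x \<in> closure V \<Longrightarrow> x \<notin> V \<Longrightarrow> norm (fst x) < 2 * r \<Longrightarrow> snd x < 2 * r \<Longrightarrow> u x = 0"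
begin

lemma A_pos: "0 < A" and K2_nonneg: "0 \<le> K2" and K_ge: "2 \<le> K"
  using \<nu> by (auto simp: A_def K2_def K_def)

lemma V_D: "x \<in> V \<Longrightarrow> norm (fst x) < 2 * r" "x \<in> V \<Longrightarrow> 0 < snd x" "x \<in> V \<Longrightarrow> snd x < 2 * r"
  using V by (auto simp: Pcyl_def)

lemma closure_V_le:
  assumes "x \<in> closure V"
  shows "0 \<le> snd x" "u x \<le> M * snd x"
proof -
  have "closure V \<subseteq> {x. 0 \<le> snd x}"
    by (rule closure_minimal) (auto dest: V_D intro!: closed_Collect_le continuous_intros)
  then show "0 \<le> snd x" using assms by auto
  have "continuous_on (closure V) (\<lambda>x. M * snd x - u x)"
    by (intro continuous_intros cont)
  then have "(\<lambda>x. M * snd x - u x) ` closure V \<subseteq> closure {0..}"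
    by (rule image_closure_subset) (use le in auto)
  then show "u x \<le> M * snd x" using assms by auto
qed

text \<open>The barrier \<open>k (G - exp (- A))\<close> is compared with \<open>M x_n - u\<close>
  in the annulus between radii \<open>h/2\<close> and \<open>h\<close>: it is at most
  \<open>k\<close> on the inner sphere and 0 on the outer one, and \<open>outer\<close> treats
  boundary points of \<open>V\<close>, where \<open>u = 0\<close>. The subtracted terms are the
  drift error: the barrier has gradient at most \<open>2 A k / h\<close>, and \<open>M x_n\<close>
  adds \<open>M\<close> to the normal part.\<close>

lemma Gaussian_lower_bound:
  assumes h: "0 < h" and c: "\<And>x. dist x c < h \<Longrightarrow> norm (fst x) < 2 * r \<and> snd x < 2 * r" and k: "0 \<le> k"
    and inner: "\<And>x. x \<in> V \<Longrightarrow> dist x c \<le> h / 2 \<Longrightarrow> k \<le> M * snd x - u x"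
    and outer: "\<And>x. x \<in> closure V \<Longrightarrow> x \<notin> V \<Longrightarrow> dist x c < h \<Longrightarrow>
      k * (exp (- (A * (dist x c / h)\<^sup>2)) - exp (- A)) \<le> M * snd x"
    and x: "x \<in> V" "dist x c < h"
  shows "k * (exp (- (A * (dist x c / h)\<^sup>2)) - exp (- A))
      - (4 * N * A * k * (\<beta>' + \<beta> (2 * r)) + 2 * N * h * M * \<beta> (2 * r)) \<le> M * snd x - u x"
proof (cases "dist x c \<le> h / 2")
  case True
  have "exp (- (A * (dist x c / h)\<^sup>2)) - exp (- A) \<le> 1"
    using A_pos by (smt (verit) exp_ge_zero exp_le_one_iff mult_nonneg_nonneg zero_le_power2)
  then have "k * (exp (- (A * (dist x c / h)\<^sup>2)) - exp (- A)) \<le> k"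
    using k by (simp add: mult_left_le)
  moreover have "0 \<le> 4 * N * A * k * (\<beta>' + \<beta> (2 * r)) + 2 * N * h * M * \<beta> (2 * r)"
    using N A_pos k h M \<beta>(1) \<beta>(2)[of "2 * r"] r by simp
  ultimately show ?thesis using inner[OF x(1) True] by linarith
next
  case False
  \<comment> \<open>This scaling gives \<open>G\<close> the value \<open>exp (- A)\<close> on the
    outer sphere, whatever \<open>h\<close> is.\<close>
  define \<alpha> where "\<alpha> = A / h\<^sup>2"
  define G where "G x = exp (- (\<alpha> * ((x - c) \<bullet> (x - c))))" for x
  have Geq: "G x = exp (- (A * (dist x c / h)\<^sup>2))" for x
    by (simp add: G_def \<alpha>_def dist_norm power2_norm_eq_inner[symmetric] power_divide)
  have G: "0 < G x" "G x \<le> 1" for x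
    using A_pos by (auto simp: Geq)
  define D where "D = V \<inter> ball c h - cball c (h / 2)"
  define g where "g x = k * (G x - exp (- A)) - M * snd x" for x
  define grad where "grad x = k *\<^sub>R ((- 2 * \<alpha> * G x) *\<^sub>R (x - c)) - (0, M)" for x
  define H where "H x v = k *\<^sub>R ((- 2 * \<alpha> * G x) *\<^sub>R v + (4 * \<alpha>\<^sup>2 * G x * ((x - c) \<bullet> v)) *\<^sub>R (x - c))" for x v
  have \<alpha>: "0 < \<alpha>" using A_pos h by (simp add: \<alpha>_def)
  have dG: "(G has_derivative (\<lambda>v. ((- 2 * \<alpha> * G x) *\<^sub>R (x - c)) \<bullet> v)) (at x)"
    "((\<lambda>x. (- 2 * \<alpha> * G x) *\<^sub>R (x - c)) has_derivative
       (\<lambda>v. (- 2 * \<alpha> * G x) *\<^sub>R v + (4 * \<alpha>\<^sup>2 * G x * ((x - c) \<bullet> v)) *\<^sub>R (x - c))) (at x)" for x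
    using Gaussian_has_derivative[of \<alpha> c x] unfolding G_def by auto
  have gn: "norm (k *\<^sub>R ((- 2 * \<alpha> * G x) *\<^sub>R (x - c))) \<le> 2 * A * k / h" if "x \<in> D" for x
  proof -
    have "norm (x - c) \<le> h" using that by (auto simp: D_def dist_norm norm_minus_commute)
    then have "\<alpha> * (G x * norm (x - c)) \<le> \<alpha> * (1 * h)"
      using \<alpha> G[of x] h by (intro mult_left_mono mult_mono) auto
    also have "\<dots> = A / h" using h by (simp add: \<alpha>_def power2_eq_square)
    finally have "k * (2 * (\<alpha> * (G x * norm (x - c)))) \<le> k * (2 * (A / h))"
      using k by (intro mult_left_mono) auto
    then show ?thesis using k \<alpha> G(1)[of x] by (simp add: abs_mult ac_simps)
  qed
  have "u x + g x \<le> N * (2 * h) * ((2 * A * k / h) * \<beta>' + (2 * A * k / h + M) * \<beta> (2 * r))"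
  proof (rule cp[where D = D and c = 0 and grad = grad and H = H])
    show "open D" using V by (auto simp: D_def)
    show "D \<subseteq> V" by (auto simp: D_def)
    then show "D \<subseteq> Pcyl (2 * r) (2 * r) 0" using V by auto
    show "dist x y \<le> 2 * h" if "x \<in> D" "y \<in> D" for x y
      using that dist_triangle2[of x y c] by (auto simp: D_def dist_commute)
    show "(g has_derivative (\<lambda>v. grad x \<bullet> v)) (at x)" for x
      unfolding g_def grad_def
      by (rule derivative_eq_intros dG refl)+ (auto simp: fun_eq_iff inner_diff_left inner_prod_def algebra_simps)
    show "(grad has_derivative H x) (at x)" for x
      unfolding grad_def H_def
      by (rule derivative_eq_intros dG refl)+ (auto simp: fun_eq_iff)
    have "continuous_on UNIV G"
      unfolding G_def by (intro continuous_intros)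
    then show "continuous_on UNIV (\<lambda>x. H x i)" for i
      unfolding H_def by (intro continuous_intros)
    show "0 \<le> (\<Sum>i\<in>Basis. \<Sum>j\<in>Basis. a x i j * (H x i \<bullet> j))" if x: "x \<in> D" for x
    proof -
      have xV: "x \<in> V" and xd: "h / 2 \<le> norm (x - c)"
        using x by (auto simp: D_def dist_norm norm_minus_commute)
      have "(\<Sum>i\<in>Basis. \<Sum>j\<in>Basis. a x i j * (H x i \<bullet> j))
        = (\<Sum>i\<in>Basis. \<Sum>j\<in>Basis. a x i j * (((- 2 * \<alpha> * G x * k) *\<^sub>R i + ((4 * \<alpha>\<^sup>2 * G x * k) * ((x - c) \<bullet> i)) *\<^sub>R (x - c)) \<bullet> j))"
        unfolding H_def by (simp add: algebra_simps)
      also have "\<dots> = (- 2 * \<alpha> * G x * k) * (\<Sum>i\<in>Basis. a x i i)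
          + (4 * \<alpha>\<^sup>2 * G x * k) * (\<Sum>i\<in>Basis. \<Sum>j\<in>Basis. a x i j * ((x - c) \<bullet> i) * ((x - c) \<bullet> j))"
        by (rule sum_Basis_scaled_rank_one)
      also have "\<dots> = (2 * \<alpha> * G x * k) * (2 * \<alpha> * (\<Sum>i\<in>Basis. \<Sum>j\<in>Basis. a x i j * ((x - c) \<bullet> i) * ((x - c) \<bullet> j)) - (\<Sum>i\<in>Basis. a x i i))"
        by (simp add: algebra_simps power2_eq_square)
      also have "\<dots> \<ge> 0"
      proof -
        have "(h / 2)\<^sup>2 \<le> (norm (x - c))\<^sup>2"
          using xd h by (intro power_mono) auto
        then have "\<nu> * (h / 2)\<^sup>2 \<le> (\<Sum>i\<in>Basis. \<Sum>j\<in>Basis. a x i j * ((x - c) \<bullet> i) * ((x - c) \<bullet> j))"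
          using elliptic_trace_le(2)[OF ell xV, of "x - c"] \<nu> by (smt (verit) mult_left_mono)
        then have "2 * \<alpha> * (\<nu> * (h / 2)\<^sup>2) \<le> 2 * \<alpha> * (\<Sum>i\<in>Basis. \<Sum>j\<in>Basis. a x i j * ((x - c) \<bullet> i) * ((x - c) \<bullet> j))"
          using \<alpha> by (intro mult_left_mono) auto
        \<comment> \<open>Origin of the value of \<open>A\<close>: outside the inner ball the
          rank-one part of the Hessian matches the largest possible trace of
          \<open>a\<close>.\<close>
        moreover have "2 * \<alpha> * (\<nu> * (h / 2)\<^sup>2) = real DIM('a \<times> real) / \<nu>"
          using \<nu> h by (simp add: \<alpha>_def A_def power2_eq_square field_simps)
        ultimately have "0 \<le> 2 * \<alpha> * (\<Sum>i\<in>Basis. \<Sum>j\<in>Basis. a x i j * ((x - c) \<bullet> i) * ((x - c) \<bullet> j)) - (\<Sum>i\<in>Basis. a x i i)"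
          using elliptic_trace_le(1)[OF ell xV] by linarith
        then show ?thesis using \<alpha> G(1)[of x] k by (intro mult_nonneg_nonneg) auto
      qed
      finally show ?thesis .
    qed
    show "norm (fst (grad x)) \<le> 2 * A * k / h" if "x \<in> D" for x
    proof -
      have "fst (grad x) = fst (k *\<^sub>R ((- 2 * \<alpha> * G x) *\<^sub>R (x - c)))"
        by (simp add: grad_def)
      then show ?thesis
        using gn[OF that] norm_fst_le[of "fst w" "snd w" for w] by (smt (verit) prod.collapse)
    qed
    show "\<bar>snd (grad x)\<bar> \<le> 2 * A * k / h + M" if "x \<in> D" for x
    proof -
      have "snd (grad x) = snd (k *\<^sub>R ((- 2 * \<alpha> * G x) *\<^sub>R (x - c))) - M"
        by (simp add: grad_def)
      moreover have "\<bar>snd (k *\<^sub>R ((- 2 * \<alpha> * G x) *\<^sub>R (x - c)))\<bar> \<le> 2 * A * k / h"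
        using gn[OF that] norm_snd_le[of "snd w" "fst w" for w :: "'a \<times> real"] by (smt (verit) prod.collapse real_norm_def)
      ultimately show ?thesis using M by linarith
    qed
    show "0 \<le> 2 * A * k / h" "0 \<le> 2 * A * k / h + M"
      using A_pos k h M by auto
    show "x \<in> D" using x False by (auto simp: D_def dist_commute)
    fix y assume y: "y \<in> frontier D"
    have D': "closure D \<subseteq> closure V \<inter> (cball c h - ball c (h / 2))"
    proof (rule closure_minimal)
      show "D \<subseteq> closure V \<inter> (cball c h - ball c (h / 2))"
        using closure_subset[of V] by (auto simp: D_def)
      have "cball c h - ball c (h / 2) = cball c h \<inter> - ball c (h / 2)" by auto
      then show "closed (closure V \<inter> (cball c h - ball c (h / 2)))"
        by (auto intro!: closed_Int)
    qed
    have yc: "y \<in> closure D" "y \<notin> D"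
      using y \<open>open D\<close> by (auto simp: frontier_def interior_open)
    then have yV: "y \<in> closure V" and yh: "dist y c \<le> h" "h / 2 \<le> dist y c"
      using D' by (auto simp: dist_commute)
    show "u y + g y \<le> 0"
    proof (cases "dist y c = h")
      case True
      then have "G y = exp (- A)" using h by (simp add: Geq)
      then show ?thesis using closure_V_le[OF yV] by (simp add: g_def)
    next
      case F: False
      then have yh': "dist y c < h" using yh by simp
      show ?thesis
      proof (cases "y \<in> V")
        case True
        then have "dist y c \<le> h / 2"
          using yc(2) yh' by (auto simp: D_def dist_commute)
        then have "k \<le> M * snd y - u y" using inner True by blast
        moreover have "k * (G y - exp (- A)) \<le> k * 1"
          using G[of y] k by (intro mult_left_mono) (auto simp: algebra_simps intro: order_trans)
        ultimately show ?thesis by (simp add: g_def)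
      next
        case False
        then have "u y = 0" using bdry[OF yV] c[OF yh'] by blast
        then show ?thesis using outer[OF yV False yh'] by (simp add: g_def Geq)
      qed
    qed
  qed (use r in auto)
  also have "\<dots> = 4 * N * A * k * (\<beta>' + \<beta> (2 * r)) + 2 * N * h * M * \<beta> (2 * r)"
    using h by (simp add: field_simps)
  finally show ?thesis by (simp add: g_def Geq)
qed

text \<open>The constant defect \<open>E\<close> is replaced by \<open>E \<psi>\<close>, where
  \<psi> is at least 1 on the side and the top of the cylinder and nonnegative on the rest of the
  boundary. In the quarter cylinder \<psi> is at most \<open>(1/4)^2\<close> plus
  \<open>K x_n / \<rho>\<close>: up to the drift error the defect drops to \<open>E / 16\<close>,
  and the slope pays for the remaining part.\<close>

lemma quadratic_improvement:
  assumes \<rho>: "0 < \<rho>" "norm xb + \<rho> < 2 * r" and k: "k \<le> M" "0 \<le> k" and E: "0 \<le> E"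
    and hyp: "\<And>x. x \<in> V \<Longrightarrow> x \<in> Pcyl \<rho> \<rho> xb \<Longrightarrow> k * snd x - E \<le> M * snd x - u x"
    and x: "x \<in> V" "x \<in> Pcyl (\<rho> / 4) (\<rho> / 4) xb"
  shows "(k - K * (E / \<rho>)) * snd x - (E / 16 + 3 * N * (K + 2 * K2 + 2) * E * (\<beta>' + \<beta> \<rho>) + 3 * N * \<rho> * M * \<beta> \<rho>)
    \<le> M * snd x - u x"
proof -
  \<comment> \<open>The concave term in \<open>x_n\<close> makes \<open>- E \<psi>\<close> a
    subsolution: with coefficient \<open>K2\<close> it outweighs the trace coming from the
    paraboloid in \<open>x'\<close>. For heights up to \<rho> it is dominated by the part
    \<open>K2\<close> of \<open>K = K2 + 2\<close>, which leaves
    \<open>2 x_n / \<rho>\<close>.\<close>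
  define \<psi> where "\<psi> x = (1 / \<rho>\<^sup>2) * ((fst x - xb) \<bullet> (fst x - xb)) + (K / \<rho>) * snd x - (K2 / \<rho>\<^sup>2) * (snd x)\<^sup>2" for x :: "'a \<times> real"
  define D where "D = V \<inter> Pcyl \<rho> \<rho> xb"
  define g where "g x = (k - M) * snd x - E * \<psi> x" for x
  define grad where "grad x = (- (2 * E / \<rho>\<^sup>2) *\<^sub>R (fst x - xb), (k - M) - E * K / \<rho> + 2 * E * K2 * snd x / \<rho>\<^sup>2)" for x :: "'a \<times> real"
  define H where "H x v = (- (2 * E / \<rho>\<^sup>2) *\<^sub>R fst v, 2 * E * K2 * snd v / \<rho>\<^sup>2)" for x v :: "'a \<times> real"
  have \<rho>2: "\<rho> < 2 * r" using \<rho> norm_ge_zero[of xb] by linarith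
  have oP: "open (Pcyl \<rho> \<rho> xb)"
    unfolding Pcyl_def by (intro open_Collect_conj open_Collect_less continuous_intros)
  have "u x + g x \<le> N * (3 * \<rho>) * ((2 * E / \<rho>) * \<beta>' + (M + E * (K + 2 * K2) / \<rho>) * \<beta> \<rho>)"
  proof (rule cp[where D = D and c = xb and grad = grad and H = H])
    show oD: "open D" using V oP by (auto simp: D_def)
    show "D \<subseteq> V" "D \<subseteq> Pcyl \<rho> \<rho> xb" by (auto simp: D_def)
    show "dist x y \<le> 3 * \<rho>" if "x \<in> D" "y \<in> D" for x y
    proof -
      have "dist (fst x) (fst y) \<le> dist (fst x) xb + dist (fst y) xb"
        by (rule dist_triangle2)
      moreover have "\<bar>snd x - snd y\<bar> \<le> \<rho>" "dist (fst x) xb < \<rho>" "dist (fst y) xb < \<rho>"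
        using that by (auto simp: D_def Pcyl_def dist_norm)
      moreover have "dist x y \<le> dist (fst x) (fst y) + \<bar>snd x - snd y\<bar>"
        using norm_Pair_le[of "fst x - fst y" "snd x - snd y"] by (simp add: dist_norm minus_prod_def)
      ultimately show ?thesis by linarith
    qed
    show "(g has_derivative (\<lambda>v. grad x \<bullet> v)) (at x)" for x
    proof -
      define s1 s2 s3 where "s1 = 1 / \<rho>\<^sup>2" and "s2 = K / \<rho>" and "s3 = K2 / \<rho>\<^sup>2"
      have geq: "g = (\<lambda>x. (k - M) * snd x - E * (s1 * ((fst x - xb) \<bullet> (fst x - xb)) + s2 * snd x - s3 * (snd x)\<^sup>2))"
        by (simp add: g_def \<psi>_def s1_def s2_def s3_def fun_eq_iff)
      have gradeq: "grad x = (- (2 * E * s1) *\<^sub>R (fst x - xb), (k - M) - E * s2 + 2 * E * s3 * snd x)"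
        by (simp add: grad_def s1_def s2_def s3_def)
      show ?thesis
        unfolding geq gradeq
        by (auto intro!: derivative_eq_intros simp: fun_eq_iff inner_prod_def inner_commute)
          (auto simp: algebra_simps)
    qed
    show "(grad has_derivative H x) (at x)" for x
      unfolding grad_def H_def
      using \<rho> by (auto intro!: derivative_eq_intros simp: fun_eq_iff power2_eq_square power4_eq_xxxx)
    show "continuous_on UNIV (\<lambda>x. H x i)" for i
      unfolding H_def by (intro continuous_intros)
    show "0 \<le> (\<Sum>i\<in>Basis. \<Sum>j\<in>Basis. a x i j * (H x i \<bullet> j))" if x: "x \<in> D" for x
    proof -
      have xV: "x \<in> V" using x by (auto simp: D_def)
      define e where "e = (0 :: 'a, 1 :: real)"
      \<comment> \<open>In \<open>K2 + 1\<close> the summand 1 restores the normal direction that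
        the multiple of the identity takes away.\<close>
      have He: "H x i = (- (2 * E / \<rho>\<^sup>2)) *\<^sub>R i + ((2 * E / \<rho>\<^sup>2 * (K2 + 1)) * (e \<bullet> i)) *\<^sub>R e" for i
        by (cases i) (simp add: H_def e_def algebra_simps add_divide_distrib)
      have "\<nu> * 1 \<le> (\<Sum>i\<in>Basis. \<Sum>j\<in>Basis. a x i j * (e \<bullet> i) * (e \<bullet> j))"
        using elliptic_trace_le(2)[OF ell xV, of e] by (simp add: e_def)
      then have "(K2 + 1) * \<nu> \<le> (K2 + 1) * (\<Sum>i\<in>Basis. \<Sum>j\<in>Basis. a x i j * (e \<bullet> i) * (e \<bullet> j))"
        using K2_nonneg by (intro mult_left_mono) auto
      moreover have "real DIM('a \<times> real) / \<nu> \<le> (K2 + 1) * \<nu>"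
        using \<nu> by (simp add: K2_def power2_eq_square field_simps)
      ultimately have "0 \<le> (K2 + 1) * (\<Sum>i\<in>Basis. \<Sum>j\<in>Basis. a x i j * (e \<bullet> i) * (e \<bullet> j)) - (\<Sum>i\<in>Basis. a x i i)"
        using elliptic_trace_le(1)[OF ell xV] by linarith
      then have "0 \<le> (2 * E / \<rho>\<^sup>2) * \<dots>"
        using E by (intro mult_nonneg_nonneg) auto
      also have "\<dots> = (- (2 * E / \<rho>\<^sup>2)) * (\<Sum>i\<in>Basis. a x i i)
         + (2 * E / \<rho>\<^sup>2 * (K2 + 1)) * (\<Sum>i\<in>Basis. \<Sum>j\<in>Basis. a x i j * (e \<bullet> i) * (e \<bullet> j))"
        by (simp add: algebra_simps add_divide_distrib)
      also have "\<dots> = (\<Sum>i\<in>Basis. \<Sum>j\<in>Basis. a x i j * (H x i \<bullet> j))"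
        unfolding He by (rule sum_Basis_scaled_rank_one[symmetric])
      finally show ?thesis .
    qed
    show "norm (fst (grad x)) \<le> 2 * E / \<rho>" if "x \<in> D" for x
    proof -
      have "norm (fst x - xb) \<le> \<rho>" using that by (auto simp: D_def Pcyl_def)
      then have "(2 * E / \<rho>\<^sup>2) * norm (fst x - xb) \<le> (2 * E / \<rho>\<^sup>2) * \<rho>"
        using E by (intro mult_left_mono) auto
      also have "\<dots> = 2 * E / \<rho>" using \<rho> by (simp add: power2_eq_square)
      finally show ?thesis using E by (simp add: grad_def)
    qed
    show "\<bar>snd (grad x)\<bar> \<le> M + E * (K + 2 * K2) / \<rho>" if "x \<in> D" for x
    proof -
      have "0 < snd x" "snd x < \<rho>" using that by (auto simp: D_def Pcyl_def)
      then have "(2 * E * K2 / \<rho>) * (snd x / \<rho>) \<le> (2 * E * K2 / \<rho>) * 1" "0 \<le> (2 * E * K2 / \<rho>) * (snd x / \<rho>)"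
        using E K2_nonneg \<rho> by (intro mult_left_mono mult_nonneg_nonneg; simp)+
      moreover have "0 \<le> E * K / \<rho>" using E K_ge \<rho> by auto
      moreover have "snd (grad x) = (k - M) - E * K / \<rho> + (2 * E * K2 / \<rho>) * (snd x / \<rho>)"
        by (simp add: grad_def power2_eq_square)
      moreover have "E * (K + 2 * K2) / \<rho> = E * K / \<rho> + 2 * E * K2 / \<rho>"
        by (simp add: algebra_simps add_divide_distrib)
      ultimately show ?thesis
        using k unfolding abs_le_iff by linarith
    qed
    show "0 \<le> 2 * E / \<rho>" "0 \<le> M + E * (K + 2 * K2) / \<rho>"
      using E K2_nonneg K_ge M \<rho> by auto
    show "x \<in> D" using x \<rho> by (auto simp: D_def Pcyl_def)
    fix y assume y: "y \<in> frontier D"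
    have D': "closure D \<subseteq> closure V \<inter> {x. norm (fst x - xb) \<le> \<rho> \<and> snd x \<le> \<rho>}"
    proof (rule closure_minimal)
      show "D \<subseteq> closure V \<inter> {x. norm (fst x - xb) \<le> \<rho> \<and> snd x \<le> \<rho>}"
        using closure_subset[of V] by (auto simp: D_def Pcyl_def)
      show "closed (closure V \<inter> {x. norm (fst x - xb) \<le> \<rho> \<and> snd x \<le> \<rho>})"
        by (intro closed_Int closed_Collect_conj closed_Collect_le continuous_intros closed_closure)
    qed
    have yc: "y \<in> closure D" "y \<notin> D"
      using y oD by (auto simp: frontier_def interior_open)
    then have yV: "y \<in> closure V" and y\<rho>: "norm (fst y - xb) \<le> \<rho>" "snd y \<le> \<rho>"
      using D' by auto
    have y0: "0 \<le> snd y" using closure_V_le[OF yV] by simp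
    have \<psi>0: "((norm (fst y - xb)) / \<rho>)\<^sup>2 + 2 * (snd y / \<rho>) \<le> \<psi> y"
    proof -
      have "(snd y / \<rho>) * (snd y / \<rho>) \<le> 1 * (snd y / \<rho>)"
        using y0 y\<rho> \<rho> by (intro mult_right_mono) auto
      then have "K2 * ((snd y / \<rho>) * (snd y / \<rho>)) \<le> K2 * (snd y / \<rho>)"
        using K2_nonneg by (intro mult_left_mono) auto
      then show ?thesis
        by (simp add: \<psi>_def K_def power2_norm_eq_inner[symmetric] power_divide power2_eq_square algebra_simps add_divide_distrib)
    qed
    have \<psi>nn: "0 \<le> \<psi> y"
      using y0 \<rho> by (intro order_trans[OF _ \<psi>0] add_nonneg_nonneg) auto
    show "u y + g y \<le> 0"
    proof (cases "y \<in> V")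
      case False
      have "norm (fst y) \<le> norm (fst y - xb) + norm xb"
        using norm_triangle_ineq[of "fst y - xb" xb] by simp
      then have "u y = 0" using bdry[OF yV False] y\<rho> \<rho> \<rho>2 by linarith
      moreover have "(k - M) * snd y \<le> 0" using k y0 by (simp add: mult_nonpos_nonneg)
      moreover have "0 \<le> E * \<psi> y" using E \<psi>nn by simp
      ultimately show ?thesis unfolding g_def by linarith
    next
      case True
      then have "norm (fst y - xb) = \<rho> \<or> snd y = \<rho>"
        using yc(2) y\<rho> V_D[OF True] by (auto simp: D_def Pcyl_def)
      then have "1 \<le> ((norm (fst y - xb)) / \<rho>)\<^sup>2 + 2 * (snd y / \<rho>)"
        using \<rho> y0 by auto
      then have "E * 1 \<le> E * \<psi> y" using E \<psi>0 by (intro mult_left_mono) auto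
      moreover have "k * snd y - E \<le> M * snd y - u y"
      proof -
        have cD: "closure D \<subseteq> closure V"
          by (rule closure_mono) (auto simp: D_def)
        have "continuous_on (closure D) (\<lambda>x. M * snd x - u x - (k * snd x - E))"
          using continuous_on_subset[OF cont cD] by (intro continuous_intros)
        then have "(\<lambda>x. M * snd x - u x - (k * snd x - E)) ` closure D \<subseteq> closure {0..}"
          by (rule image_closure_subset) (use hyp in \<open>auto simp: D_def\<close>)
        then show ?thesis using yc(1) by force
      qed
      ultimately show ?thesis by (simp add: g_def algebra_simps)
    qed
  next
    show "norm xb \<le> 2 * r" using \<rho> by linarith
  qed (use \<rho> \<rho>2 in auto)
  also have "N * (3 * \<rho>) * ((2 * E / \<rho>) * \<beta>' + (M + E * (K + 2 * K2) / \<rho>) * \<beta> \<rho>)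
      = 3 * N * E * (2 * \<beta>' + (K + 2 * K2) * \<beta> \<rho>) + 3 * N * \<rho> * M * \<beta> \<rho>"
    using \<rho> by (simp add: field_simps)
  also have "\<dots> \<le> 3 * N * E * ((K + 2 * K2 + 2) * (\<beta>' + \<beta> \<rho>)) + 3 * N * \<rho> * M * \<beta> \<rho>"
  proof -
    have "2 * \<beta>' + (K + 2 * K2) * \<beta> \<rho> \<le> (K + 2 * K2 + 2) * (\<beta>' + \<beta> \<rho>)"
      using \<beta>(1) \<beta>(2)[of \<rho>] \<rho> \<rho>2 K_ge K2_nonneg by (simp add: algebra_simps)
    then show ?thesis using N E by (intro add_right_mono mult_left_mono) auto
  qed
  finally have 1: "u x + g x \<le> 3 * N * (K + 2 * K2 + 2) * E * (\<beta>' + \<beta> \<rho>) + 3 * N * \<rho> * M * \<beta> \<rho>"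
    by (simp add: ac_simps)
  have "\<psi> x \<le> 1 / 16 + K * snd x / \<rho>"
  proof -
    have "(norm (fst x - xb) / \<rho>)\<^sup>2 \<le> (1 / 4)\<^sup>2"
      using x \<rho> by (intro power_mono) (auto simp: Pcyl_def field_simps)
    moreover have "0 \<le> K2 * (snd x)\<^sup>2 / \<rho>\<^sup>2" using K2_nonneg by simp
    ultimately show ?thesis
      by (simp add: \<psi>_def power2_norm_eq_inner[symmetric] power_divide power2_eq_square)
  qed
  then have "E * \<psi> x \<le> E * (1 / 16 + K * snd x / \<rho>)"
    using E by (rule mult_left_mono)
  then show ?thesis using 1 by (simp add: g_def algebra_simps)
qed

end

subsection \<open>Propagation and improvement of lower bounds\<close>

text \<open>Near the sphere the Gaussian profile is bounded by a linear function of the distance to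
  it. This keeps a low barrier below \<open>M x_n\<close> near the boundary.\<close>

lemma exp_square_diff_le:
  fixes A s :: real
  assumes "0 \<le> A" "0 \<le> s" "s \<le> 1"
  shows "exp (- (A * s\<^sup>2)) - exp (- A) \<le> 2 * A * (1 - s)"
proof -
  have "1 - A * (1 - s\<^sup>2) \<le> exp (- (A * (1 - s\<^sup>2)))"
    using exp_ge_add_one_self[of "- (A * (1 - s\<^sup>2))"] by simp
  then have "exp (- (A * s\<^sup>2)) * (1 - exp (- (A * (1 - s\<^sup>2)))) \<le> exp (- (A * s\<^sup>2)) * (A * (1 - s\<^sup>2))"
    by (intro mult_left_mono) auto
  also have "\<dots> \<le> 1 * (A * (1 - s\<^sup>2))"
    using assms by (intro mult_right_mono mult_nonneg_nonneg) (auto simp: power_le_one)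
  also have "\<dots> \<le> 2 * A * (1 - s)"
  proof -
    have "A * ((1 - s) * (1 + s)) \<le> A * ((1 - s) * 2)"
      using assms by (intro mult_left_mono) auto
    then show ?thesis by (simp add: power2_eq_square algebra_simps)
  qed
  also have "exp (- (A * s\<^sup>2)) * (1 - exp (- (A * (1 - s\<^sup>2)))) = exp (- (A * s\<^sup>2)) - exp (- A)"
    by (simp add: algebra_simps exp_add[symmetric])
  finally show ?thesis .
qed

text \<open>The inequality \<open>1 + x \<le> exp x\<close> gives linear growth inward from the
  sphere with slope \<open>A exp (- A)\<close>. It plays the role of a quantitative Hopf
  lemma.\<close>

lemma exp_square_diff_ge:
  fixes A t :: real
  assumes "0 \<le> A" "0 \<le> t" "t \<le> 1"
  shows "A * exp (- A) * t \<le> exp (- (A * (1 - t)\<^sup>2)) - exp (- A)"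
proof -
  have "t * t \<le> 1 * t" using assms by (intro mult_right_mono) auto
  then have "A * t \<le> A * (2 * t - t\<^sup>2)"
    using assms by (intro mult_left_mono) (auto simp: power2_eq_square)
  also have "\<dots> \<le> exp (A * (2 * t - t\<^sup>2)) - 1"
    using exp_ge_add_one_self[of "A * (2 * t - t\<^sup>2)"] by linarith
  finally have "exp (- A) * (A * t) \<le> exp (- A) * (exp (A * (2 * t - t\<^sup>2)) - 1)"
    by (intro mult_left_mono) auto
  also have "\<dots> = exp (- (A * (1 - t)\<^sup>2)) - exp (- A)"
    by (simp add: algebra_simps exp_add[symmetric] power2_eq_square)
  finally show ?thesis by (simp add: algebra_simps)
qed

text \<open>Here \<delta> is the value of the profile at \<open>r\<close>, and
  \<open>y\<^sub>0\<close> is the centre of a ball over which the closure of \<open>V\<close> lies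
  at height at least \<open>\<delta> r\<close>. \<open>J\<close> dominates the sum of \<beta> over
  the scales, by telescoping its first property. \<open>th\<close> is half of the least barrier
  value at distance at most \<open>3/4 h\<close>, relative to its factor \<open>k\<close>; the other
  half is kept for errors. Of the bounds on \<epsilon>, the first makes each error of the chain
  small against the last link, the second limits the total loss to half of the first slope, the
  third lets the defect halve at each scale up to the \<beta> term.\<close>

locale small_corner = corner V a u \<nu> N M r \<beta>' \<beta> A K2 K
  for V :: "('a::euclidean_space \<times> real) set" and a and u :: "'a \<times> real \<Rightarrow> real"
    and \<nu> N M r \<beta>' :: real and \<beta> :: "real \<Rightarrow> real" and A K2 K :: real +
  fixes \<delta> \<epsilon> th :: real and J :: "real \<Rightarrow> real" and y\<^sub>0 :: 'a
  assumes th_def: "th = (exp (- (9 / 16 * A)) - exp (- A)) / 2"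
    and \<delta>: "0 \<le> \<delta>" "128 * A * \<delta> \<le> 1"
    and \<beta>_\<epsilon>: "\<And>\<rho>. 0 < \<rho> \<Longrightarrow> \<rho> \<le> 2 * r \<Longrightarrow> \<beta>' + \<beta> \<rho> \<le> \<epsilon>" "\<beta> (2 * r) \<le> \<epsilon> * \<delta>"
    and J: "\<And>t. 0 < t \<Longrightarrow> t \<le> r \<Longrightarrow> J (t / 4) + \<beta> t \<le> J t" "\<And>t. 0 < t \<Longrightarrow> t \<le> r \<Longrightarrow> 0 \<le> J t" "J (r / 64) \<le> \<epsilon> * \<delta>"
    and \<epsilon>: "\<epsilon> * (4 * N * A + 2 * N) \<le> th ^ 514"
      "\<epsilon> * (128 * K * (4 * N * A + 2 * N) + 24 * K * N) \<le> 32 * th ^ 513 * (A * exp (- A))"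
      "3 * N * (K + 2 * K2 + 2) * \<epsilon> \<le> 1 / 16"
    and y\<^sub>0: "norm y\<^sub>0 \<le> 5 / 4 * r" "\<And>x. x \<in> closure V \<Longrightarrow> norm (fst x - y\<^sub>0) < r / 4 \<Longrightarrow> \<delta> * r \<le> snd x"
begin

lemma th: "0 < th" "th \<le> 1"
proof -
  show "0 < th" using A_pos by (simp add: th_def)
  have "exp (- (9 / 16 * A)) \<le> 1" using A_pos by simp
  moreover have "(x - y) / 2 \<le> 1" if "x \<le> 1" "0 < y" for x y :: real
    using that by simp
  ultimately show "th \<le> 1" unfolding th_def by (metis exp_gt_zero)
qed

text \<open>The two terms are of order \<open>M \<delta> r\<close> for different reasons: the first
  because \<open>k\<close> is, the second because \<open>\<beta> (2 * r)\<close> is at most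
  \<open>\<epsilon> * \<delta>\<close>, which offsets the full slope \<open>M\<close>.\<close>

lemma error_le:
  assumes "0 \<le> k" "k \<le> M * \<delta> * r" "0 < h" "h \<le> r"
  shows "4 * N * A * k * (\<beta>' + \<beta> (2 * r)) + 2 * N * h * M * \<beta> (2 * r) \<le> \<epsilon> * (4 * N * A + 2 * N) * (M * \<delta> * r)"
    and "\<epsilon> * (4 * N * A + 2 * N) * (M * \<delta> * r) \<le> th ^ 514 * (M * \<delta> * r)"
proof -
  have b: "0 \<le> \<beta>' + \<beta> (2 * r)" "\<beta>' + \<beta> (2 * r) \<le> \<epsilon>" "0 \<le> \<beta> (2 * r)"
    using \<beta>(1) \<beta>(2)[of "2 * r"] \<beta>_\<epsilon>(1)[of "2 * r"] r by auto
  have "(4 * N * A) * (k * (\<beta>' + \<beta> (2 * r))) \<le> (4 * N * A) * ((M * \<delta> * r) * \<epsilon>)"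
    using N A_pos assms b by (intro mult_left_mono mult_mono) auto
  moreover have "(2 * N) * (h * (M * \<beta> (2 * r))) \<le> (2 * N) * (r * (M * (\<epsilon> * \<delta>)))"
    using N M assms b \<beta>_\<epsilon>(2) by (intro mult_left_mono mult_mono) auto
  ultimately show "4 * N * A * k * (\<beta>' + \<beta> (2 * r)) + 2 * N * h * M * \<beta> (2 * r) \<le> \<epsilon> * (4 * N * A + 2 * N) * (M * \<delta> * r)"
    by (simp add: algebra_simps)
  show "\<epsilon> * (4 * N * A + 2 * N) * (M * \<delta> * r) \<le> th ^ 514 * (M * \<delta> * r)"
    using \<epsilon>(1) M \<delta> r by (intro mult_right_mono) auto
qed

text \<open>Within \<open>3/4 h\<close> of the centre the barrier is at least \<open>2 th\<close>
  times \<open>k\<close>; one \<open>th\<close> survives and the other pays the drift error. The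
  bound thus spreads from half of the ball to three quarters of it.\<close>

lemma propagate:
  assumes h: "0 < h" "h \<le> r" and c: "\<And>x. dist x c < h \<Longrightarrow> norm (fst x) < 2 * r \<and> snd x < 2 * r"
    and j: "j \<le> 513"
    and inner: "\<And>x. x \<in> V \<Longrightarrow> dist x c \<le> h / 2 \<Longrightarrow> th ^ j * (M * \<delta> * r) \<le> M * snd x - u x"
    and outer: "\<And>x. x \<in> closure V \<Longrightarrow> x \<notin> V \<Longrightarrow> dist x c < h \<Longrightarrow>
      (th ^ j * (M * \<delta> * r)) * (exp (- (A * (dist x c / h)\<^sup>2)) - exp (- A)) \<le> M * snd x"
    and x: "x \<in> V" "dist x c \<le> 3 / 4 * h"
  shows "th ^ Suc j * (M * \<delta> * r) \<le> M * snd x - u x"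
proof -
  define k where "k = th ^ j * (M * \<delta> * r)"
  have nn: "0 \<le> M * \<delta> * r" using M \<delta> r by simp
  have k: "0 \<le> k" "k \<le> M * \<delta> * r"
    using th nn by (auto simp: k_def mult_left_le_one_le power_le_one)
  have "(dist x c / h)\<^sup>2 \<le> (3 / 4)\<^sup>2"
    using x h by (intro power_mono) (auto simp: field_simps)
  then have "A * (dist x c / h)\<^sup>2 \<le> A * (9 / 16)"
    using A_pos by (intro mult_left_mono) (auto simp: power2_eq_square)
  then have "2 * th \<le> exp (- (A * (dist x c / h)\<^sup>2)) - exp (- A)"
    by (simp add: th_def)
  then have "k * (2 * th) \<le> k * (exp (- (A * (dist x c / h)\<^sup>2)) - exp (- A))"
    using k by (intro mult_left_mono) auto
  moreover have "k * (exp (- (A * (dist x c / h)\<^sup>2)) - exp (- A))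
      - (4 * N * A * k * (\<beta>' + \<beta> (2 * r)) + 2 * N * h * M * \<beta> (2 * r)) \<le> M * snd x - u x"
    by (rule Gaussian_lower_bound) (use h c k inner outer x in \<open>auto simp: k_def\<close>)
  moreover have "4 * N * A * k * (\<beta>' + \<beta> (2 * r)) + 2 * N * h * M * \<beta> (2 * r) \<le> th ^ 514 * (M * \<delta> * r)"
    using error_le[OF k h] by linarith
  moreover have "th ^ 514 * (M * \<delta> * r) \<le> th ^ Suc j * (M * \<delta> * r)"
    using th j nn by (intro mult_right_mono power_decreasing) auto
  moreover have "th ^ Suc j * (M * \<delta> * r) = th * k" by (simp add: k_def)
  moreover have "k * (2 * th) = 2 * (th * k)" by simp
  ultimately show ?thesis by linarith
qed

text \<open>The ball may cross the boundary of \<open>V\<close>. The barrier vanishes on the sphere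
  and rises inward with slope at most \<open>2 A k / h\<close>, which is at most
  \<open>128 A \<delta> M \<le> M\<close>, while a point at distance \<open>s\<close> from the
  sphere has height at least \<open>s\<close> because \<open>h \<le> snd c\<close>.\<close>

lemma outer_interior:
  assumes h: "r / 64 \<le> h" "h \<le> snd c" and k: "0 \<le> k" "k \<le> M * \<delta> * r" and x: "x \<in> closure V" "dist x c < h"
  shows "k * (exp (- (A * (dist x c / h)\<^sup>2)) - exp (- A)) \<le> M * snd x"
proof -
  have h0: "0 < h" using h r by linarith
  have "\<bar>snd x - snd c\<bar> \<le> dist x c"
    using dist_snd_le[of x c] by (simp add: dist_real_def)
  then have sx: "h - dist x c \<le> snd x" using h by linarith
  have "k * (exp (- (A * (dist x c / h)\<^sup>2)) - exp (- A)) \<le> k * (2 * A * (1 - dist x c / h))"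
    using exp_square_diff_le[of A "dist x c / h"] A_pos x h0 k by (intro mult_left_mono) auto
  also have "\<dots> \<le> (M * \<delta> * r) * (2 * A * (1 - dist x c / h))"
    using k A_pos x h0 by (intro mult_right_mono) auto
  also have "\<dots> = M * ((128 * A * \<delta>) * (r / 64 / h) * (h - dist x c))"
    using h0 by (simp add: field_simps)
  also have "\<dots> \<le> M * (1 * 1 * (h - dist x c))"
    using M \<delta> A_pos h h0 r x by (intro mult_left_mono mult_right_mono mult_mono) auto
  also have "\<dots> \<le> M * snd x" using sx M by (intro mult_left_mono) auto
  finally show ?thesis .
qed

text \<open>The segment from the point at height \<open>r/64\<close> over \<open>y\<^sub>0\<close>
  to the given centre has length at most \<open>7/4 r + r/4 = 2 r\<close>, so each of 512 steps is
  at most \<open>r/256\<close>. This is exactly the gain of \<open>propagate\<close> with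
  \<open>h = r/64\<close>, from radius \<open>r/128\<close> to \<open>3r/256\<close>. One factor
  \<open>th\<close> for the start and one per step make \<open>th ^ 513\<close>.\<close>

lemma chain:
  assumes c: "norm c' \<le> 5 / 4 * r" "r / 64 \<le> c\<^sub>n" "c\<^sub>n \<le> r / 4" "norm (c' - y\<^sub>0) \<le> 7 / 4 * r"
    and x: "x \<in> V" "dist x (c', c\<^sub>n) \<le> r / 128"
  shows "th ^ 513 * (M * \<delta> * r) \<le> M * snd x - u x"
proof -
  define c1 where "c1 = (y\<^sub>0, r / 64)"
  define cj where "cj j = c1 + (real j / 512) *\<^sub>R ((c', c\<^sub>n) - c1)" for j
  have nn: "0 \<le> M * \<delta> * r" using M \<delta> r by simp
  have start: "th * (M * \<delta> * r) \<le> M * snd x - u x" if x: "x \<in> V" "dist x c1 \<le> r / 128" for x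
  proof -
    have d1: "dist c1 (y\<^sub>0, - (r / 16)) = 5 / 64 * r"
      using r by (simp add: c1_def dist_Pair_Pair dist_real_def)
    \<comment> \<open>The centre lies at depth \<open>r/16\<close> below height 0, so the inner ball
      of radius \<open>r/16\<close> misses \<open>V\<close> and the inner condition is vacuous. The
      bound comes from the boundary over the ball around \<open>y\<^sub>0\<close>, where
      \<open>M x_n\<close> is at least \<open>M \<delta> r\<close>.\<close>
    have "th ^ Suc 0 * (M * \<delta> * r) \<le> M * snd x - u x"
    proof (rule propagate[where h = "r / 8" and c = "(y\<^sub>0, - (r / 16))"])
      fix y assume y: "dist y (y\<^sub>0, - (r / 16)) < r / 8"
      have f: "norm (fst y - y\<^sub>0) < r / 8" "\<bar>snd y + r / 16\<bar> < r / 8"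
        using dist_fst_le[of y "(y\<^sub>0, - (r / 16))"] dist_snd_le[of y "(y\<^sub>0, - (r / 16))"] y
        by (auto simp: dist_norm)
      then show "norm (fst y) < 2 * r \<and> snd y < 2 * r"
        using norm_triangle_ineq[of "fst y - y\<^sub>0" y\<^sub>0] y\<^sub>0(1) r unfolding abs_less_iff by auto
      assume yV: "y \<in> closure V" "y \<notin> V"
      have "exp (- (A * (dist y (y\<^sub>0, - (r / 16)) / (r / 8))\<^sup>2)) \<le> 1"
        using A_pos by simp
      then have "exp (- (A * (dist y (y\<^sub>0, - (r / 16)) / (r / 8))\<^sup>2)) - exp (- A) \<le> 1"
        using exp_gt_zero[of "- A"] by linarith
      then have "(M * \<delta> * r) * (exp (- (A * (dist y (y\<^sub>0, - (r / 16)) / (r / 8))\<^sup>2)) - exp (- A)) \<le> (M * \<delta> * r) * 1"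
        using nn by (rule mult_left_mono)
      also have "\<dots> = M * (\<delta> * r)" by simp
      also have "\<dots> \<le> M * snd y"
        using y\<^sub>0(2)[OF yV(1)] f M r by (intro mult_left_mono) auto
      finally show "th ^ 0 * (M * \<delta> * r) * (exp (- (A * (dist y (y\<^sub>0, - (r / 16)) / (r / 8))\<^sup>2)) - exp (- A)) \<le> M * snd y"
        by simp
    next
      fix y assume y: "y \<in> V" "dist y (y\<^sub>0, - (r / 16)) \<le> r / 8 / 2"
      have "\<bar>snd y + r / 16\<bar> \<le> r / 16"
        using dist_snd_le[of y "(y\<^sub>0, - (r / 16))"] y by (auto simp: dist_norm)
      then show "th ^ 0 * (M * \<delta> * r) \<le> M * snd y - u y"
        using V_D(2)[OF y(1)] r by linarith
    next
      show "dist x (y\<^sub>0, - (r / 16)) \<le> 3 / 4 * (r / 8)"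
        using dist_triangle[of x "(y\<^sub>0, - (r / 16))" c1] x d1 r by linarith
    qed (use r x in auto)
    then show ?thesis by simp
  qed
  have step: "dist (cj (Suc j)) (cj j) \<le> r / 256" for j
  proof -
    have "cj (Suc j) - cj j = (real (Suc j) / 512 - real j / 512) *\<^sub>R ((c', c\<^sub>n) - c1)"
      unfolding cj_def scaleR_diff_left by simp
    also have "real (Suc j) / 512 - real j / 512 = 1 / 512" by (simp add: field_simps)
    finally have "cj (Suc j) - cj j = (1 / 512) *\<^sub>R ((c', c\<^sub>n) - c1)" .
    moreover have "norm ((c', c\<^sub>n) - c1) \<le> 2 * r"
    proof -
      have "norm ((c', c\<^sub>n) - c1) \<le> norm (c' - y\<^sub>0) + norm (c\<^sub>n - r / 64)"
        using norm_Pair_le[of "c' - y\<^sub>0" "c\<^sub>n - r / 64"] by (simp add: c1_def)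
      also have "\<dots> \<le> 2 * r" using c r by simp
      finally show ?thesis .
    qed
    ultimately show ?thesis by (simp add: dist_norm)
  qed
  have loc: "norm (fst (cj j)) \<le> 5 / 4 * r" "r / 64 \<le> snd (cj j)" "snd (cj j) \<le> r / 4" if "j \<le> 512" for j
  proof -
    define t where "t = real j / 512"
    have t: "0 \<le> t" "t \<le> 1" using that by (auto simp: t_def)
    have e: "cj j = ((1 - t) *\<^sub>R y\<^sub>0 + t *\<^sub>R c', (1 - t) * (r / 64) + t * c\<^sub>n)"
      by (simp add: cj_def c1_def t_def[symmetric] algebra_simps diff_divide_distrib)
    have "norm (fst (cj j)) \<le> (1 - t) * norm y\<^sub>0 + t * norm c'"
      using t norm_triangle_ineq[of "(1 - t) *\<^sub>R y\<^sub>0" "t *\<^sub>R c'"] by (simp add: e)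
    also have "\<dots> \<le> (1 - t) * (5 / 4 * r) + t * (5 / 4 * r)"
      using t c y\<^sub>0 by (intro add_mono mult_left_mono) auto
    finally show "norm (fst (cj j)) \<le> 5 / 4 * r" by (simp add: algebra_simps diff_divide_distrib)
    have "(1 - t) * (r / 64) + t * (r / 64) \<le> (1 - t) * (r / 64) + t * c\<^sub>n"
      using t c by (intro add_mono mult_left_mono) auto
    then show "r / 64 \<le> snd (cj j)" by (simp add: e algebra_simps diff_divide_distrib)
    have "(1 - t) * (r / 64) + t * c\<^sub>n \<le> (1 - t) * (r / 4) + t * (r / 4)"
      using t c r by (intro add_mono mult_left_mono) auto
    then show "snd (cj j) \<le> r / 4" by (simp add: e algebra_simps diff_divide_distrib)
  qed
  have main: "j \<le> 512 \<Longrightarrow> x \<in> V \<Longrightarrow> dist x (cj j) \<le> r / 128 \<Longrightarrow> th ^ Suc j * (M * \<delta> * r) \<le> M * snd x - u x" for j x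
  proof (induction j arbitrary: x)
    case 0
    then show ?case using start[of x] by (simp add: cj_def)
  next
    case (Suc j)
    then have j: "j \<le> 512" by simp
    show ?case
    proof (rule propagate[where h = "r / 64" and c = "cj j"])
      fix y assume y: "dist y (cj j) < r / 64"
      have "norm (fst y - fst (cj j)) < r / 64" "\<bar>snd y - snd (cj j)\<bar> < r / 64"
        using dist_fst_le[of y "cj j"] dist_snd_le[of y "cj j"] y by (auto simp: dist_norm)
      then show "norm (fst y) < 2 * r \<and> snd y < 2 * r"
        using norm_triangle_ineq[of "fst y - fst (cj j)" "fst (cj j)"] loc[OF j] r unfolding abs_less_iff by auto
      assume yV: "y \<in> closure V"
      have "0 \<le> th ^ Suc j * (M * \<delta> * r)" using th nn by simp
      moreover have "th ^ Suc j * (M * \<delta> * r) \<le> M * \<delta> * r"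
        using th nn by (intro mult_left_le_one_le power_le_one) auto
      ultimately show "th ^ Suc j * (M * \<delta> * r) * (exp (- (A * (dist y (cj j) / (r / 64))\<^sup>2)) - exp (- A)) \<le> M * snd y"
        using loc[OF j] by (intro outer_interior[OF _ _ _ _ yV y]) auto
    next
      show "dist x (cj j) \<le> 3 / 4 * (r / 64)"
        using dist_triangle[of x "cj j" "cj (Suc j)"] step[of j] Suc.prems r by linarith
    next
      show "th ^ Suc j * (M * \<delta> * r) \<le> M * snd y - u y" if "y \<in> V" "dist y (cj j) \<le> r / 64 / 2" for y
        using Suc.IH[OF j, of y] that by simp
    qed (use r Suc.prems in auto)
  qed
  have "cj 512 = (c', c\<^sub>n)" by (simp add: cj_def)
  then show ?thesis using main[of 512 x] x by simp
qed

text \<open>The slope guaranteed by \<open>exp_square_diff_ge\<close> for a barrier with factor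
  \<open>th ^ 513 * (M * \<delta> * r)\<close> in a ball of radius \<open>r/64\<close>.\<close>

definition k\<^sub>0 where "k\<^sub>0 = 64 * th ^ 513 * (A * exp (- A)) * (M * \<delta>)"

lemma k\<^sub>0: "0 \<le> k\<^sub>0" "k\<^sub>0 \<le> M"
proof -
  show "0 \<le> k\<^sub>0" using th A_pos M \<delta> by (simp add: k\<^sub>0_def)
  have "k\<^sub>0 = (th ^ 513 * exp (- A)) * (64 * A * \<delta>) * M"
    by (simp add: k\<^sub>0_def)
  also have "\<dots> \<le> (1 * 1) * 1 * M"
    using th A_pos M \<delta> by (intro mult_right_mono mult_mono) (auto simp: power_le_one)
  finally show "k\<^sub>0 \<le> M" by simp
qed

text \<open>The ball of radius \<open>r/64\<close> centred at height \<open>r/64\<close> over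
  \<open>x'\<close> touches height 0 below \<open>x\<close>, so the height of \<open>x\<close> is
  its distance to the sphere and the barrier becomes linear in it. The drift error survives as the
  first defect. The bound \<open>7/4 r\<close> in \<open>chain\<close> is \<open>r/2 + 5/4 r\<close>
  here.\<close>

lemma base_layer:
  assumes xb: "norm (fst x) \<le> r / 2" and x: "x \<in> V" "snd x \<le> r / 64"
  shows "k\<^sub>0 * snd x - \<epsilon> * (4 * N * A + 2 * N) * (M * \<delta> * r) \<le> M * snd x - u x"
proof -
  define c where "c = (fst x, r / 64)"
  define k where "k = th ^ 513 * (M * \<delta> * r)"
  define t where "t = snd x / (r / 64)"
  have nn: "0 \<le> M * \<delta> * r" using M \<delta> r by simp
  have k: "0 \<le> k" "k \<le> M * \<delta> * r"
    using th nn by (auto simp: k_def mult_left_le_one_le power_le_one)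
  have sx: "0 < snd x" using V_D x by blast
  have t: "0 < t" "t \<le> 1" using sx x r by (auto simp: t_def field_simps)
  have dx: "dist x c = r / 64 - snd x"
    using x by (cases x) (simp add: c_def dist_Pair_Pair dist_real_def)
  have dxt: "dist x c / (r / 64) = 1 - t" using r by (simp add: dx t_def field_simps)
  have "k * (exp (- (A * (dist x c / (r / 64))\<^sup>2)) - exp (- A))
      - (4 * N * A * k * (\<beta>' + \<beta> (2 * r)) + 2 * N * (r / 64) * M * \<beta> (2 * r)) \<le> M * snd x - u x"
  proof (rule Gaussian_lower_bound)
    fix y assume y: "dist y c < r / 64"
    have "norm (fst y - fst x) < r / 64" "\<bar>snd y - r / 64\<bar> < r / 64"
      using dist_fst_le[of y c] dist_snd_le[of y c] y by (auto simp: dist_norm c_def)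
    then show "norm (fst y) < 2 * r \<and> snd y < 2 * r"
      using norm_triangle_ineq[of "fst y - fst x" "fst x"] xb r unfolding abs_less_iff by auto
    assume "y \<in> closure V"
    then show "k * (exp (- (A * (dist y c / (r / 64))\<^sup>2)) - exp (- A)) \<le> M * snd y"
      using k y by (intro outer_interior) (auto simp: c_def)
  next
    fix y assume "y \<in> V" "dist y c \<le> r / 64 / 2"
    then show "k \<le> M * snd y - u y"
      unfolding k_def c_def using xb r norm_triangle_ineq4[of "fst x" y\<^sub>0] y\<^sub>0(1)
      by (intro chain[where c' = "fst x" and c\<^sub>n = "r / 64"]) auto
  qed (use r k x sx dx in auto)
  moreover have "4 * N * A * k * (\<beta>' + \<beta> (2 * r)) + 2 * N * (r / 64) * M * \<beta> (2 * r) \<le> \<epsilon> * (4 * N * A + 2 * N) * (M * \<delta> * r)"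
    using k r by (intro error_le) auto
  moreover have "k * (A * exp (- A) * t) \<le> k * (exp (- (A * (dist x c / (r / 64))\<^sup>2)) - exp (- A))"
    unfolding dxt using exp_square_diff_ge[of A t] A_pos t k by (intro mult_left_mono) auto
  moreover have "k * (A * exp (- A) * t) = k\<^sub>0 * snd x"
    using r by (simp add: k_def k\<^sub>0_def t_def)
  ultimately show ?thesis by linarith
qed

text \<open>As the radius shrinks from \<open>\<rho>\<close> to \<open>\<rho>/4\<close>, the slope \<open>k\<close> drops by \<open>K e\<close> while the defect \<open>e\<close> is halved up to
  a multiple of \<open>\<beta> \<rho>\<close>. The quantity \<open>k - 2 K e - 24 K N M J \<rho>\<close> does not decrease, so the slope never falls
  below half of its initial value.\<close>

definition layer_bound :: "'a \<Rightarrow> real \<Rightarrow> bool" where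
  "layer_bound xb \<rho> \<longleftrightarrow> (\<exists>k e. 0 \<le> e \<and> k \<le> k\<^sub>0 \<and> k\<^sub>0 / 2 \<le> k - 2 * K * e - 24 * K * N * M * J \<rho> \<and>
     (\<forall>x\<in>V. x \<in> Pcyl \<rho> \<rho> xb \<longrightarrow> k * snd x - e * \<rho> \<le> M * snd x - u x))"

lemma layer_bound_start:
  assumes "norm xb \<le> r / 4"
  shows "layer_bound xb (r / 64)"
  unfolding layer_bound_def
proof (intro exI conjI ballI impI)
  have "0 \<le> \<epsilon>" using \<beta>(1) \<beta>(2)[of r] \<beta>_\<epsilon>(1)[of r] r by linarith
  \<comment> \<open>The factor 64 converts the defect of \<open>base_layer\<close> into a defect
    relative to the radius \<open>r/64\<close>.\<close>
  then show "0 \<le> 64 * (\<epsilon> * (4 * N * A + 2 * N)) * (M * \<delta>)"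
    using N A_pos M \<delta> by auto
  show "k\<^sub>0 \<le> k\<^sub>0" ..
  \<comment> \<open>The second bound on \<epsilon> is made for this sum: \<open>128 K\<close> is
    \<open>2 K\<close> times the 64 of the defect, and \<open>24 K N\<close> belongs to
    \<open>J\<close>.\<close>
  have "24 * K * N * M * J (r / 64) \<le> 24 * K * N * M * (\<epsilon> * \<delta>)"
    using J(3) K_ge N M by (intro mult_left_mono) auto
  moreover have "(\<epsilon> * (128 * K * (4 * N * A + 2 * N) + 24 * K * N)) * (M * \<delta>) \<le> (32 * th ^ 513 * (A * exp (- A))) * (M * \<delta>)"
    using \<epsilon>(2) M \<delta> by (intro mult_right_mono) auto
  ultimately have "24 * K * N * M * J (r / 64) + 2 * K * (64 * (\<epsilon> * (4 * N * A + 2 * N)) * (M * \<delta>)) \<le> (32 * th ^ 513 * (A * exp (- A))) * (M * \<delta>)"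
    by (simp add: algebra_simps)
  also have "\<dots> = k\<^sub>0 / 2" by (simp add: k\<^sub>0_def)
  finally show "k\<^sub>0 / 2 \<le> k\<^sub>0 - 2 * K * (64 * (\<epsilon> * (4 * N * A + 2 * N)) * (M * \<delta>)) - 24 * K * N * M * J (r / 64)"
    by simp
  fix x assume x: "x \<in> V" "x \<in> Pcyl (r / 64) (r / 64) xb"
  have "norm (fst x) \<le> r / 2"
    using x(2) assms norm_triangle_ineq[of "fst x - xb" xb] r by (auto simp: Pcyl_def)
  then show "k\<^sub>0 * snd x - 64 * (\<epsilon> * (4 * N * A + 2 * N)) * (M * \<delta>) * (r / 64) \<le> M * snd x - u x"
  proof -
    have "64 * E * (M * \<delta>) * (r / 64) = E * (M * \<delta> * r)" for E
      by simp
    then show ?thesis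
      using base_layer[OF \<open>norm (fst x) \<le> r / 2\<close> x(1)] x(2) by (simp only: Pcyl_def mem_Collect_eq) linarith
  qed
qed

lemma layer_bound_step:
  assumes xb: "norm xb \<le> r / 4" and \<rho>: "0 < \<rho>" "\<rho> \<le> r / 64" and L: "layer_bound xb \<rho>"
  shows "layer_bound xb (\<rho> / 4)"
proof -
  obtain k e where e: "0 \<le> e" and k: "k \<le> k\<^sub>0" "k\<^sub>0 / 2 \<le> k - 2 * K * e - 24 * K * N * M * J \<rho>"
    and hyp: "\<And>x. x \<in> V \<Longrightarrow> x \<in> Pcyl \<rho> \<rho> xb \<Longrightarrow> k * snd x - e * \<rho> \<le> M * snd x - u x"
    using L unfolding layer_bound_def by blast
  have \<rho>r: "\<rho> \<le> r" "\<rho> \<le> 2 * r" using \<rho> r by auto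
  have nn: "0 \<le> 24 * K * N * M * J \<rho>" "0 \<le> 24 * K * N * M"
    using K_ge N M J(2)[OF \<rho>(1) \<rho>r(1)] by auto
  have k0: "0 \<le> k" "k \<le> M"
  proof -
    have "0 \<le> K * e" using K_ge e by simp
    moreover have "2 * K * e = 2 * (K * e)" by simp
    ultimately show "0 \<le> k" "k \<le> M" using k nn k\<^sub>0 by linarith+
  qed
  \<comment> \<open>The new defect consists of \<open>e \<rho> / 16\<close> from the quadratic
    barrier, at most as much again from the error proportional to \<open>e\<close>, and
    \<open>3 N \<rho> M (\<beta> \<rho>)\<close>. Division by the new radius
    \<open>\<rho> / 4\<close> gives this value.\<close>
  define e' where "e' = e / 2 + 12 * N * M * \<beta> \<rho>"
  have \<beta>\<rho>: "0 \<le> \<beta> \<rho>" "\<beta>' + \<beta> \<rho> \<le> \<epsilon>" using \<beta>(2) \<beta>_\<epsilon>(1) \<rho> \<rho>r by auto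
  show ?thesis
    unfolding layer_bound_def
  proof (rule exI[of _ "k - K * e"], rule exI[of _ e'], intro conjI ballI impI)
    show "0 \<le> e'" using e N M \<beta>\<rho> by (simp add: e'_def)
    show "k - K * e \<le> k\<^sub>0" using k e K_ge mult_nonneg_nonneg[of K e] by linarith
    \<comment> \<open>The slope loses \<open>K e\<close> and \<open>2 K e'\<close> equals
      \<open>K e + 24 K N M (\<beta> \<rho>)\<close>; the decrease of \<open>J\<close> covers the
      last summand.\<close>
    have "24 * K * N * M * (J (\<rho> / 4) + \<beta> \<rho>) \<le> 24 * K * N * M * J \<rho>"
      using J(1)[OF \<rho>(1) \<rho>r(1)] nn by (intro mult_left_mono) auto
    then show "k\<^sub>0 / 2 \<le> k - K * e - 2 * K * e' - 24 * K * N * M * J (\<rho> / 4)"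
      using k by (simp add: e'_def algebra_simps)
    fix x assume x: "x \<in> V" "x \<in> Pcyl (\<rho> / 4) (\<rho> / 4) xb"
    have \<rho>e: "e * \<rho> / \<rho> = e" using \<rho> by simp
    have "(k - K * (e * \<rho> / \<rho>)) * snd x - (e * \<rho> / 16 + 3 * N * (K + 2 * K2 + 2) * (e * \<rho>) * (\<beta>' + \<beta> \<rho>) + 3 * N * \<rho> * M * \<beta> \<rho>)
      \<le> M * snd x - u x"
      using xb \<rho> r k0 e hyp x by (intro quadratic_improvement) auto
    note this[unfolded \<rho>e]
    moreover have "3 * N * (K + 2 * K2 + 2) * (e * \<rho>) * (\<beta>' + \<beta> \<rho>) \<le> (e * \<rho>) * (1 / 16)"
    proof -
      have "3 * N * (K + 2 * K2 + 2) * (\<beta>' + \<beta> \<rho>) \<le> 3 * N * (K + 2 * K2 + 2) * \<epsilon>"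
        using \<beta>\<rho> N K_ge K2_nonneg by (intro mult_left_mono) auto
      also have "\<dots> \<le> 1 / 16" by (rule \<epsilon>(3))
      finally have "(e * \<rho>) * (3 * N * (K + 2 * K2 + 2) * (\<beta>' + \<beta> \<rho>)) \<le> (e * \<rho>) * (1 / 16)"
        using e \<rho> by (intro mult_left_mono) auto
      then show ?thesis by (simp only: ac_simps)
    qed
    moreover have "e' * (\<rho> / 4) = e * \<rho> / 16 + (e * \<rho>) * (1 / 16) + 3 * N * \<rho> * M * \<beta> \<rho>"
      by (simp add: e'_def algebra_simps)
    ultimately show "(k - K * e) * snd x - e' * (\<rho> / 4) \<le> M * snd x - u x" by linarith
  qed
qed

text \<open>Above height \<open>r/64\<close> the chain may end at \<open>x\<close> itself. Below,
  the cylinders centred over \<open>x'\<close> are followed down to the smallest radius in the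
  sequence that still exceeds \<open>x_n\<close>. It is at most \<open>4 x_n\<close>, so the
  remaining defect is itself a multiple of \<open>x_n\<close>.\<close>

lemma lower_bound:
  assumes x: "x \<in> V" "norm (fst x) \<le> r / 4" "snd x \<le> r / 4"
  shows "min (4 * th ^ 513) (32 * th ^ 513 * (A * exp (- A))) * (M * \<delta>) * snd x \<le> M * snd x - u x"
proof (cases "r / 64 \<le> snd x")
  case True
  have "th ^ 513 * (M * \<delta> * r) \<le> M * snd x - u x"
    using x True r norm_triangle_ineq4[of "fst x" y\<^sub>0] y\<^sub>0(1)
    by (intro chain[where c' = "fst x" and c\<^sub>n = "snd x"]) auto
  moreover have "min (4 * th ^ 513) (32 * th ^ 513 * (A * exp (- A))) * (M * \<delta>) * snd x
      \<le> (4 * th ^ 513) * (M * \<delta>) * (r / 4)"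
    using th M \<delta> x V_D(2)[OF x(1)] A_pos by (intro mult_mono) auto
  ultimately show ?thesis by (simp add: ac_simps)
next
  case False
  have sx: "0 < snd x" using V_D x by blast
  have L: "layer_bound (fst x) (r / 64 / 4 ^ j) \<and> 0 < r / 64 / 4 ^ j \<and> r / 64 / 4 ^ j \<le> r / 64" for j :: nat
  proof (induction j)
    case 0
    then show ?case using layer_bound_start[OF x(2)] r by simp
  next
    case (Suc j)
    moreover have "r / 64 / 4 ^ Suc j = r / 64 / 4 ^ j / 4" by simp
    ultimately show ?case using layer_bound_step[OF x(2), of "r / 64 / 4 ^ j"] by auto
  qed
  obtain n :: nat where "(1 / 4) ^ n < snd x / (r / 64)"
    using real_arch_pow_inv[of "snd x / (r / 64)" "1 / 4"] sx r by auto
  then have ex: "\<exists>n. r / 64 / 4 ^ n \<le> snd x"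
    using r by (intro exI[of _ n]) (simp add: field_simps power_divide)
  define m where "m = (LEAST n. r / 64 / 4 ^ n \<le> snd x)"
  have m: "r / 64 / 4 ^ m \<le> snd x" unfolding m_def by (rule LeastI_ex[OF ex])
  have "m \<noteq> 0" using m False by (cases m) auto
  then obtain i where i: "m = Suc i" by (cases m) auto
  have "\<not> r / 64 / 4 ^ i \<le> snd x"
    using not_less_Least[of i "\<lambda>n. r / 64 / 4 ^ n \<le> snd x"] i m_def by auto
  then have i2: "snd x < r / 64 / 4 ^ i" "r / 64 / 4 ^ i \<le> 4 * snd x"
    using m i by auto
  define \<rho> where "\<rho> = r / 64 / 4 ^ i"
  obtain k e where e: "0 \<le> e" and k: "k\<^sub>0 / 2 \<le> k - 2 * K * e - 24 * K * N * M * J \<rho>"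
    and hyp: "\<And>x'. x' \<in> V \<Longrightarrow> x' \<in> Pcyl \<rho> \<rho> (fst x) \<Longrightarrow> k * snd x' - e * \<rho> \<le> M * snd x' - u x'"
    using L[of i] unfolding layer_bound_def \<rho>_def by blast
  have "0 \<le> J \<rho>" using L[of i] r J(2)[of \<rho>] by (simp add: \<rho>_def)
  then have "0 \<le> 24 * K * N * M * J \<rho>" using K_ge N M by auto
  \<comment> \<open>The reserve \<open>2 K e\<close> in \<open>layer_bound\<close> pays for the
    final defect, since \<open>K \<ge> 2\<close>.\<close>
  moreover have "4 * e \<le> 2 * K * e" using K_ge e by (intro mult_right_mono) auto
  ultimately have "k\<^sub>0 / 2 \<le> k - 4 * e" using k by linarith
  then have "k\<^sub>0 / 2 * snd x \<le> (k - 4 * e) * snd x" using sx by (intro mult_right_mono) auto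
  moreover have "e * \<rho> \<le> e * (4 * snd x)" using i2 e by (intro mult_left_mono) (auto simp: \<rho>_def)
  moreover have "k * snd x - e * \<rho> \<le> M * snd x - u x"
    using i2 sx L[of i] x by (intro hyp) (auto simp: Pcyl_def \<rho>_def)
  moreover have "min (4 * th ^ 513) (32 * th ^ 513 * (A * exp (- A))) * (M * \<delta>) * snd x \<le> k\<^sub>0 / 2 * snd x"
  proof -
    have "min (4 * th ^ 513) (32 * th ^ 513 * (A * exp (- A))) * (M * \<delta>) \<le> (32 * th ^ 513 * (A * exp (- A))) * (M * \<delta>)"
      using M \<delta> by (intro mult_right_mono min.cobounded2 mult_nonneg_nonneg)
    also have "\<dots> = k\<^sub>0 / 2" by (simp add: k\<^sub>0_def)
    finally show ?thesis using sx by (intro mult_right_mono) auto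
  qed
  ultimately show ?thesis by (simp add: algebra_simps)
qed

end

subsection \<open>Oscillation decay\<close>

text \<open>The denominator is \<open>c + 1\<close> because \<open>c\<close> can be 0, as happens
  when the maximum principle supplies \<open>N = 0\<close>.\<close>

lemma mult_le_of_le_divide_Suc:
  fixes c d e :: real
  assumes "0 \<le> c" "0 < e" "e \<le> d / (c + 1)"
  shows "e * c \<le> d"
proof -
  have "e * (c + 1) \<le> d" using assms by (simp add: pos_le_divide_eq)
  then show ?thesis using assms by (simp add: algebra_simps)
qed

text \<open>The constants are extracted before the domain, the operator and the solution, so they
  depend only on the space, the dimension and \<nu>. Only the upper slope \<open>M\<close> is
  lowered; the lower one is treated by applying the result to \<open>-u\<close>.\<close>

lemma one_sided_improvement:
  fixes Xn :: "('a::euclidean_space \<times> real) set \<Rightarrow> (('a \<times> real) \<Rightarrow> real) \<Rightarrow> ennreal"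
  assumes X: "X_space Xn" and Alek: "Aleksandrov Xn" and \<nu>: "0 < \<nu>"
  obtains \<kappa> \<epsilon> \<delta>\<^sub>0 :: real where "0 < \<kappa>" "0 < \<epsilon>" "0 < \<delta>\<^sub>0"
    "\<And>\<Omega> a b u M r \<beta> J \<delta> y\<^sub>0 x. bounded_domain \<Omega> \<Longrightarrow> 0 < r \<Longrightarrow> elliptic \<nu> \<Omega> a \<Longrightarrow>
      b \<in> borel_measurable lebesgue \<Longrightarrow> strong_solution Xn \<Omega> a b u \<Longrightarrow> continuous_on (closure \<Omega>) u \<Longrightarrow> 0 \<le> M \<Longrightarrow>
      (\<And>x. x \<in> \<Omega> \<inter> Pcyl (2 * r) (2 * r) 0 \<Longrightarrow> u x \<le> M * snd x) \<Longrightarrow>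
      (\<And>x. x \<in> closure (\<Omega> \<inter> Pcyl (2 * r) (2 * r) 0) \<Longrightarrow> x \<notin> \<Omega> \<inter> Pcyl (2 * r) (2 * r) 0 \<Longrightarrow>
        norm (fst x) < 2 * r \<Longrightarrow> snd x < 2 * r \<Longrightarrow> u x = 0) \<Longrightarrow>
      X_modulus Xn \<Omega> (\<lambda>x. norm (fst (b x))) (6 * r) \<le> ennreal (\<epsilon> / 2) \<Longrightarrow>
      (\<And>\<rho> c. 0 < \<rho> \<Longrightarrow> \<rho> \<le> 2 * r \<Longrightarrow> norm c \<le> 2 * r \<Longrightarrow> Xn (Pcyl \<rho> \<rho> c \<inter> \<Omega>) (\<lambda>x. snd (b x)) \<le> ennreal (\<beta> \<rho>)) \<Longrightarrow>
      (\<And>\<rho>. 0 < \<rho> \<Longrightarrow> \<rho> \<le> 2 * r \<Longrightarrow> 0 \<le> \<beta> \<rho> \<and> \<beta> \<rho> \<le> \<epsilon> / 2) \<Longrightarrow> \<beta> (2 * r) \<le> \<epsilon> * \<delta> \<Longrightarrow>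
      (\<And>t. 0 < t \<Longrightarrow> t \<le> r \<Longrightarrow> J (t / 4) + \<beta> t \<le> J t) \<Longrightarrow> (\<And>t. 0 < t \<Longrightarrow> t \<le> r \<Longrightarrow> 0 \<le> J t) \<Longrightarrow>
      J (r / 64) \<le> \<epsilon> * \<delta> \<Longrightarrow> 0 \<le> \<delta> \<Longrightarrow> \<delta> \<le> \<delta>\<^sub>0 \<Longrightarrow> norm y\<^sub>0 \<le> 5 / 4 * r \<Longrightarrow>
      (\<And>x. x \<in> closure (\<Omega> \<inter> Pcyl (2 * r) (2 * r) 0) \<Longrightarrow> norm (fst x - y\<^sub>0) < r / 4 \<Longrightarrow> \<delta> * r \<le> snd x) \<Longrightarrow>
      x \<in> \<Omega> \<Longrightarrow> x \<in> Pcyl (r / 4) (r / 4) 0 \<Longrightarrow> \<kappa> * \<delta> * M * snd x \<le> M * snd x - u x"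
proof -
  obtain N where N: "0 \<le> N" and CP:
    "\<And>\<Omega> a b u D g grad H p q \<beta>' \<beta>\<^sub>n d x. bounded_domain \<Omega> \<Longrightarrow> elliptic \<nu> \<Omega> a \<Longrightarrow>
      b \<in> borel_measurable lebesgue \<Longrightarrow> strong_solution Xn \<Omega> a b u \<Longrightarrow> continuous_on (closure \<Omega>) u \<Longrightarrow>
      open D \<Longrightarrow> D \<subseteq> \<Omega> \<Longrightarrow>
      Xn D (\<lambda>x. norm (fst (b x))) \<le> ennreal \<beta>' \<Longrightarrow> Xn D (\<lambda>x. snd (b x)) \<le> ennreal \<beta>\<^sub>n \<Longrightarrow>
      0 \<le> \<beta>' \<Longrightarrow> 0 \<le> \<beta>\<^sub>n \<Longrightarrow> \<beta>' + \<beta>\<^sub>n \<le> 1 \<Longrightarrow>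
      (\<And>x y. x \<in> D \<Longrightarrow> y \<in> D \<Longrightarrow> dist x y \<le> d) \<Longrightarrow>
      (\<And>x. (g has_derivative (\<lambda>h. grad x \<bullet> h)) (at x)) \<Longrightarrow>
      (\<And>x. (grad has_derivative H x) (at x)) \<Longrightarrow>
      (\<And>i. i \<in> Basis \<Longrightarrow> continuous_on UNIV (\<lambda>x. H x i)) \<Longrightarrow>
      (\<And>x. x \<in> D \<Longrightarrow> 0 \<le> (\<Sum>i\<in>Basis. \<Sum>j\<in>Basis. a x i j * (H x i \<bullet> j))) \<Longrightarrow>
      (\<And>x. x \<in> D \<Longrightarrow> norm (fst (grad x)) \<le> p) \<Longrightarrow> (\<And>x. x \<in> D \<Longrightarrow> \<bar>snd (grad x)\<bar> \<le> q) \<Longrightarrow>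
      0 \<le> p \<Longrightarrow> 0 \<le> q \<Longrightarrow>
      (\<And>x. x \<in> frontier D \<Longrightarrow> u x + g x \<le> 0) \<Longrightarrow> x \<in> D \<Longrightarrow>
      u x + g x \<le> N * d * (p * \<beta>' + q * \<beta>\<^sub>n)"
    by (rule comparison_principle[OF X Alek \<nu>]) blast
  define A where "A = 2 * real DIM('a \<times> real) / \<nu>\<^sup>2"
  define K2 where "K2 = real DIM('a \<times> real) / \<nu>\<^sup>2"
  define K where "K = K2 + 2"
  define th where "th = (exp (- (9 / 16 * A)) - exp (- A)) / 2"
  have A: "0 < A" and K2: "0 \<le> K2" and K: "2 \<le> K"
    using \<nu> by (auto simp: A_def K2_def K_def)
  have th: "0 < th" using A by (simp add: th_def)
  define c1 c2 c3 where "c1 = 4 * N * A + 2 * N" and "c2 = 128 * K * (4 * N * A + 2 * N) + 24 * K * N"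
    and "c3 = 3 * N * (K + 2 * K2 + 2)"
  define d1 d2 where "d1 = th ^ 514" and "d2 = 32 * th ^ 513 * (A * exp (- A))"
  have c: "0 \<le> c1" "0 \<le> c2" "0 \<le> c3" using N A K K2 by (auto simp: c1_def c2_def c3_def)
  have d: "0 < d1" "0 < d2" using th A by (auto simp: d1_def d2_def)
  \<comment> \<open>Besides the three requirements of \<open>small_corner\<close>, the bound by 1
    keeps the total drift at most 1, as the uniform maximum principle demands.\<close>
  define \<epsilon> where "\<epsilon> = min 1 (min (d1 / (c1 + 1)) (min (d2 / (c2 + 1)) ((1 / 16) / (c3 + 1))))"
  have "0 < d1 / (c1 + 1)" "0 < d2 / (c2 + 1)" "0 < (1 / 16) / (c3 + 1)"
    using c d by (intro divide_pos_pos; linarith)+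
  then have \<epsilon>: "0 < \<epsilon>" "\<epsilon> \<le> 1" "\<epsilon> \<le> d1 / (c1 + 1)" "\<epsilon> \<le> d2 / (c2 + 1)" "\<epsilon> \<le> (1 / 16) / (c3 + 1)"
    by (auto simp: \<epsilon>_def)
  have \<epsilon>c: "\<epsilon> * c1 \<le> d1" "\<epsilon> * c2 \<le> d2" "\<epsilon> * c3 \<le> 1 / 16"
    by (fact mult_le_of_le_divide_Suc[OF c(1) \<epsilon>(1,3)] mult_le_of_le_divide_Suc[OF c(2) \<epsilon>(1,4)]
        mult_le_of_le_divide_Suc[OF c(3) \<epsilon>(1,5)])+
  define \<kappa> where "\<kappa> = min (4 * th ^ 513) d2"
  show ?thesis
  proof (rule that[of \<kappa> \<epsilon> "1 / (128 * A)"])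
    show "0 < \<kappa>" "0 < \<epsilon>" "0 < 1 / (128 * A)"
      using th d \<epsilon> A by (auto simp: \<kappa>_def)
    fix \<Omega> :: "('a \<times> real) set" and a and b :: "'a \<times> real \<Rightarrow> 'a \<times> real" and u and M r :: real and \<beta> J and \<delta> :: real and y\<^sub>0 x
    define V where "V = \<Omega> \<inter> Pcyl (2 * r) (2 * r) 0"
    assume bd: "bounded_domain \<Omega>" and r: "0 < r" and ell: "elliptic \<nu> \<Omega> a"
      and b[measurable]: "b \<in> borel_measurable lebesgue"
      and sol: "strong_solution Xn \<Omega> a b u" and cu: "continuous_on (closure \<Omega>) u" and M: "0 \<le> M"
    have VO: "V \<subseteq> \<Omega>" by (auto simp: V_def)
    have oP: "open (Pcyl s s c)" for s and c :: 'a
      unfolding Pcyl_def by (intro open_Collect_conj open_Collect_less continuous_intros)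
    have [measurable]: "\<Omega> \<in> sets lebesgue" using bd by (rule bounded_domain_sets)
    have [measurable]: "fst \<in> borel_measurable (borel :: ('a \<times> real) measure)" "snd \<in> borel_measurable (borel :: ('a \<times> real) measure)"
      by (auto intro!: borel_measurable_continuous_onI continuous_intros)
    assume "\<And>x. x \<in> \<Omega> \<inter> Pcyl (2 * r) (2 * r) 0 \<Longrightarrow> u x \<le> M * snd x"
      and "\<And>x. x \<in> closure (\<Omega> \<inter> Pcyl (2 * r) (2 * r) 0) \<Longrightarrow> x \<notin> \<Omega> \<inter> Pcyl (2 * r) (2 * r) 0 \<Longrightarrow>
        norm (fst x) < 2 * r \<Longrightarrow> snd x < 2 * r \<Longrightarrow> u x = 0"
    note u = this[folded V_def]
    assume mod: "X_modulus Xn \<Omega> (\<lambda>x. norm (fst (b x))) (6 * r) \<le> ennreal (\<epsilon> / 2)"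
      and bn: "\<And>\<rho> c. 0 < \<rho> \<Longrightarrow> \<rho> \<le> 2 * r \<Longrightarrow> norm c \<le> 2 * r \<Longrightarrow> Xn (Pcyl \<rho> \<rho> c \<inter> \<Omega>) (\<lambda>x. snd (b x)) \<le> ennreal (\<beta> \<rho>)"
      and \<beta>: "\<And>\<rho>. 0 < \<rho> \<Longrightarrow> \<rho> \<le> 2 * r \<Longrightarrow> 0 \<le> \<beta> \<rho> \<and> \<beta> \<rho> \<le> \<epsilon> / 2" "\<beta> (2 * r) \<le> \<epsilon> * \<delta>"
      and J: "\<And>t. 0 < t \<Longrightarrow> t \<le> r \<Longrightarrow> J (t / 4) + \<beta> t \<le> J t" "\<And>t. 0 < t \<Longrightarrow> t \<le> r \<Longrightarrow> 0 \<le> J t"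
        "J (r / 64) \<le> \<epsilon> * \<delta>"
      and \<delta>: "0 \<le> \<delta>" "\<delta> \<le> 1 / (128 * A)" and y\<^sub>0: "norm y\<^sub>0 \<le> 5 / 4 * r"
      and "\<And>x. x \<in> closure (\<Omega> \<inter> Pcyl (2 * r) (2 * r) 0) \<Longrightarrow> norm (fst x - y\<^sub>0) < r / 4 \<Longrightarrow> \<delta> * r \<le> snd x"
    note y\<^sub>0' = this(11)[folded V_def]
    assume x: "x \<in> \<Omega>" "x \<in> Pcyl (r / 4) (r / 4) 0"
    interpret small_corner V a u \<nu> N M r "\<epsilon> / 2" \<beta> A K2 K \<delta> \<epsilon> th J y\<^sub>0
    proof (unfold_locales, goal_cases)
      case (14 D c \<rho> g grad H p q d x)
      \<comment> \<open>Horizontal distances in \<open>V\<close> are below \<open>4 r\<close> and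
        vertical ones below \<open>2 r\<close>, hence the modulus of \<open>b'\<close> at
        \<open>6 r\<close>.\<close>
      have dist6: "dist x y < 6 * r" if "y \<in> V" "x \<in> V" for x y
      proof -
        have "norm (fst x - fst y) < 4 * r"
          using that norm_triangle_ineq4[of "fst x" "fst y"] by (auto simp: V_def Pcyl_def)
        moreover have "\<bar>snd x - snd y\<bar> < 2 * r"
          using that by (auto simp: V_def Pcyl_def)
        ultimately show ?thesis
          using norm_Pair_le[of "fst x - fst y" "snd x - snd y"] by (simp add: dist_norm minus_prod_def)
      qed
      have [measurable]: "D \<in> sets lebesgue" "Pcyl \<rho> \<rho> c \<in> sets lebesgue" using 14(1) oP by auto
      have xV: "x \<in> V" using 14 by blast
      have "Xn D (\<lambda>x. norm (fst (b x))) \<le> Xn (ball x (6 * r) \<inter> \<Omega>) (\<lambda>x. norm (fst (b x)))"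
        using 14(2) dist6[OF _ xV] VO by (intro X_space_mono[OF X bd]) auto
      also have "\<dots> \<le> X_modulus Xn \<Omega> (\<lambda>x. norm (fst (b x))) (6 * r)"
        unfolding X_modulus_def using xV VO by (intro SUP_upper) auto
      also note mod
      finally have 1: "Xn D (\<lambda>x. norm (fst (b x))) \<le> ennreal (\<epsilon> / 2)" .
      have "Xn D (\<lambda>x. snd (b x)) \<le> Xn (Pcyl \<rho> \<rho> c \<inter> \<Omega>) (\<lambda>x. snd (b x))"
        using 14(2,3) VO by (intro X_space_mono[OF X bd]) auto
      also have "\<dots> \<le> ennreal (\<beta> \<rho>)" using 14 by (intro bn) auto
      finally have 2: "Xn D (\<lambda>x. snd (b x)) \<le> ennreal (\<beta> \<rho>)" .
      have 3: "0 \<le> \<epsilon> / 2" "0 \<le> \<beta> \<rho>" "\<epsilon> / 2 + \<beta> \<rho> \<le> 1" using \<epsilon> \<beta>(1)[of \<rho>] 14 by auto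
      have D\<Omega>: "D \<subseteq> \<Omega>" using 14 VO by blast
      show ?case
        by (rule CP[OF bd ell b sol cu 14(1) D\<Omega> 1 2 3 14(7-17)])
    next
      case 1 show ?case by (rule A_def)
    next
      case 2 show ?case by (rule K2_def)
    next
      case 3 show ?case by (rule K_def)
    next
      case 4 show ?case using bd oP by (auto simp: V_def bounded_domain_def)
    next
      case 10 show ?case by (rule elliptic_mono[OF ell VO])
    next
      case (13 \<rho>) then show ?case using \<beta>(1)[of \<rho>] \<epsilon> by linarith
    next
      case 15 show ?case by (rule continuous_on_subset[OF cu closure_mono[OF VO]])
    next
      case 18 show ?case by (rule th_def)
    next
      case 20 show ?case using \<delta> A by (simp add: field_simps)
    next
      case (21 \<rho>) then show ?case using \<beta>(1)[of \<rho>] by linarith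
    next
      case 26 show ?case using \<epsilon>c(1) by (simp add: c1_def d1_def)
    next
      case 27 show ?case using \<epsilon>c(2) by (simp add: c2_def d2_def)
    next
      case 28 show ?case using \<epsilon>c(3) by (simp add: c3_def mult.commute)
    next
      case (30 x) then show ?case by (rule y\<^sub>0')
    qed (use V_def r M \<nu> N \<epsilon> u \<delta> \<beta> J y\<^sub>0 in auto)
    show "\<kappa> * \<delta> * M * snd x \<le> M * snd x - u x"
    proof -
      have "x \<in> V" using x r by (auto simp: V_def Pcyl_def)
      then show ?thesis
        using lower_bound[of x] x by (simp add: Pcyl_def \<kappa>_def d2_def ac_simps)
    qed
  qed
qed


section \<open>The convex boundary profile\<close>

lemma convex_strict_sublevel:
  assumes "convex_on S f"
  shows "convex {x \<in> S. f x < (c :: real)}"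
proof (rule convexI)
  fix x y and s t :: real
  assume xy: "x \<in> {x \<in> S. f x < c}" "y \<in> {x \<in> S. f x < c}" and st: "0 \<le> s" "0 \<le> t" "s + t = 1"
  have "f (s *\<^sub>R x + t *\<^sub>R y) \<le> s * f x + t * f y"
    using assms xy st unfolding convex_on_def by blast
  also have "\<dots> < c"
    using xy st by (intro convex_bound_lt) auto
  finally show "s *\<^sub>R x + t *\<^sub>R y \<in> {x \<in> S. f x < c}"
    using xy st convex_on_imp_convex[OF assms] by (auto simp: convex_def)
qed

text \<open>The ratio \<open>F x / norm x\<close> is maximal at a point \<open>x\<^sub>0\<close> of the sphere of radius \<open>r\<close>. Separating
  \<open>x\<^sub>0\<close> from the convex set where \<open>F < F x\<^sub>0\<close> shows that \<open>F\<close> is at least \<open>F x\<^sub>0\<close> on a half ball, hence on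
  a ball of radius comparable to \<open>r\<close>.\<close>

lemma convex_profile:
  fixes F :: "'a::euclidean_space \<Rightarrow> real"
  assumes conv: "convex_on (ball 0 R) F" and F0: "F 0 = 0" and nonneg: "\<And>x. x \<in> ball 0 R \<Longrightarrow> 0 \<le> F x"
    and r: "0 < r" "r < R" and \<delta>: "\<delta> = (SUP x\<in>{x. 0 < norm x \<and> norm x \<le> r}. F x / norm x)"
  obtains x\<^sub>0 y\<^sub>0 where "0 \<le> \<delta>" "norm x\<^sub>0 = r" "F x\<^sub>0 = \<delta> * r" "norm y\<^sub>0 \<le> 5 / 4 * r"
    "\<And>x. x \<in> ball 0 R \<Longrightarrow> norm (x - y\<^sub>0) < r / 4 \<Longrightarrow> \<delta> * r \<le> F x"
proof -
  have cF: "continuous_on (ball 0 R) F"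
    using conv by (intro convex_on_continuous) auto
  have "\<exists>x\<in>sphere 0 r. \<forall>y\<in>sphere 0 r. F y \<le> F x"
  proof (rule continuous_attains_sup)
    show "sphere (0 :: 'a) r \<noteq> {}" using r by simp
    show "continuous_on (sphere 0 r) F"
      by (rule continuous_on_subset[OF cF]) (use r in auto)
  qed simp
  then obtain x\<^sub>0 where x\<^sub>0: "norm x\<^sub>0 = r" and max: "\<And>y. norm y = r \<Longrightarrow> F y \<le> F x\<^sub>0"
    by auto
  have x\<^sub>0R: "x\<^sub>0 \<in> ball 0 R" using x\<^sub>0 r by simp
  have "\<delta> = F x\<^sub>0 / norm x\<^sub>0"
    unfolding \<delta>
  proof (rule cSup_eq_maximum)
    show "F x\<^sub>0 / norm x\<^sub>0 \<in> (\<lambda>x. F x / norm x) ` {x. 0 < norm x \<and> norm x \<le> r}"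
      using x\<^sub>0 r by auto
    fix z assume "z \<in> (\<lambda>x. F x / norm x) ` {x. 0 < norm x \<and> norm x \<le> r}"
    then obtain x where x: "z = F x / norm x" "0 < norm x" "norm x \<le> r" by auto
    \<comment> \<open>Since \<open>F 0 = 0\<close>, convexity makes the quotient nondecreasing along
      rays, so the supremum over the ball is attained on the sphere.\<close>
    define y where "y = (r / norm x) *\<^sub>R x"
    have y: "norm y = r" using x r by (simp add: y_def)
    have "x = (1 - norm x / r) *\<^sub>R 0 + (norm x / r) *\<^sub>R y"
      using x r by (simp add: y_def)
    then have "F x \<le> (1 - norm x / r) * F 0 + (norm x / r) * F y"
      using convex_onD[OF conv, of "norm x / r" 0 y] x y r by (simp add: field_simps)
    also have "\<dots> \<le> (norm x / r) * F x\<^sub>0"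
      using max[OF y] F0 r by (simp add: mult_left_mono divide_right_mono)
    finally show "z \<le> F x\<^sub>0 / norm x\<^sub>0"
      by (simp add: x(1) x\<^sub>0 pos_divide_le_eq[OF x(2)] mult.commute)
  qed
  then have Fx: "F x\<^sub>0 = \<delta> * r" using x\<^sub>0 r by simp
  have \<delta>0: "0 \<le> \<delta>"
    using nonneg[OF x\<^sub>0R] Fx r by (simp add: zero_le_mult_iff)
  define S where "S = {x \<in> ball 0 R. F x < \<delta> * r}"
  show ?thesis
  proof (cases "S = {}")
    case True
    have "\<delta> * r \<le> F x" if "x \<in> ball 0 R" for x
      using True that not_less unfolding S_def by blast
    then show ?thesis
      using \<delta>0 x\<^sub>0 Fx r by (intro that[of x\<^sub>0 x\<^sub>0]) auto
  next
    case False
    have "S \<inter> {x\<^sub>0} = {}" using Fx by (auto simp: S_def)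
    moreover have "convex S" unfolding S_def by (rule convex_strict_sublevel[OF conv])
    ultimately obtain p c where p: "p \<noteq> 0" "\<forall>x\<in>S. p \<bullet> x \<le> c" "\<forall>x\<in>{x\<^sub>0}. c \<le> p \<bullet> x"
      using separating_hyperplane_sets[of S "{x\<^sub>0}"] False by auto
    \<comment> \<open>Moving from \<open>x\<^sub>0\<close> by \<open>r/4\<close> to the side away
      from \<open>S\<close> puts the open ball of radius \<open>r/4\<close> strictly beyond the
      hyperplane through \<open>x\<^sub>0\<close>.\<close>
    define y\<^sub>0 where "y\<^sub>0 = x\<^sub>0 + (r / 4 / norm p) *\<^sub>R p"
    show ?thesis
    proof (rule that[of x\<^sub>0 y\<^sub>0])
      have "norm y\<^sub>0 \<le> norm x\<^sub>0 + norm ((r / 4 / norm p) *\<^sub>R p)"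
        unfolding y\<^sub>0_def by (rule norm_triangle_ineq)
      then show "norm y\<^sub>0 \<le> 5 / 4 * r" using p r x\<^sub>0 by simp
      fix x assume x: "x \<in> ball 0 R" "norm (x - y\<^sub>0) < r / 4"
      have "\<bar>p \<bullet> (x - y\<^sub>0)\<bar> \<le> norm p * norm (x - y\<^sub>0)"
        by (rule Cauchy_Schwarz_ineq2)
      also have "\<dots> < norm p * (r / 4)"
        using x p by (intro mult_strict_left_mono) auto
      finally have "- (norm p * (r / 4)) < p \<bullet> (x - y\<^sub>0)" by linarith
      moreover have "p \<bullet> y\<^sub>0 = p \<bullet> x\<^sub>0 + norm p * (r / 4)"
        using p by (simp add: y\<^sub>0_def inner_add_right dot_square_norm power2_eq_square)
      ultimately have "p \<bullet> x\<^sub>0 < p \<bullet> x" by (simp add: inner_diff_right)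
      then have "x \<notin> S" using p by force
      then show "\<delta> * r \<le> F x" using x by (auto simp: S_def)
    qed (use \<delta>0 x\<^sub>0 Fx in auto)
  qed
qed

section \<open>Dini functions\<close>

lemma class_D1_scale:
  assumes "class_D1 \<sigma>" "0 < t" "t \<le> s" "s \<le> 1"
  shows "\<sigma> s \<le> (s / t) * \<sigma> t"
proof -
  have "\<sigma> s / s \<le> \<sigma> t / t"
    using assms unfolding class_D1_def by blast
  then show ?thesis using assms by (simp add: field_simps)
qed

text \<open>The integrand is decreasing, so on \<open>(t/4, t]\<close>, of length
  \<open>3/4 t\<close>, it is at least \<open>\<sigma> t / t\<close>. In this one-step form the sum
  of \<sigma> over the scales telescopes.\<close>

lemma J_sigma_step:
  assumes D: "class_D1 \<sigma>" and t: "0 < t" "t \<le> 1"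
  shows "J_sigma \<sigma> (t / 4) + 3 / 4 * \<sigma> t \<le> J_sigma \<sigma> t" and "0 \<le> J_sigma \<sigma> t"
proof -
  have int: "set_integrable lborel A (\<lambda>t. \<sigma> t / t)" if "A \<subseteq> {0<..1}" "A \<in> sets borel" for A
    using D that unfolding class_D1_def by (auto intro: set_integrable_subset)
  have pos: "0 \<le> \<sigma> s / s" if "0 < s" "s \<le> 1" for s
    using D that by (auto simp: class_D1_def)
  have nn: "0 \<le> J_sigma \<sigma> s" if "s \<le> 1" for s
    unfolding J_sigma_def set_lebesgue_integral_def
    using that pos by (intro integral_nonneg_AE AE_I2) (auto simp: indicator_def)
  show "0 \<le> J_sigma \<sigma> t" using nn t by simp
  have split: "J_sigma \<sigma> t = (LINT s:{0<..t/4} \<union> {t/4<..t}|lborel. \<sigma> s / s)"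
    unfolding J_sigma_def using t by (intro arg_cong2[where f = "\<lambda>A. set_lebesgue_integral lborel A"] refl) auto
  have union: "\<dots> = J_sigma \<sigma> (t / 4) + (LINT s:{t/4<..t}|lborel. \<sigma> s / s)"
    unfolding J_sigma_def using t by (intro set_integral_Un int) auto
  have "(LINT s:{t/4<..t}|lborel. \<sigma> t / t) \<le> (LINT s:{t/4<..t}|lborel. \<sigma> s / s)"
  proof (rule set_integral_mono)
    show "set_integrable lborel {t/4<..t} (\<lambda>s. \<sigma> s / s)" using t by (intro int) auto
    show "set_integrable lborel {t/4<..t} (\<lambda>s. \<sigma> t / t)"
      unfolding set_integrable_def using t by (intro integrable_scaleR_left integrable_real_indicator) auto
    show "\<sigma> t / t \<le> \<sigma> s / s" if "s \<in> {t/4<..t}" for s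
      using D that t unfolding class_D1_def by auto
  qed
  moreover have "(LINT s:{t/4<..t}|lborel. \<sigma> t / t) = 3 / 4 * \<sigma> t"
    using t by (simp add: set_lebesgue_integral_def field_simps)
  ultimately show "J_sigma \<sigma> (t / 4) + 3 / 4 * \<sigma> t \<le> J_sigma \<sigma> t"
    using split union by linarith
qed

text \<open>From \<open>\<sigma> 1 = 1\<close> and the monotonicity of \<open>\<sigma> t / t\<close>
  one gets \<open>\<sigma> t \<ge> t\<close>. Strict positivity of the integral later forces the
  profile \<delta> to be positive.\<close>

lemma J_sigma_pos:
  assumes D: "class_D1 \<sigma>" and t: "0 < t" "t \<le> 1"
  shows "0 < J_sigma \<sigma> t" and "\<sigma> t \<le> 4 / 3 * J_sigma \<sigma> t" and "J_sigma \<sigma> (t / 4) \<le> J_sigma \<sigma> t"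
proof -
  have "1 \<le> (1 / t) * \<sigma> t"
    using class_D1_scale[OF D t(1), of 1] D t by (simp add: class_D1_def)
  then have s: "t \<le> \<sigma> t" using t by (simp add: field_simps)
  have n: "0 \<le> J_sigma \<sigma> (t / 4)" using J_sigma_step(2)[OF D, of "t / 4"] t by simp
  show "0 < J_sigma \<sigma> t" "\<sigma> t \<le> 4 / 3 * J_sigma \<sigma> t" "J_sigma \<sigma> (t / 4) \<le> J_sigma \<sigma> t"
    using J_sigma_step(1)[OF D t] s n t by linarith+
qed

section \<open>Choice of the radius and reduction to one-sided bounds\<close>

theorem theorem4p1:
  fixes Xn :: "('a::euclidean_space \<times> real) set \<Rightarrow> (('a \<times> real) \<Rightarrow> real) \<Rightarrow> ennreal"
  assumes X: "X_space Xn" and Alek: "Aleksandrov Xn"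
  shows "\<forall>\<nu>>0. \<exists>\<kappa>. 0 < \<kappa> \<and> \<kappa> < 1 \<and>
    (\<forall>R\<^sub>0 \<B> (\<sigma>::real \<Rightarrow> real) (\<delta>::real \<Rightarrow> real) (\<mu>::real \<Rightarrow> ennreal).
      \<exists>R0'>0. \<forall>(\<Omega>::('a \<times> real) set) (F::'a \<Rightarrow> real) a (b::'a \<times> real \<Rightarrow> 'a \<times> real) u.
        (
          bounded_domain \<Omega> \<and> 0 \<in> frontier \<Omega> \<and> 0 < R\<^sub>0 \<and> R\<^sub>0 \<le> 1 \<and>
          \<Omega> \<inter> Pcyl R\<^sub>0 R\<^sub>0 0 = {x. norm (fst x) < R\<^sub>0 \<and> F (fst x) < snd x \<and> snd x < R\<^sub>0} \<and>
          convex_on (ball 0 R\<^sub>0) F \<and> (\<forall>x'\<in>ball 0 R\<^sub>0. 0 \<le> F x') \<and> F 0 = 0 \<and>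
          (\<forall>r. 0 < r \<and> r < R\<^sub>0 \<longrightarrow>
             \<delta> r = (SUP x'\<in>{x'. 0 < norm x' \<and> norm x' \<le> r}. F x' / norm x')) \<and>
          (\<delta> \<longlongrightarrow> 0) (at_right 0) \<and>
          elliptic \<nu> \<Omega> a \<and> b \<in> borel_measurable lebesgue \<and> X_mem Xn \<Omega> (\<lambda>x. norm (b x)) \<and>
          (\<forall>\<rho>>0. X_modulus Xn \<Omega> (\<lambda>x. norm (fst (b x))) \<rho> = \<mu> \<rho>) \<and>
          0 < \<B> \<and> class_D1 \<sigma> \<and> J_sigma \<sigma> \<in> o[at_right 0](\<delta>) \<and>
          (\<forall>\<rho>. 0 < \<rho> \<and> \<rho> \<le> R\<^sub>0 / 2 \<longrightarrow>
             (SUP x\<in>Pcyl (R\<^sub>0/2) (R\<^sub>0/2) 0. Xn (Pcyl \<rho> \<rho> (fst x) \<inter> \<Omega>) (\<lambda>y. snd (b y)))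
               \<le> ennreal (\<B> * \<sigma> (\<rho> / R\<^sub>0))) \<and>
          continuous_on (closure \<Omega>) u \<and>
          (\<exists>Du D2u. W2Xloc Xn \<Omega> u Du D2u \<and>
             (AE x in lebesgue. x \<in> \<Omega> \<longrightarrow> Lop a b Du D2u x = 0)) \<and>
          (\<forall>x\<in>frontier \<Omega> \<inter> closure (Pcyl R\<^sub>0 R\<^sub>0 0). u x = 0))
        \<longrightarrow> (\<forall>r. 0 < r \<and> r < R0' / 2 \<longrightarrow>
              osc (\<Omega> \<inter> Pcyl (r/4) (r/4) 0) (\<lambda>x. u x / snd x)
                \<le> ereal (1 - \<kappa> * \<delta> r) * osc (\<Omega> \<inter> Pcyl (2*r) (2*r) 0) (\<lambda>x. u x / snd x)))"
proof (intro allI impI, goal_cases)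
  case (1 \<nu>)
  then have \<nu>: "0 < \<nu>" .
  obtain \<kappa>\<^sub>1 \<epsilon> \<delta>\<^sub>0 :: real where \<kappa>\<^sub>1: "0 < \<kappa>\<^sub>1" and \<epsilon>: "0 < \<epsilon>" and \<delta>\<^sub>0: "0 < \<delta>\<^sub>0" and improve:
    "\<And>\<Omega> a b u M r \<beta> J \<delta> y\<^sub>0 x. bounded_domain \<Omega> \<Longrightarrow> 0 < r \<Longrightarrow> elliptic \<nu> \<Omega> a \<Longrightarrow>
      b \<in> borel_measurable lebesgue \<Longrightarrow> strong_solution Xn \<Omega> a b u \<Longrightarrow> continuous_on (closure \<Omega>) u \<Longrightarrow> 0 \<le> M \<Longrightarrow>
      (\<And>x. x \<in> \<Omega> \<inter> Pcyl (2 * r) (2 * r) 0 \<Longrightarrow> u x \<le> M * snd x) \<Longrightarrow>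
      (\<And>x. x \<in> closure (\<Omega> \<inter> Pcyl (2 * r) (2 * r) 0) \<Longrightarrow> x \<notin> \<Omega> \<inter> Pcyl (2 * r) (2 * r) 0 \<Longrightarrow>
        norm (fst x) < 2 * r \<Longrightarrow> snd x < 2 * r \<Longrightarrow> u x = 0) \<Longrightarrow>
      X_modulus Xn \<Omega> (\<lambda>x. norm (fst (b x))) (6 * r) \<le> ennreal (\<epsilon> / 2) \<Longrightarrow>
      (\<And>\<rho> c. 0 < \<rho> \<Longrightarrow> \<rho> \<le> 2 * r \<Longrightarrow> norm c \<le> 2 * r \<Longrightarrow> Xn (Pcyl \<rho> \<rho> c \<inter> \<Omega>) (\<lambda>x. snd (b x)) \<le> ennreal (\<beta> \<rho>)) \<Longrightarrow>
      (\<And>\<rho>. 0 < \<rho> \<Longrightarrow> \<rho> \<le> 2 * r \<Longrightarrow> 0 \<le> \<beta> \<rho> \<and> \<beta> \<rho> \<le> \<epsilon> / 2) \<Longrightarrow> \<beta> (2 * r) \<le> \<epsilon> * \<delta> \<Longrightarrow>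
      (\<And>t. 0 < t \<Longrightarrow> t \<le> r \<Longrightarrow> J (t / 4) + \<beta> t \<le> J t) \<Longrightarrow> (\<And>t. 0 < t \<Longrightarrow> t \<le> r \<Longrightarrow> 0 \<le> J t) \<Longrightarrow>
      J (r / 64) \<le> \<epsilon> * \<delta> \<Longrightarrow> 0 \<le> \<delta> \<Longrightarrow> \<delta> \<le> \<delta>\<^sub>0 \<Longrightarrow> norm y\<^sub>0 \<le> 5 / 4 * r \<Longrightarrow>
      (\<And>x. x \<in> closure (\<Omega> \<inter> Pcyl (2 * r) (2 * r) 0) \<Longrightarrow> norm (fst x - y\<^sub>0) < r / 4 \<Longrightarrow> \<delta> * r \<le> snd x) \<Longrightarrow>
      x \<in> \<Omega> \<Longrightarrow> x \<in> Pcyl (r / 4) (r / 4) 0 \<Longrightarrow> \<kappa>\<^sub>1 * \<delta> * M * snd x \<le> M * snd x - u x"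
    by (rule one_sided_improvement[OF X Alek \<nu>]) blast
  \<comment> \<open>The larger of \<open>M\<close> and \<open>- m\<close> is at least half of
    \<open>M - m\<close>, which costs a factor 2 of \<open>\<kappa>\<^sub>1\<close>; the second
    entry keeps \<open>\<kappa> < 1\<close>.\<close>
  define \<kappa> where "\<kappa> = min (\<kappa>\<^sub>1 / 2) (1 / 2)"
  have \<kappa>: "0 < \<kappa>" "\<kappa> < 1" "2 * \<kappa> \<le> \<kappa>\<^sub>1" using \<kappa>\<^sub>1 by (auto simp: \<kappa>_def)
  show ?case
  proof (rule exI[of _ \<kappa>], intro conjI allI, goal_cases)
    case 1
    show ?case by (rule \<kappa>)
  next
    case 2
    show ?case by (rule \<kappa>)
  next
    case (3 R\<^sub>0 \<B> \<sigma> \<delta> \<mu>)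
    \<comment> \<open>The radius is needed before \<open>\<Omega>\<close>, \<open>F\<close>,
      \<open>a\<close>, \<open>b\<close> and \<open>u\<close> are introduced, so only earlier data
      occur here. Existence of a good radius is derived later from any admissible configuration,
      whose profile and modulus are then \<delta> and \<mu>.\<close>
    define Good where "Good R \<longleftrightarrow> 0 < R \<and> (\<forall>r. 0 < r \<and> r < R / 2 \<longrightarrow> 8 * r < R\<^sub>0 \<and>
      8 / 3 * (\<B> / R\<^sub>0) * J_sigma \<sigma> r \<le> \<epsilon> / 2 * \<delta> r \<and> \<delta> r \<le> min 1 \<delta>\<^sub>0 \<and> \<mu> (6 * r) \<le> ennreal (\<epsilon> / 2))" for R
    obtain R where R: "0 < R" "(\<exists>R. Good R) \<longrightarrow> Good R"
    proof (cases "\<exists>R. Good R")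
      case True
      then obtain R where "Good R" by blast
      then show ?thesis by (intro that[of R]) (auto simp: Good_def)
    next
      case False
      \<comment> \<open>An arbitrary positive default: without a good radius there is no admissible
        configuration to treat.\<close>
      then show ?thesis by (intro that[of 1]) auto
    qed
    show ?case
    proof (rule exI[of _ R], intro conjI allI impI, goal_cases)
      case 1
      show ?case by (rule R)
    next
      case (2 \<Omega> F a b u r)
      from 2 have bd: "bounded_domain \<Omega>" and R0: "0 < R\<^sub>0" "R\<^sub>0 \<le> 1"
        and \<Omega>: "\<Omega> \<inter> Pcyl R\<^sub>0 R\<^sub>0 0 = {x. norm (fst x) < R\<^sub>0 \<and> F (fst x) < snd x \<and> snd x < R\<^sub>0}"
        and F: "convex_on (ball 0 R\<^sub>0) F" "\<And>x'. x' \<in> ball 0 R\<^sub>0 \<Longrightarrow> 0 \<le> F x'" "F 0 = 0"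
        and \<delta>: "\<And>r. 0 < r \<Longrightarrow> r < R\<^sub>0 \<Longrightarrow> \<delta> r = (SUP x'\<in>{x'. 0 < norm x' \<and> norm x' \<le> r}. F x' / norm x')"
        and \<delta>lim: "(\<delta> \<longlongrightarrow> 0) (at_right 0)"
        and ell: "elliptic \<nu> \<Omega> a" and b[measurable]: "b \<in> borel_measurable lebesgue"
        and bX: "X_mem Xn \<Omega> (\<lambda>x. norm (b x))"
        and \<mu>: "\<And>\<rho>. 0 < \<rho> \<Longrightarrow> X_modulus Xn \<Omega> (\<lambda>x. norm (fst (b x))) \<rho> = \<mu> \<rho>"
        and B: "0 < \<B>" and \<sigma>: "class_D1 \<sigma>" and o: "J_sigma \<sigma> \<in> o[at_right 0](\<delta>)"
        and bn: "\<And>\<rho>. 0 < \<rho> \<Longrightarrow> \<rho> \<le> R\<^sub>0 / 2 \<Longrightarrow>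
             (SUP x\<in>Pcyl (R\<^sub>0/2) (R\<^sub>0/2) 0. Xn (Pcyl \<rho> \<rho> (fst x) \<inter> \<Omega>) (\<lambda>y. snd (b y)))
               \<le> ennreal (\<B> * \<sigma> (\<rho> / R\<^sub>0))"
        and cu: "continuous_on (closure \<Omega>) u"
        and eq: "\<exists>Du D2u. W2Xloc Xn \<Omega> u Du D2u \<and>
             (AE x in lebesgue. x \<in> \<Omega> \<longrightarrow> Lop a b Du D2u x = 0)"
        and bc: "\<And>x. x \<in> frontier \<Omega> \<Longrightarrow> x \<in> closure (Pcyl R\<^sub>0 R\<^sub>0 0) \<Longrightarrow> u x = 0"
        and r: "0 < r" "r < R / 2"
        by blast+
      have [measurable]: "\<Omega> \<in> sets lebesgue" using bd by (rule bounded_domain_sets)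
      have [measurable]: "fst \<in> borel_measurable (borel :: ('a \<times> real) measure)"
        by (auto intro!: borel_measurable_continuous_onI continuous_intros)
      have sol: "strong_solution Xn \<Omega> a b u"
        using eq bd strong_solutionI[OF X] by (auto simp: bounded_domain_def)
      have "\<exists>R. Good R"
      proof -
        have fin: "Xn \<Omega> (\<lambda>x. norm (fst (b x))) < \<infinity>"
        proof -
          have "Xn \<Omega> (\<lambda>x. norm (fst (b x))) \<le> Xn \<Omega> (\<lambda>x. norm (b x))"
            using norm_fst_le[of "fst (b y)" "snd (b y)" for y] by (intro X_space_mono[OF X bd]) auto
          then show ?thesis using bX by (auto simp: X_mem_def intro: le_less_trans)
        qed
        obtain \<rho> where \<rho>: "0 < \<rho>" "X_modulus Xn \<Omega> (\<lambda>x. norm (fst (b x))) \<rho> \<le> ennreal (\<epsilon> / 2)"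
          using X_modulus_small[OF X bd _ fin, of "ennreal (\<epsilon> / 2)"] \<epsilon> by auto
        have 1: "eventually (\<lambda>r::real. 0 < r \<and> r < R\<^sub>0 / 8 \<and> r < \<rho> / 6) (at_right 0)"
          using R0 \<rho> by (auto simp: eventually_at_right_field intro!: exI[of _ "min (R\<^sub>0 / 8) (\<rho> / 6)"])
        have 2: "eventually (\<lambda>r. \<delta> r < min 1 \<delta>\<^sub>0) (at_right 0)"
          using order_tendstoD(2)[OF \<delta>lim, of "min 1 \<delta>\<^sub>0"] \<delta>\<^sub>0 by simp
        define c where "c = (\<epsilon> / 2) / (8 / 3 * (\<B> / R\<^sub>0))"
        have c: "0 < c" using \<epsilon> B R0 by (simp add: c_def)
        have 3: "eventually (\<lambda>r. norm (J_sigma \<sigma> r) \<le> c * norm (\<delta> r)) (at_right 0)"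
          by (rule landau_o.smallD[OF o c])
        have "eventually (\<lambda>r. 8 * r < R\<^sub>0 \<and>
          8 / 3 * (\<B> / R\<^sub>0) * J_sigma \<sigma> r \<le> \<epsilon> / 2 * \<delta> r \<and> \<delta> r \<le> min 1 \<delta>\<^sub>0 \<and> \<mu> (6 * r) \<le> ennreal (\<epsilon> / 2)) (at_right 0)"
          using 1 2 3
        proof eventually_elim
          case (elim r)
          then have r: "0 < r" "r < R\<^sub>0" using R0 by auto
          have "0 \<le> \<delta> r"
            by (rule convex_profile[OF F(1,3,2) r \<delta>[OF r]])
          then have "J_sigma \<sigma> r \<le> c * \<delta> r" using elim by simp
          then have "8 / 3 * (\<B> / R\<^sub>0) * J_sigma \<sigma> r \<le> 8 / 3 * (\<B> / R\<^sub>0) * (c * \<delta> r)"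
            using B R0 by (intro mult_left_mono) auto
          also have "\<dots> = \<epsilon> / 2 * \<delta> r"
            using B R0 by (simp add: c_def)
          moreover have "\<mu> (6 * r) \<le> ennreal (\<epsilon> / 2)"
          proof -
            have "\<mu> (6 * r) = X_modulus Xn \<Omega> (\<lambda>x. norm (fst (b x))) (6 * r)"
              using \<mu>[of "6 * r"] r by simp
            also have "\<dots> \<le> X_modulus Xn \<Omega> (\<lambda>x. norm (fst (b x))) \<rho>"
              using elim by (intro X_modulus_mono[OF X bd]) auto
            finally show ?thesis using \<rho> by simp
          qed
          ultimately show ?case using elim by auto
        qed
        then obtain d where "0 < d" "\<And>r. 0 < r \<Longrightarrow> r < d \<Longrightarrow> 8 * r < R\<^sub>0 \<and>
          8 / 3 * (\<B> / R\<^sub>0) * J_sigma \<sigma> r \<le> \<epsilon> / 2 * \<delta> r \<and> \<delta> r \<le> min 1 \<delta>\<^sub>0 \<and> \<mu> (6 * r) \<le> ennreal (\<epsilon> / 2)"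
          unfolding eventually_at_right_field by auto
        then have "Good (2 * d)" by (simp add: Good_def)
        then show ?thesis by blast
      qed
      then have "Good R" using R by blast
      then have rR: "8 * r < R\<^sub>0" and Jr: "8 / 3 * (\<B> / R\<^sub>0) * J_sigma \<sigma> r \<le> \<epsilon> / 2 * \<delta> r"
        and \<delta>r: "\<delta> r \<le> 1" "\<delta> r \<le> \<delta>\<^sub>0" and \<mu>r: "\<mu> (6 * r) \<le> ennreal (\<epsilon> / 2)"
        using r by (auto simp: Good_def)
      have rR0: "r < R\<^sub>0" "r \<le> 1" using rR r R0 by linarith+
      have "\<exists>x\<^sub>0 y\<^sub>0. norm x\<^sub>0 = r \<and> F x\<^sub>0 = \<delta> r * r \<and> norm y\<^sub>0 \<le> 5 / 4 * r \<and>
          (\<forall>x\<in>ball 0 R\<^sub>0. norm (x - y\<^sub>0) < r / 4 \<longrightarrow> \<delta> r * r \<le> F x)"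
        by (rule convex_profile[OF F(1,3,2) r(1) rR0(1) \<delta>[OF r(1) rR0(1)]]) blast+
      then obtain x\<^sub>0 y\<^sub>0 where x\<^sub>0: "norm x\<^sub>0 = r" "F x\<^sub>0 = \<delta> r * r"
        and y\<^sub>0: "norm y\<^sub>0 \<le> 5 / 4 * r" "\<And>x. x \<in> ball 0 R\<^sub>0 \<Longrightarrow> norm (x - y\<^sub>0) < r / 4 \<Longrightarrow> \<delta> r * r \<le> F x"
        by blast
      \<comment> \<open>The flat case \<open>\<delta> r = 0\<close> is excluded because a positive
        integral is bounded by a multiple of it. A boundary point of positive height is thereby
        available.\<close>
      have "0 < 8 / 3 * (\<B> / R\<^sub>0) * J_sigma \<sigma> r"
        using J_sigma_pos(1)[OF \<sigma> r(1) rR0(2)] B R0 by simp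
      then have "0 < \<epsilon> / 2 * \<delta> r" using Jr by linarith
      then have \<delta>pos: "0 < \<delta> r" using \<epsilon> by (simp add: zero_less_mult_iff)
      define V where "V = \<Omega> \<inter> Pcyl (2 * r) (2 * r) 0"
      define W where "W = \<Omega> \<inter> Pcyl (r / 4) (r / 4) 0"
      have WV: "W \<subseteq> V" using r by (auto simp: V_def W_def Pcyl_def)
      have V: "norm (fst x) < R\<^sub>0" "F (fst x) < snd x" "norm (fst x) < 2 * r" "0 < snd x" "snd x < 2 * r" if "x \<in> V" for x
      proof -
        have "x \<in> \<Omega> \<inter> Pcyl R\<^sub>0 R\<^sub>0 0" using that rR r by (auto simp: V_def Pcyl_def)
        then show "norm (fst x) < R\<^sub>0" "F (fst x) < snd x" using \<Omega> by auto
        show "norm (fst x) < 2 * r" "0 < snd x" "snd x < 2 * r" using that by (auto simp: V_def Pcyl_def)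
      qed
      have VI: "x \<in> V" if "norm (fst x) < 2 * r" "F (fst x) < snd x" "snd x < 2 * r" for x
      proof -
        have "x \<in> \<Omega> \<inter> Pcyl R\<^sub>0 R\<^sub>0 0" using that rR r \<Omega> by auto
        then show ?thesis using that by (auto simp: V_def Pcyl_def)
      qed
      have VO: "closure V \<subseteq> closure \<Omega>" by (intro closure_mono) (auto simp: V_def)
      have clV0: "norm (fst x) \<le> 2 * r" "0 \<le> snd x" if "x \<in> closure V" for x
      proof -
        have "closure V \<subseteq> {x. norm (fst x) \<le> 2 * r \<and> 0 \<le> snd x}"
          by (intro closure_minimal closed_Collect_conj closed_Collect_le continuous_intros)
            (auto dest: V)
        then show "norm (fst x) \<le> 2 * r" "0 \<le> snd x" using that by auto
      qed
      have clV: "F (fst x) \<le> snd x" if x: "x \<in> closure V" for x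
      proof -
        have cF: "continuous_on (ball 0 R\<^sub>0) F" by (rule convex_on_continuous[OF _ F(1)]) simp
        have "fst x \<in> ball 0 R\<^sub>0" if "x \<in> closure V" for x
          using clV0(1)[OF that] rR r by simp
        then have "continuous_on (closure V) (\<lambda>x. F (fst x) - snd x)"
          by (intro continuous_intros continuous_on_compose2[OF cF]) auto
        then have "F (fst x) - snd x \<le> 0"
          by (rule continuous_le_on_closure[OF _ x]) (auto dest: V(2))
        then show ?thesis by simp
      qed
      have u0: "u x = 0" if "x \<in> closure V" "x \<notin> \<Omega>" for x
      proof (rule bc)
        show "x \<in> frontier \<Omega>"
          using that VO bd by (auto simp: frontier_def bounded_domain_def interior_open)
        have "V \<subseteq> Pcyl R\<^sub>0 R\<^sub>0 0" using rR r by (auto simp: V_def Pcyl_def)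
        then show "x \<in> closure (Pcyl R\<^sub>0 R\<^sub>0 0)" using that closure_mono by blast
      qed
      \<comment> \<open>At this boundary point \<open>u\<close> vanishes and the height is positive,
        so an upper slope of \<open>u\<close> is nonnegative; for \<open>-u\<close> the same
        argument makes a lower slope of \<open>u\<close> nonpositive.\<close>
      define q where "q = (x\<^sub>0, \<delta> r * r)"
      have \<delta>rr: "\<delta> r * r \<le> r" "0 < \<delta> r * r" using \<delta>r \<delta>pos r by (auto simp: mult_left_le_one_le)
      have q: "q \<in> closure V" "q \<notin> \<Omega>" "0 < snd q"
      proof -
        \<comment> \<open>The point is approached from above. The denominators start at 2, so the
          added height is less than \<open>r\<close>, and with \<open>\<delta> r * r \<le> r\<close>
          the sequence stays below height \<open>2 r\<close>.\<close>
        have lim: "(\<lambda>n. (x\<^sub>0, \<delta> r * r + r / real (Suc (Suc n)))) \<longlonglongrightarrow> (x\<^sub>0, \<delta> r * r + 0)"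
        proof (intro tendsto_intros)
          have "(\<lambda>n. r / real n) \<longlonglongrightarrow> 0" by (rule lim_const_over_n)
          then have "(\<lambda>n. r / real (n + 2)) \<longlonglongrightarrow> 0" by (rule LIMSEQ_ignore_initial_segment)
          then show "(\<lambda>n. r / real (Suc (Suc n))) \<longlonglongrightarrow> 0" by (simp add: numeral_2_eq_2)
        qed
        moreover have "(x\<^sub>0, \<delta> r * r + r / real (Suc (Suc n))) \<in> V" for n
        proof (rule VI)
          have "r / real (Suc (Suc n)) < r / 1"
            using r by (intro divide_strict_left_mono) auto
          then show "snd (x\<^sub>0, \<delta> r * r + r / real (Suc (Suc n))) < 2 * r" using \<delta>rr by simp
        qed (use x\<^sub>0 r in auto)
        ultimately show "q \<in> closure V"
          unfolding q_def closure_sequential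
          by (intro exI[of _ "\<lambda>n. (x\<^sub>0, \<delta> r * r + r / real (Suc (Suc n)))"]) simp
        show "0 < snd q" using \<delta>rr by (simp add: q_def)
        show "q \<notin> \<Omega>"
        proof
          assume "q \<in> \<Omega>"
          then have "q \<in> \<Omega> \<inter> Pcyl R\<^sub>0 R\<^sub>0 0" using x\<^sub>0 rR r \<delta>rr by (auto simp: q_def Pcyl_def)
          then show False unfolding \<Omega> by (simp add: q_def x\<^sub>0)
        qed
      qed
      have cl_le: "w x \<le> M * snd x"
        if "continuous_on (closure \<Omega>) w" "\<And>x. x \<in> V \<Longrightarrow> w x \<le> M * snd x" "x \<in> closure V" for w M x
      proof -
        have "continuous_on (closure V) (\<lambda>x. w x - M * snd x)"
          using continuous_on_subset[OF that(1) VO] by (intro continuous_intros)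
        then have "w x - M * snd x \<le> 0"
          by (rule continuous_le_on_closure[OF _ that(3)]) (use that(2) in auto)
        then show ?thesis by simp
      qed
      have nonneg: "0 \<le> M"
        if "continuous_on (closure \<Omega>) w" "\<And>x. x \<in> V \<Longrightarrow> w x \<le> M * snd x" "w q = 0" for w M
        using cl_le[OF that(1,2) q(1)] that(3) q(3) by (simp add: zero_le_mult_iff)
      define \<beta> where "\<beta> \<rho> = \<B> * \<sigma> (\<rho> / R\<^sub>0)" for \<rho>
      \<comment> \<open>The factor \<open>4/3\<close> undoes the \<open>3/4\<close> of
        \<open>J_sigma_step\<close>, and \<open>\<B> / R\<^sub>0\<close> comes from
        \<open>\<sigma> (t / R\<^sub>0) \<le> \<sigma> t / R\<^sub>0\<close>.\<close>
      define J where "J t = 4 / 3 * (\<B> / R\<^sub>0) * J_sigma \<sigma> t" for t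
      have \<beta>_le: "\<beta> t \<le> (\<B> / R\<^sub>0) * \<sigma> t" if "0 < t" "t \<le> 2 * r" for t
      proof -
        have "\<sigma> (t / R\<^sub>0) \<le> (t / R\<^sub>0) / t * \<sigma> t"
          using that R0 rR r by (intro class_D1_scale[OF \<sigma>]) (auto simp: field_simps)
        also have "\<dots> = (1 / R\<^sub>0) * \<sigma> t" using that by simp
        finally have "\<B> * \<sigma> (t / R\<^sub>0) \<le> \<B> * ((1 / R\<^sub>0) * \<sigma> t)" using B by (intro mult_left_mono) auto
        then show ?thesis by (simp add: \<beta>_def)
      qed
      have \<sigma>_mono: "0 \<le> \<sigma> s \<and> \<sigma> s \<le> \<sigma> t" if "0 \<le> s" "s \<le> t" "t \<le> 1" for s t
        using \<sigma> that by (auto simp: class_D1_def intro: mono_onD)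
      \<comment> \<open>Doubling the argument of \<sigma> costs a factor 2, and passing to the
        integral costs \<open>4/3\<close>: this is the \<open>8/3\<close> in
        \<open>Good\<close>.\<close>
      have \<beta>2r: "\<beta> (2 * r) \<le> \<epsilon> / 2 * \<delta> r"
      proof -
        have "\<sigma> (2 * r) \<le> (2 * r) / r * \<sigma> r"
          using r rR R0 by (intro class_D1_scale[OF \<sigma>]) auto
        also have "\<dots> \<le> 2 * (4 / 3 * J_sigma \<sigma> r)"
          using J_sigma_pos(2)[OF \<sigma> r(1) rR0(2)] r by simp
        finally have "(\<B> / R\<^sub>0) * \<sigma> (2 * r) \<le> (\<B> / R\<^sub>0) * (2 * (4 / 3 * J_sigma \<sigma> r))"
          using B R0 by (intro mult_left_mono) auto
        then show ?thesis using \<beta>_le[of "2 * r"] r Jr by simp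
      qed
      have \<epsilon>\<delta>: "\<epsilon> / 2 * \<delta> r \<le> \<epsilon> / 2" "\<epsilon> / 2 * \<delta> r \<le> \<epsilon> * \<delta> r"
        using \<epsilon> \<delta>r \<delta>pos by (auto simp: mult_left_le)
      have Jle: "J (r / 64) \<le> \<epsilon> * \<delta> r"
      proof -
        have "J_sigma \<sigma> (r / 64) \<le> J_sigma \<sigma> r"
          using J_sigma_pos(3)[OF \<sigma>, of r] J_sigma_pos(3)[OF \<sigma>, of "r / 4"] J_sigma_pos(3)[OF \<sigma>, of "r / 16"] r rR0
          by simp
        then have "4 / 3 * (\<B> / R\<^sub>0) * J_sigma \<sigma> (r / 64) \<le> 8 / 3 * (\<B> / R\<^sub>0) * J_sigma \<sigma> r"
          using B R0 J_sigma_pos(1)[OF \<sigma>, of "r / 64"] r rR0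
          by (intro mult_mono mult_right_mono) auto
        then show ?thesis using Jr \<epsilon>\<delta> unfolding J_def by linarith
      qed
      have key: "w x \<le> (M - \<kappa>\<^sub>1 * \<delta> r * M) * snd x"
        if solw: "strong_solution Xn \<Omega> a b w" and cw: "continuous_on (closure \<Omega>) w"
          and w0: "\<And>x. x \<in> closure V \<Longrightarrow> x \<notin> \<Omega> \<Longrightarrow> w x = 0"
          and wM: "\<And>x. x \<in> V \<Longrightarrow> w x \<le> M * snd x" and wm: "\<And>x. x \<in> V \<Longrightarrow> m * snd x \<le> w x"
          and x: "x \<in> W" for w M m x
      proof -
        have M: "0 \<le> M" using nonneg[OF cw wM] w0 q by blast
        have "\<kappa>\<^sub>1 * \<delta> r * M * snd x \<le> M * snd x - w x"
        proof (rule improve[OF bd r(1) ell b solw cw M wM[unfolded V_def], where \<beta> = \<beta> and J = J and y\<^sub>0 = y\<^sub>0])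
          fix y assume "y \<in> closure (\<Omega> \<inter> Pcyl (2 * r) (2 * r) 0)" "y \<notin> \<Omega> \<inter> Pcyl (2 * r) (2 * r) 0"
            "norm (fst y) < 2 * r" "snd y < 2 * r"
          then have y: "y \<in> closure V" "y \<notin> \<Omega> \<or> snd y \<le> 0"
            by (auto simp: V_def Pcyl_def)
          \<comment> \<open>The description of \<Omega> concerns positive heights, so a limit point
            of \<open>V\<close> at height 0 may lie inside \<Omega>. There \<open>w\<close> is
            squeezed between \<open>m x_n\<close> and \<open>M x_n\<close>, both 0.\<close>
          show "w y = 0"
          proof (cases "y \<in> \<Omega>")
            case True
            then have "snd y = 0" using y clV0(2)[OF y(1)] by auto
            moreover have "w y \<le> M * snd y" by (rule cl_le[OF cw wM y(1)])
            moreover have "- w y \<le> (- m) * snd y"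
              using cw wm by (intro cl_le[OF _ _ y(1)]) (auto intro: continuous_intros)
            ultimately show ?thesis by simp
          qed (use w0 y in blast)
        next
          show "X_modulus Xn \<Omega> (\<lambda>x. norm (fst (b x))) (6 * r) \<le> ennreal (\<epsilon> / 2)"
            using \<mu>r \<mu>[of "6 * r"] r by simp
        next
          fix \<rho> :: real and c :: 'a assume \<rho>: "0 < \<rho>" "\<rho> \<le> 2 * r" "norm c \<le> 2 * r"
          \<comment> \<open>The supremum runs over points of a cylinder although the norm sees only
            \<open>x'\<close>; \<open>R\<^sub>0 / 4\<close> is an admissible height.\<close>
          have "(c, R\<^sub>0 / 4) \<in> Pcyl (R\<^sub>0/2) (R\<^sub>0/2) 0"
            using \<rho> rR R0 by (auto simp: Pcyl_def)
          then have "Xn (Pcyl \<rho> \<rho> (fst (c, R\<^sub>0 / 4)) \<inter> \<Omega>) (\<lambda>y. snd (b y))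
              \<le> (SUP x\<in>Pcyl (R\<^sub>0/2) (R\<^sub>0/2) 0. Xn (Pcyl \<rho> \<rho> (fst x) \<inter> \<Omega>) (\<lambda>y. snd (b y)))"
            by (rule SUP_upper)
          also have "\<dots> \<le> ennreal (\<beta> \<rho>)"
            unfolding \<beta>_def using \<rho> rR r by (intro bn) auto
          finally show "Xn (Pcyl \<rho> \<rho> c \<inter> \<Omega>) (\<lambda>x. snd (b x)) \<le> ennreal (\<beta> \<rho>)" by simp
        next
          fix \<rho> :: real assume \<rho>: "0 < \<rho>" "\<rho> \<le> 2 * r"
          have "0 \<le> \<sigma> (\<rho> / R\<^sub>0) \<and> \<sigma> (\<rho> / R\<^sub>0) \<le> \<sigma> (2 * r / R\<^sub>0)"
            using \<rho> R0 rR r by (intro \<sigma>_mono) (auto simp: field_simps)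
          then have "0 \<le> \<beta> \<rho> \<and> \<beta> \<rho> \<le> \<beta> (2 * r)"
            unfolding \<beta>_def using B by (auto intro: mult_left_mono)
          then show "0 \<le> \<beta> \<rho> \<and> \<beta> \<rho> \<le> \<epsilon> / 2"
            using \<beta>2r \<epsilon>\<delta> by linarith
        next
          show "\<beta> (2 * r) \<le> \<epsilon> * \<delta> r" using \<beta>2r \<epsilon>\<delta> by linarith
        next
          fix t :: real assume t: "0 < t" "t \<le> r"
          then have t1: "t \<le> 1" "t \<le> 2 * r" using rR0 by auto
          have "(\<B> / R\<^sub>0) * (J_sigma \<sigma> (t / 4) + 3 / 4 * \<sigma> t) \<le> (\<B> / R\<^sub>0) * J_sigma \<sigma> t"
            using J_sigma_step(1)[OF \<sigma> t(1) t1(1)] B R0 by (intro mult_left_mono) auto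
          then show "J (t / 4) + \<beta> t \<le> J t"
            using \<beta>_le[OF t(1) t1(2)] by (simp add: J_def algebra_simps)
          show "0 \<le> J t"
            using J_sigma_step(2)[OF \<sigma> t(1) t1(1)] B R0 by (simp add: J_def)
        next
          fix y assume y: "y \<in> closure (\<Omega> \<inter> Pcyl (2 * r) (2 * r) 0)" "norm (fst y - y\<^sub>0) < r / 4"
          have yV: "y \<in> closure V" using y by (simp add: V_def)
          have "\<delta> r * r \<le> F (fst y)"
            using y clV0(1)[OF yV] rR r by (intro y\<^sub>0) auto
          also have "\<dots> \<le> snd y" by (rule clV[OF yV])
          finally show "\<delta> r * r \<le> snd y" .
        qed (use Jle \<delta>r \<delta>pos y\<^sub>0 x in \<open>auto simp: W_def\<close>)
        then show ?thesis by (simp add: algebra_simps)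
      qed
      define v where "v x = u x / snd x" for x
      have vV: "x \<in> V \<Longrightarrow> u x = v x * snd x" for x using V(4)[of x] by (simp add: v_def)
      have "(0, r / 8) \<in> W" using VI[of "(0, r / 8)"] F r by (auto simp: V_def W_def Pcyl_def)
      then have neW: "(0, r / 8) \<in> W" "(0, r / 8) \<in> V" using WV by auto
      define S where "S = (SUP x\<in>V. ereal (v x))"
      define I where "I = (INF x\<in>V. ereal (v x))"
      have S: "x \<in> V \<Longrightarrow> ereal (v x) \<le> S" and I: "x \<in> V \<Longrightarrow> I \<le> ereal (v x)" for x
        by (auto simp: S_def I_def intro: SUP_upper INF_lower)
      have "\<kappa> * \<delta> r \<le> \<kappa> * 1" using \<kappa> \<delta>r by (intro mult_left_mono) auto
      then have pos: "0 < 1 - \<kappa> * \<delta> r" using \<kappa> by linarith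
      have "osc W v \<le> ereal (1 - \<kappa> * \<delta> r) * osc V v"
      proof (cases "S = \<infinity> \<or> I = - \<infinity>")
        \<comment> \<open>An infinite oscillation over \<open>V\<close> makes the right-hand side
          infinite, as its factor is positive.\<close>
        case True
        then have "osc V v = \<infinity>"
          using S[OF neW(2)] I[OF neW(2)] unfolding osc_def S_def[symmetric] I_def[symmetric] by auto
        then show ?thesis using pos by simp
      next
        case False
        then obtain M m where Mm: "S = ereal M" "I = ereal m"
          using S[OF neW(2)] I[OF neW(2)] by (cases S; cases I) auto
        have vM: "v x \<le> M" "m \<le> v x" if "x \<in> V" for x
          using S[OF that] I[OF that] Mm by auto
        have uM: "u x \<le> M * snd x" "m * snd x \<le> u x" if "x \<in> V" for x
          using vM[OF that] V(4)[OF that] vV[OF that] by (auto intro: mult_right_mono)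
        have cmu: "continuous_on (closure \<Omega>) (\<lambda>x. - u x)" using cu by (intro continuous_intros)
        have M0: "0 \<le> M" by (rule nonneg[OF cu uM(1) u0[OF q(1,2)]])
        have m0: "0 \<le> - m"
          by (rule nonneg[OF cmu]) (use uM u0[OF q(1,2)] in auto)
        have "\<exists>M' m'. (\<forall>x\<in>W. m' \<le> v x \<and> v x \<le> M') \<and> M' - m' \<le> (1 - \<kappa> * \<delta> r) * (M - m)"
        proof (cases "(M - m) / 2 \<le> M")
          case True
          have "(\<kappa> * \<delta> r) * (M - m) \<le> (\<kappa>\<^sub>1 / 2 * \<delta> r) * (2 * M)"
            using True \<kappa> \<delta>pos M0 m0 by (intro mult_mono mult_right_mono) auto
          moreover have "m \<le> v x \<and> v x \<le> M - \<kappa>\<^sub>1 * \<delta> r * M" if x: "x \<in> W" for x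
          proof -
            have "u x \<le> (M - \<kappa>\<^sub>1 * \<delta> r * M) * snd x"
              by (rule key[OF sol cu u0 uM x])
            then show ?thesis using x WV V(4)[of x] vM(2)[of x] by (auto simp: v_def divide_le_eq)
          qed
          ultimately show ?thesis
            by (intro exI[of _ "M - \<kappa>\<^sub>1 * \<delta> r * M"] exI[of _ m]) (auto simp: algebra_simps)
        next
          case False
          have "(\<kappa> * \<delta> r) * (M - m) \<le> (\<kappa>\<^sub>1 / 2 * \<delta> r) * (2 * (- m))"
            using False \<kappa> \<delta>pos M0 m0 by (intro mult_mono mult_right_mono) auto
          moreover have "m - \<kappa>\<^sub>1 * \<delta> r * m \<le> v x \<and> v x \<le> M" if x: "x \<in> W" for x
          proof -
            have "- u x \<le> (- m - \<kappa>\<^sub>1 * \<delta> r * (- m)) * snd x"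
              \<comment> \<open>For \<open>-u\<close> the slopes exchange roles: the upper one is
                \<open>- m\<close> and the lower one \<open>- M\<close>.\<close>
              by (rule key[OF strong_solution_minus[OF X sol] cmu _ _ _ x, where m = "- M"]) (use u0 uM in auto)
            then have "(m - \<kappa>\<^sub>1 * \<delta> r * m) * snd x \<le> u x" by (simp add: algebra_simps)
            then show ?thesis using x WV V(4)[of x] vM(1)[of x] by (auto simp: v_def le_divide_eq)
          qed
          ultimately show ?thesis
            by (intro exI[of _ M] exI[of _ "m - \<kappa>\<^sub>1 * \<delta> r * m"]) (auto simp: algebra_simps)
        qed
        then obtain M' m' where M': "\<And>x. x \<in> W \<Longrightarrow> m' \<le> v x \<and> v x \<le> M'"
          and le: "M' - m' \<le> (1 - \<kappa> * \<delta> r) * (M - m)" by blast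
        have "osc W v \<le> ereal M' - ereal m'"
          unfolding osc_def using M' by (intro ereal_minus_mono SUP_least INF_greatest) auto
        also have "\<dots> \<le> ereal ((1 - \<kappa> * \<delta> r) * (M - m))" using le by simp
        also have "\<dots> = ereal (1 - \<kappa> * \<delta> r) * osc V v"
          unfolding osc_def S_def[symmetric] I_def[symmetric] Mm by simp
        finally show ?thesis .
      qed
      then show ?case
        by (simp only: V_def W_def v_def[abs_def])
    qed
  qed
qed

end
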